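(* Let $\Omega\subset\mathbb{R}^2$ be a bounded Lipschitz domain, $K\subset\Omega$ a measurable set of positive measure, $t>1$, $f\in L^t(K)$ and $\lambda>0$. Let $\mathcal{D}: W^{1,2}(\Omega)\to C^0(\overline{\Omega},\mathbb{R}^{2\times 2}_{sym,+})$ be a continuous mapping such that for every $R>0$ the set $\mathcal{D}(\mathcal{B}_R^K)$ is precompact in $C^0(\overline{\Omega},\mathbb{R}^{2\times 2}_{sym,+})$. Let $T: W^{1,2}(\Omega)\to W^{1,2}(\Omega)$ be the operator which assigns to $w$ the unique minimizer $T(w)$ in $W^{1,2}(\Omega)$ of $$v\mapsto J[w,v,f]:=\frac12\int_\Omega\mathcal{D}(w)\nabla v\cdot\nabla v\,dx+\lambda\int_K|v-f|^t\,dx .$$ If $R>0$ is sufficiently large, then $T$ has at least one fixed point in $\mathcal{B}_R^K$.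
   Context: $\mathbb{R}^{2\times 2}_{sym,+}$ denotes the set of real symmetric $2\times2$ matrices $F$ with $FQ\cdot Q>0$ for all $Q\in\mathbb{R}^2$, $Q\neq 0$. $C^0(\overline{\Omega},\mathbb{R}^{2\times 2}_{sym,+})$ is the set of continuous maps $\overline{\Omega}\to\mathbb{R}^{2\times 2}_{sym,+}$ with the topology of uniform convergence. A subset is precompact in this space if every sequence in it has a subsequence converging uniformly on $\overline{\Omega}$ to an element of $C^0(\overline{\Omega},\mathbb{R}^{2\times 2}_{sym,+})$ (so the limit is again pointwise positive definite). For $R>0$, the ``data ball'' is $\mathcal{B}_R^K:=\{w\in W^{1,2}(\Omega):\ \|w\|_{L^t(K)}\le R\}$. Elements of $W^{1,2}(\Omega)$ are real-valued. *)

theory Defs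
  imports "HOL-Analysis.Analysis"
begin

definition lipschitz_domain :: "(real^2) set \<Rightarrow> bool" where
  "lipschitz_domain \<Omega> \<longleftrightarrow> open \<Omega> \<and> connected \<Omega> \<and> \<Omega> \<noteq> {} \<and>
     (\<forall>p \<in> frontier \<Omega>. \<exists>r>0. \<exists>(A :: real^2 \<Rightarrow> real^2) (\<gamma> :: real \<Rightarrow> real) L.
        orthogonal_transformation A \<and> L-lipschitz_on UNIV \<gamma> \<and>
        \<Omega> \<inter> ball p r = {x \<in> ball p r. \<gamma> (A x $ 1) < A x $ 2})"


text \<open>
  Elements of Lebesgue and Sobolev spaces are represented by functions on the whole type, of which
  only the values on the underlying set matter; equality in these spaces is equality almost
  everywhere.
\<close>

definition ae_eq :: "(real^2) set \<Rightarrow> (real^2 \<Rightarrow> 'b) \<Rightarrow> (real^2 \<Rightarrow> 'b) \<Rightarrow> bool" where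
  "ae_eq S u v \<longleftrightarrow> (AE x in lebesgue_on S. u x = v x)"

definition Lp :: "real \<Rightarrow> (real^2) set \<Rightarrow> (real^2 \<Rightarrow> 'b::euclidean_space) set" where
  "Lp p S = {u \<in> borel_measurable (lebesgue_on S).
               integrable (lebesgue_on S) (\<lambda>x. norm (u x) powr p)}"

definition Lp_norm :: "real \<Rightarrow> (real^2) set \<Rightarrow> (real^2 \<Rightarrow> 'b::euclidean_space) \<Rightarrow> real" where
  "Lp_norm p S u = (\<integral>x. norm (u x) powr p \<partial>lebesgue_on S) powr (1 / p)"


definition partial_deriv :: "2 \<Rightarrow> (real^2 \<Rightarrow> real) \<Rightarrow> real^2 \<Rightarrow> real" where
  "partial_deriv i \<phi> x = frechet_derivative \<phi> (at x) (axis i 1)"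

primrec Ck :: "nat \<Rightarrow> (real^2 \<Rightarrow> real) \<Rightarrow> bool" where
  "Ck 0 \<phi> \<longleftrightarrow> continuous_on UNIV \<phi>"
| "Ck (Suc k) \<phi> \<longleftrightarrow> (\<forall>x. \<phi> differentiable (at x)) \<and> (\<forall>i. Ck k (partial_deriv i \<phi>))"

definition test_functions :: "(real^2) set \<Rightarrow> (real^2 \<Rightarrow> real) set" where
  "test_functions \<Omega> = {\<phi>. (\<forall>k. Ck k \<phi>) \<and>
     compact (closure {x. \<phi> x \<noteq> 0}) \<and> closure {x. \<phi> x \<noteq> 0} \<subseteq> \<Omega>}"

text \<open>
  Square integrability of \<open>g\<close> is part of the definition: the Bochner integral of a
  non-integrable function is 0, so the bare integral identity would not determine \<open>g\<close>.
\<close>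

definition has_weak_gradient ::
    "(real^2) set \<Rightarrow> (real^2 \<Rightarrow> real) \<Rightarrow> (real^2 \<Rightarrow> real^2) \<Rightarrow> bool" where
  "has_weak_gradient \<Omega> u g \<longleftrightarrow> u \<in> Lp 2 \<Omega> \<and> g \<in> Lp 2 \<Omega> \<and>
     (\<forall>\<phi> \<in> test_functions \<Omega>. \<forall>i.
        (\<integral>x. u x * partial_deriv i \<phi> x \<partial>lebesgue_on \<Omega>) = - (\<integral>x. (g x $ i) * \<phi> x \<partial>lebesgue_on \<Omega>))"

definition W12 :: "(real^2) set \<Rightarrow> (real^2 \<Rightarrow> real) set" where
  "W12 \<Omega> = {u. \<exists>g. has_weak_gradient \<Omega> u g}"

text \<open>The weak gradient is determined up to null sets; an arbitrary representative is chosen.\<close>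

definition weak_gradient :: "(real^2) set \<Rightarrow> (real^2 \<Rightarrow> real) \<Rightarrow> real^2 \<Rightarrow> real^2" where
  "weak_gradient \<Omega> u = (SOME g. has_weak_gradient \<Omega> u g)"

definition W12_norm :: "(real^2) set \<Rightarrow> (real^2 \<Rightarrow> real) \<Rightarrow> real" where
  "W12_norm \<Omega> u = sqrt ((Lp_norm 2 \<Omega> u)\<^sup>2 + (Lp_norm 2 \<Omega> (weak_gradient \<Omega> u))\<^sup>2)"


definition sym_pos :: "(real^2^2) set" where
  "sym_pos = {F. transpose F = F \<and> (\<forall>Q. Q \<noteq> 0 \<longrightarrow> (F *v Q) \<bullet> Q > 0)}"

definition C0_sym_pos :: "(real^2) set \<Rightarrow> (real^2 \<Rightarrow> real^2^2) set" where
  "C0_sym_pos \<Omega> = {F. continuous_on (closure \<Omega>) F \<and> F ` closure \<Omega> \<subseteq> sym_pos}"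

definition precompact_C0 :: "(real^2) set \<Rightarrow> (real^2 \<Rightarrow> real^2^2) set \<Rightarrow> bool" where
  "precompact_C0 \<Omega> S \<longleftrightarrow> S \<subseteq> C0_sym_pos \<Omega> \<and>
     (\<forall>G::nat \<Rightarrow> real^2 \<Rightarrow> real^2^2. range G \<subseteq> S \<longrightarrow>
        (\<exists>F \<in> C0_sym_pos \<Omega>. \<exists>r::nat \<Rightarrow> nat. strict_mono r \<and>
           uniform_limit (closure \<Omega>) (G \<circ> r) F sequentially))"

text \<open>
  Continuity with respect to the Sobolev norm forces \<open>\<D>\<close> to take equal values (on the closure of
  \<open>\<Omega>\<close>) at functions that agree almost everywhere, so \<open>\<D>\<close> is a map on the space of classes.
\<close>

definition continuous_W12_C0 ::
    "(real^2) set \<Rightarrow> ((real^2 \<Rightarrow> real) \<Rightarrow> real^2 \<Rightarrow> real^2^2) \<Rightarrow> bool" where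
  "continuous_W12_C0 \<Omega> \<D> \<longleftrightarrow>
     (\<forall>w \<in> W12 \<Omega>. \<forall>\<epsilon>>0. \<exists>\<delta>>0. \<forall>v \<in> W12 \<Omega>. W12_norm \<Omega> (\<lambda>x. v x - w x) < \<delta> \<longrightarrow>
        (\<forall>x \<in> closure \<Omega>. norm (\<D> v x - \<D> w x) < \<epsilon>))"

definition data_ball :: "(real^2) set \<Rightarrow> (real^2) set \<Rightarrow> real \<Rightarrow> real \<Rightarrow> (real^2 \<Rightarrow> real) set" where
  "data_ball \<Omega> K t R = {w \<in> W12 \<Omega>. w \<in> Lp t K \<and> Lp_norm t K w \<le> R}"

text \<open>
  Both integrands are nonnegative, and the functional is taken with values in \<open>[0,\<infinity>]\<close>, so that a
  divergent integral counts as \<open>\<infinity>\<close> and not as the default value 0 of the Bochner integral.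
\<close>

definition J_functional ::
    "(real^2) set \<Rightarrow> (real^2) set \<Rightarrow> real \<Rightarrow> real \<Rightarrow> ((real^2 \<Rightarrow> real) \<Rightarrow> real^2 \<Rightarrow> real^2^2) \<Rightarrow>
     (real^2 \<Rightarrow> real) \<Rightarrow> (real^2 \<Rightarrow> real) \<Rightarrow> (real^2 \<Rightarrow> real) \<Rightarrow> ennreal" where
  "J_functional \<Omega> K t lam \<D> w v f =
     ennreal (1/2) * (\<integral>\<^sup>+x. ennreal ((\<D> w x *v weak_gradient \<Omega> v x) \<bullet> weak_gradient \<Omega> v x) \<partial>lebesgue_on \<Omega>)
     + ennreal lam * (\<integral>\<^sup>+x. ennreal (\<bar>v x - f x\<bar> powr t) \<partial>lebesgue_on K)"

definition is_unique_minimizer ::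
    "(real^2) set \<Rightarrow> ((real^2 \<Rightarrow> real) \<Rightarrow> ennreal) \<Rightarrow> (real^2 \<Rightarrow> real) \<Rightarrow> bool" where
  "is_unique_minimizer \<Omega> E v \<longleftrightarrow> is_arg_min E (\<lambda>u. u \<in> W12 \<Omega>) v \<and>
     (\<forall>v'. is_arg_min E (\<lambda>u. u \<in> W12 \<Omega>) v' \<longrightarrow> ae_eq \<Omega> v' v)"

end

theory Submission
  imports Defs
begin

text \<open>
  Comparing a minimizer \<open>v\<close> with \<open>0\<close> gives \<open>\<parallel>v\<parallel> \<le> 2 \<parallel>f\<parallel>\<close> in \<open>L\<^sup>t(K)\<close>, so \<open>T\<close> maps every data ball of radius
  at least \<open>2 \<parallel>f\<parallel>\<close> into itself, and the claim follows from Schauder's theorem once \<open>T\<close> is known to be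
  continuous with relatively compact image on the ball. Both reduce to one fact: minimizers for
  uniformly converging coefficients converge strongly in \<open>W\<^sup>1\<^sup>,\<^sup>2\<close>. They form a minimizing sequence for the
  limit functional, and the gradients of a minimizing sequence are Cauchy in \<open>L\<^sup>2\<close> by the parallelogram
  identity; by the Poincare inequality only the mean values over a subset of \<open>K\<close>, a bounded sequence of
  reals, remain to be controlled.

  The Poincare inequality is derived from the estimate of the difference \<open>u(x + h) - u(x)\<close> in \<open>L\<^sup>2\<close> by
  \<open>|h| \<parallel>\<nabla>u\<parallel>\<close>, which is obtained by duality with test functions, without mollification.
\<close>


subsection \<open>Smooth functions\<close>

text \<open>A sequence in a data ball need not be bounded in W^{1,2}, so compactness has to come
  from \<open>\<D>\<close>: along a subsequence the coefficients converge uniformly, and positive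
  definiteness of the limit on the compact closure of \<open>\<Omega>\<close> makes the limit
  functional elliptic. This limit need not be a value of \<open>\<D>\<close>. Minimizers are
  therefore studied for arbitrary coefficients \<open>F\<close> in
  \<open>C0_sym_pos \<Omega>\<close>, and the limit of the values of \<open>T\<close> is found as
  the minimizer for \<open>F\<close>.

  Functions equal almost everywhere are not identified, so the Sobolev norm is a seminorm on a set
  of functions. Schauder's theorem is proved in this setting and yields a point at distance 0 from
  its image. Its finite-dimensional step takes place in a cube whose dimension is known only inside
  the proof, hence Brouwer's theorem in coordinates indexed by natural numbers.

  The mean in the Poincare inequality is taken over a part of \<open>K\<close> because only there
  does the functional control \<open>v\<close> itself and not merely its gradient.\<close>

lemma partial_deriv_eq:
  assumes "(\<phi> has_derivative D) (at x)"
  shows "partial_deriv i \<phi> x = D (axis i 1)"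
  unfolding partial_deriv_def using frechet_derivative_at[OF assms] by simp

lemma Ck_SucD: "Ck (Suc k) \<phi> \<Longrightarrow> Ck k \<phi>"
proof (induction k arbitrary: \<phi>)
  case 0
  then show ?case
    by (auto intro!: continuous_at_imp_continuous_on differentiable_imp_continuous_within)
next
  case (Suc k)
  from Suc.prems have "\<forall>x. \<phi> differentiable (at x)" "\<And>i. Ck (Suc k) (partial_deriv i \<phi>)"
    by auto
  with Suc.IH show ?case by auto
qed

lemma Ck_const: "Ck k (\<lambda>x. c)"
proof (induction k arbitrary: c)
  case (Suc k)
  have "partial_deriv i (\<lambda>x. c) = (\<lambda>x. 0)" for i
    by (rule ext, subst partial_deriv_eq[OF has_derivative_const]) simp
  with Suc show ?case by simp
qed simp

lemma Ck_add: "Ck k \<phi> \<Longrightarrow> Ck k \<psi> \<Longrightarrow> Ck k (\<lambda>x. \<phi> x + \<psi> x)"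
proof (induction k arbitrary: \<phi> \<psi>)
  case 0 then show ?case by (auto intro: continuous_intros)
next
  case (Suc k)
  then have d: "\<And>x. \<phi> differentiable (at x)" "\<And>x. \<psi> differentiable (at x)" by auto
  have "partial_deriv i (\<lambda>x. \<phi> x + \<psi> x) = (\<lambda>x. partial_deriv i \<phi> x + partial_deriv i \<psi> x)" for i
    by (rule ext, subst partial_deriv_eq[OF has_derivative_add[OF
         d(1)[unfolded frechet_derivative_works] d(2)[unfolded frechet_derivative_works]]])
       (simp add: partial_deriv_def)
  with Suc d show ?case by auto
qed

lemma Ck_mult: "Ck k \<phi> \<Longrightarrow> Ck k \<psi> \<Longrightarrow> Ck k (\<lambda>x. \<phi> x * \<psi> x)"
proof (induction k arbitrary: \<phi> \<psi>)
  case 0 then show ?case by (auto intro: continuous_intros)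
next
  case (Suc k)
  then have d: "\<And>x. \<phi> differentiable (at x)" "\<And>x. \<psi> differentiable (at x)" by auto
  have "partial_deriv i (\<lambda>x. \<phi> x * \<psi> x) =
      (\<lambda>x. \<phi> x * partial_deriv i \<psi> x + partial_deriv i \<phi> x * \<psi> x)" for i
    by (rule ext, subst partial_deriv_eq[OF has_derivative_mult[OF
         d(1)[unfolded frechet_derivative_works] d(2)[unfolded frechet_derivative_works]]])
       (simp add: partial_deriv_def)
  moreover have "Ck k \<phi>" "Ck k \<psi>"
    using Suc.prems Ck_SucD by blast+
  ultimately show ?case using Suc d by (auto intro!: Ck_add)
qed

lemma Ck_prod: "(\<And>i. i \<in> I \<Longrightarrow> Ck k (\<phi> i)) \<Longrightarrow> Ck k (\<lambda>x. \<Prod>i\<in>I. \<phi> i x)"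
  by (induction I rule: infinite_finite_induct) (auto intro: Ck_const Ck_mult)

lemma Ck_power: "Ck k \<phi> \<Longrightarrow> Ck k (\<lambda>x. \<phi> x ^ n)"
  by (induction n) (auto intro: Ck_const Ck_mult)

lemma Ck_diff: "Ck k \<phi> \<Longrightarrow> Ck k \<psi> \<Longrightarrow> Ck k (\<lambda>x. \<phi> x - \<psi> x)"
  using Ck_add[of k \<phi> "\<lambda>x. (-1) * \<psi> x"] Ck_mult[OF Ck_const[of k "-1"]] by simp

lemma partial_deriv_translate:
  assumes "\<And>x. \<phi> differentiable (at x)"
  shows "((\<lambda>x. \<phi> (x - h)) has_derivative frechet_derivative \<phi> (at (x - h))) (at x)"
    and "partial_deriv i (\<lambda>x. \<phi> (x - h)) = (\<lambda>x. partial_deriv i \<phi> (x - h))"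
proof -
  show *: "((\<lambda>x. \<phi> (x - h)) has_derivative frechet_derivative \<phi> (at (x - h))) (at x)" for x
  proof -
    have "((\<lambda>x. x - h) has_derivative (\<lambda>v. v)) (at x)"
      by (auto intro!: derivative_eq_intros)
    from has_derivative_compose[OF this assms[of "x - h", unfolded frechet_derivative_works]]
    show ?thesis .
  qed
  show "partial_deriv i (\<lambda>x. \<phi> (x - h)) = (\<lambda>x. partial_deriv i \<phi> (x - h))"
    by (rule ext, subst partial_deriv_eq[OF *]) (simp add: partial_deriv_def)
qed

lemma Ck_translate: "Ck k \<phi> \<Longrightarrow> Ck k (\<lambda>x. \<phi> (x - h))"
proof (induction k arbitrary: \<phi>)
  case 0 then show ?case by (auto intro!: continuous_on_compose2[of UNIV \<phi>] continuous_intros)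
next
  case (Suc k)
  then have d: "\<And>x. \<phi> differentiable (at x)" by auto
  have "(\<lambda>x. \<phi> (x - h)) differentiable (at x)" for x
    using partial_deriv_translate(1)[OF d] unfolding differentiable_def by blast
  then show ?case using Suc partial_deriv_translate(2)[OF d] by auto
qed

text \<open>A sequence \<open>H\<close> of successive derivatives stands for a smooth function of
  one variable. A partial derivative of \<open>H n\<close> composed with an affine map is a constant
  times \<open>H (Suc n)\<close> composed with the same map, so the induction on \<open>k\<close>
  closes when \<open>n\<close> is left arbitrary.\<close>

lemma Ck_compose_linear:
  fixes H :: "nat \<Rightarrow> real \<Rightarrow> real"
  assumes H: "\<And>n x. (H n has_field_derivative H (Suc n) x) (at x)" and L: "bounded_linear L"
  shows "Ck k (\<lambda>x. H n (L x + c))"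
proof (induction k arbitrary: n)
  case 0
  have "continuous_on UNIV (H n)"
    using H by (auto intro!: continuous_at_imp_continuous_on DERIV_isCont)
  moreover have "continuous_on UNIV (\<lambda>x. L x + c)"
    by (intro continuous_intros linear_continuous_on L)
  ultimately show ?case using continuous_on_compose2[of UNIV "H n"] by auto
next
  case (Suc k)
  have D: "((\<lambda>x. H n (L x + c)) has_derivative (\<lambda>v. L v * H (Suc n) (L x + c))) (at x)" for x
  proof -
    have "((\<lambda>x. L x + c) has_derivative L) (at x)"
      using bounded_linear_imp_has_derivative[OF L, of "at x"] by (auto intro!: derivative_eq_intros)
    from has_derivative_compose[OF this H[of n "L x + c", unfolded has_field_derivative_def]]
    show ?thesis by (simp add: mult.commute[of "H (Suc n) (L x + c)"])
  qed
  have "partial_deriv i (\<lambda>x. H n (L x + c)) = (\<lambda>x. L (axis i 1) * H (Suc n) (L x + c))" for i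
    by (rule ext, rule partial_deriv_eq[OF D])
  with D Suc show ?case by (auto simp: differentiable_def intro!: Ck_mult Ck_const)
qed

lemma Ck_linear: "bounded_linear L \<Longrightarrow> Ck k L"
proof -
  assume L: "bounded_linear L"
  define H :: "nat \<Rightarrow> real \<Rightarrow> real"
    where "H n = (if n = 0 then (\<lambda>x. x) else if n = 1 then (\<lambda>x. 1) else (\<lambda>x. 0))" for n
  have "(H n has_field_derivative H (Suc n) x) (at x)" for n x
    by (auto simp: H_def intro!: derivative_eq_intros)
  from Ck_compose_linear[of H, OF this L, of k 0 0] show ?thesis by (simp add: H_def)
qed

lemma Ck_real_polynomial: "real_polynomial_function p \<Longrightarrow> Ck k p"
  by (induction rule: real_polynomial_function.induct) (auto intro: Ck_linear Ck_const Ck_add Ck_mult)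

section \<open>Bump functions and smooth cutoffs\<close>

text \<open>Differentiating p(1/x) exp(-1/x) yields (p - p')(1/x) exp(-1/x) / x^2; the factor
  \<open>[:0, 0, 1:]\<close> is this 1/x^2, read as a polynomial in 1/x.\<close>

primrec bump_poly :: "nat \<Rightarrow> real poly" where
  "bump_poly 0 = 1"
| "bump_poly (Suc n) = [:0, 0, 1:] * (bump_poly n - pderiv (bump_poly n))"

text \<open>\<open>flat n\<close> is the \<open>n\<close>-th derivative of \<open>exp (- 1 / x)\<close>, extended by 0 to the left half line.\<close>

definition flat :: "nat \<Rightarrow> real \<Rightarrow> real" where
  "flat n x = (if x > 0 then poly (bump_poly n) (1 / x) * exp (- (1 / x)) else 0)"

lemma poly_exp_tendsto_0: "((\<lambda>x::real. poly p x * exp (- x)) \<longlongrightarrow> 0) at_top"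
proof -
  have "((\<lambda>x. \<Sum>i\<le>degree p. coeff p i * (x ^ i / exp x)) \<longlongrightarrow> (\<Sum>i\<le>degree p. coeff p i * 0)) at_top"
    by (intro tendsto_intros tendsto_power_div_exp_0)
  then show ?thesis
    by (simp add: poly_altdef exp_minus field_simps sum_divide_distrib)
qed

lemma flat_deriv: "(flat n has_field_derivative flat (Suc n) x) (at x)"
proof (cases x "0 :: real" rule: linorder_cases)
  case less
  have "((\<lambda>x::real. 0::real) has_field_derivative 0) (at x)" by simp
  then have "(flat n has_field_derivative 0) (at x)"
    by (rule has_field_derivative_transform_within_open[where S="{..<0}"]) (use less in \<open>auto simp: flat_def\<close>)
  then show ?thesis using less by (simp add: flat_def)
next
  case greater
  have "((\<lambda>x. poly (bump_poly n) (1 / x) * exp (- (1 / x))) has_field_derivative flat (Suc n) x) (at x)"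
    using greater
    by (auto simp: flat_def field_simps power2_eq_square intro!: derivative_eq_intros DERIV_chain2[OF poly_DERIV])
  then show ?thesis
    by (rule has_field_derivative_transform_within_open[where S="{0<..}"]) (use greater in \<open>auto simp: flat_def\<close>)
next
  case equal
  have "((\<lambda>h. flat n h / h) \<longlongrightarrow> 0) (at 0)"
  proof (rule filterlim_split_at)
    have "\<forall>\<^sub>F h in at_left (0::real). flat n h / h = 0"
      by (auto simp: flat_def eventually_at_filter)
    then show "((\<lambda>h. flat n h / h) \<longlongrightarrow> 0) (at_left 0)"
      by (rule tendsto_eventually)
    \<comment> \<open>With h = 1/x the right-hand difference quotient becomes a polynomial times
      exp(-x) at infinity; the division by h is a multiplication by x, whence
      \<open>pCons 0\<close>.\<close>
    have "((\<lambda>x. poly (pCons 0 (bump_poly n)) x * exp (- x)) \<longlongrightarrow> 0) at_top"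
      by (rule poly_exp_tendsto_0)
    then have "((\<lambda>x. flat n (inverse x) / inverse x) \<longlongrightarrow> 0) at_top"
      by (rule Lim_transform_eventually) 
        (auto simp: flat_def field_simps intro!: eventually_mono[OF eventually_gt_at_top[of 0]])
    then show "((\<lambda>h. flat n h / h) \<longlongrightarrow> 0) (at_right 0)"
      by (subst filterlim_at_right_to_top)
  qed
  then show ?thesis unfolding equal DERIV_def by (simp add: flat_def)
qed

lemma flat_0_props: "0 \<le> flat 0 x" "flat 0 x \<le> 1" "flat 0 x = 0 \<longleftrightarrow> x \<le> 0"
  by (auto simp: flat_def)

text \<open>A product of one-dimensional factors \<open>flat 0\<close>, each vanishing exactly on a
  closed half line, vanishes exactly off the open box.\<close>

lemma box_bump:
  fixes a b :: "real^2"
  obtains \<beta> where "\<And>k. Ck k \<beta>" "\<And>x. 0 \<le> \<beta> x" "\<And>x. \<beta> x \<le> 1" "\<And>x. \<beta> x \<noteq> 0 \<longleftrightarrow> x \<in> box a b"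
proof
  define \<beta> where "\<beta> x = (\<Prod>j\<in>UNIV. flat 0 (x $ j + (- a $ j)) * flat 0 (- x $ j + b $ j))" for x :: "real^2"
  have "bounded_linear (\<lambda>x::real^2. - x $ j)" for j
    by (auto intro!: bounded_linear_minus bounded_linear_vec_nth)
  then show "Ck k \<beta>" for k unfolding \<beta>_def
    by (intro Ck_prod Ck_mult Ck_compose_linear[of flat] flat_deriv bounded_linear_vec_nth)
  show "0 \<le> \<beta> x" for x unfolding \<beta>_def by (intro prod_nonneg ballI mult_nonneg_nonneg flat_0_props)
  show "\<beta> x \<le> 1" for x unfolding \<beta>_def
    by (intro prod_le_1 conjI mult_nonneg_nonneg mult_le_one flat_0_props)
  show "\<beta> x \<noteq> 0 \<longleftrightarrow> x \<in> box a b" for x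
    by (simp add: \<beta>_def flat_0_props(3) mem_box_cart not_le add.commute)
qed

lemma test_functionsD:
  assumes "\<phi> \<in> test_functions \<Omega>"
  shows "Ck k \<phi>" "\<phi> x \<noteq> 0 \<Longrightarrow> x \<in> \<Omega>" "\<And>x. \<phi> differentiable (at x)" "continuous_on UNIV \<phi>"
    "\<And>i. continuous_on UNIV (partial_deriv i \<phi>)" "compact (closure {x. \<phi> x \<noteq> 0})"
proof -
  show c: "Ck k \<phi>" for k using assms by (auto simp: test_functions_def)
  show "\<phi> x \<noteq> 0 \<Longrightarrow> x \<in> \<Omega>"
    using assms closure_subset[of "{x. \<phi> x \<noteq> 0}"] unfolding test_functions_def by blast
  show "compact (closure {x. \<phi> x \<noteq> 0})"
    using assms unfolding test_functions_def by blast
  show "\<phi> differentiable (at x)" for x using c[of 1] by simp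
  show "continuous_on UNIV \<phi>" using c[of 0] by simp
  show "continuous_on UNIV (partial_deriv i \<phi>)" for i using c[of "Suc 0"] by simp
qed

lemma test_functionsI:
  assumes "\<And>k. Ck k \<phi>" "compact C" "C \<subseteq> \<Omega>" "\<And>x. \<phi> x \<noteq> 0 \<Longrightarrow> x \<in> C"
  shows "\<phi> \<in> test_functions \<Omega>"
proof -
  have "closure {x. \<phi> x \<noteq> 0} \<subseteq> C"
    using assms by (intro closure_minimal) (auto intro: compact_imp_closed)
  then show ?thesis using assms compact_Int_closed[of C "closure {x. \<phi> x \<noteq> 0}"]
    by (auto simp: test_functions_def Int_absorb1)
qed

lemma test_functions_translate:
  assumes "\<phi> \<in> test_functions E" "(\<lambda>x. x + h) ` E \<subseteq> \<Omega>"
  shows "(\<lambda>x. \<phi> (x - h)) \<in> test_functions \<Omega>"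
proof (rule test_functionsI)
  let ?C = "closure {x. \<phi> x \<noteq> 0}"
  show "Ck k (\<lambda>x. \<phi> (x - h))" for k by (intro Ck_translate test_functionsD(1)[OF assms(1)])
  show "compact ((\<lambda>x. x + h) ` ?C)"
    by (rule compact_continuous_image[OF _ test_functionsD(6)[OF assms(1)]]) (intro continuous_intros)
  have "?C \<subseteq> E" using assms(1) by (simp add: test_functions_def)
  then show "(\<lambda>x. x + h) ` ?C \<subseteq> \<Omega>" using assms(2) by blast
  show "x \<in> (\<lambda>x. x + h) ` ?C" if "\<phi> (x - h) \<noteq> 0" for x
  proof (rule image_eqI)
    show "x - h \<in> ?C" by (rule subsetD[OF closure_subset]) (use that in simp)
  qed simp
qed

lemma test_functions_mult:
  assumes "\<phi> \<in> test_functions E" "\<And>k. Ck k p"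
  shows "(\<lambda>x. \<phi> x * p x) \<in> test_functions E"
proof (rule test_functionsI[where C="closure {x. \<phi> x \<noteq> 0}"])
  show "Ck k (\<lambda>x. \<phi> x * p x)" for k by (intro Ck_mult test_functionsD(1)[OF assms(1)] assms(2))
  show "x \<in> closure {x. \<phi> x \<noteq> 0}" if "\<phi> x * p x \<noteq> 0" for x
    using that closure_subset by fastforce
qed (use assms in \<open>auto simp: test_functions_def\<close>)

text \<open>Countably many open boxes whose closed boxes lie in \<open>E\<close> cover
  \<open>E\<close>, and \<open>\<eta> n\<close> is 1 minus the product over i < n of (1 -
  \<open>\<beta> i\<close>)^n. Only finitely many boxes enter, so the support is a compact subset of
  \<open>E\<close>; the growing exponent drives the product to 0 wherever some
  \<open>\<beta> i\<close> is positive.\<close>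

lemma smooth_cutoffs:
  fixes E :: "(real^2) set"
  assumes "open E"
  obtains \<eta> where "\<And>n::nat. \<eta> n \<in> test_functions E" "\<And>n x. 0 \<le> \<eta> n x" "\<And>n x. \<eta> n x \<le> 1"
    "\<And>x. x \<in> E \<Longrightarrow> (\<lambda>n. \<eta> n x) \<longlonglongrightarrow> 1"
proof -
  define \<U> where "\<U> = {box a b | a b::real^2. cbox a b \<subseteq> E}"
  obtain \<V> where V: "\<V> \<subseteq> \<U>" "countable \<V>" "\<Union>\<V> = \<Union>\<U>"
    using Lindelof[of \<U>] by (auto simp: \<U>_def open_box)
  have U: "\<Union>\<U> = E"
  proof
    show "\<Union>\<U> \<subseteq> E" using box_subset_cbox by (auto simp: \<U>_def)
    show "E \<subseteq> \<Union>\<U>"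
    proof
      fix x assume "x \<in> E"
      with assms open_contains_cbox[of E] obtain a b where "x \<in> box a b" "cbox a b \<subseteq> E"
        by metis
      then show "x \<in> \<Union>\<U>" by (auto simp: \<U>_def)
    qed
  qed
  \<comment> \<open>The empty set, which is the degenerate box from 1 to 0, is inserted because the
    enumeration needs a nonempty family, and \<open>\<V>\<close> may be empty when \<open>E\<close>
    is.\<close>
  define B where "B = from_nat_into (insert {} \<V>)"
  have rB: "range B = insert {} \<V>"
    unfolding B_def using V by (intro range_from_nat_into) auto
  have "\<exists>a b. B n = box a b \<and> cbox a b \<subseteq> E" for n
  proof -
    have "box (1::real^2) 0 = {}" "cbox (1::real^2) 0 = {}" by (auto simp: interval_eq_empty_cart)
    then have "{} = box (1::real^2) 0 \<and> cbox (1::real^2) 0 \<subseteq> E" by simp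
    moreover have "B n \<in> insert {} \<U>" using rB V by blast
    ultimately show ?thesis unfolding \<U>_def by blast
  qed
  then obtain a b where ab: "\<And>n. B n = box (a n) (b n)" "\<And>n. cbox (a n) (b n) \<subseteq> E" by metis
  have "\<forall>n. \<exists>\<beta>. (\<forall>k. Ck k \<beta>) \<and> (\<forall>x. 0 \<le> \<beta> x) \<and> (\<forall>x. \<beta> x \<le> 1) \<and> (\<forall>x. \<beta> x \<noteq> 0 \<longleftrightarrow> x \<in> box (a n) (b n))"
    by (metis box_bump)
  then obtain \<beta> where be: "\<And>n k. Ck k (\<beta> n)" "\<And>n x. 0 \<le> \<beta> n x" "\<And>n x. \<beta> n x \<le> 1"
    "\<And>n x. \<beta> n x \<noteq> 0 \<longleftrightarrow> x \<in> box (a n) (b n)" by metis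
  define \<eta> where "\<eta> n x = 1 - (\<Prod>i<n. (1 - \<beta> i x) ^ n)" for n x
  show ?thesis
  proof
    show "\<eta> n \<in> test_functions E" for n
    proof (rule test_functionsI)
      show "Ck k (\<eta> n)" for k unfolding \<eta>_def
        by (intro Ck_diff Ck_const Ck_prod Ck_power be)
      show "compact (\<Union>i<n. cbox (a i) (b i))" by auto
      show "(\<Union>i<n. cbox (a i) (b i)) \<subseteq> E" using ab by auto
      show "x \<in> (\<Union>i<n. cbox (a i) (b i))" if "\<eta> n x \<noteq> 0" for x
      proof (rule ccontr)
        assume "x \<notin> (\<Union>i<n. cbox (a i) (b i))"
        then have "\<beta> i x = 0" if "i < n" for i using be(4)[of i x] that box_subset_cbox by blast
        then show False using that by (simp add: \<eta>_def)
      qed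
    qed
    show "0 \<le> \<eta> n x" for n x unfolding \<eta>_def
      using be by (auto intro!: prod_le_1 power_le_one)
    show "\<eta> n x \<le> 1" for n x unfolding \<eta>_def
      using be by (auto intro!: prod_nonneg)
    show "(\<lambda>n. \<eta> n x) \<longlonglongrightarrow> 1" if "x \<in> E" for x
    proof -
      have "x \<in> \<Union>(range B)" using U V rB that by auto
      then obtain i where "x \<in> box (a i) (b i)" using ab by auto
      then have i: "\<beta> i x \<noteq> 0" using be by blast
      have "(\<lambda>n. (1 - \<beta> i x) ^ n) \<longlonglongrightarrow> 0"
        using i be[where n=i] by (intro LIMSEQ_power_zero) (smt (verit) real_norm_def)
      moreover have "(\<Prod>j<n. (1 - \<beta> j x) ^ n) \<le> (1 - \<beta> i x) ^ n" if "n > i" for n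
      proof -
        have "(\<Prod>j<n. (1 - \<beta> j x) ^ n) = (1 - \<beta> i x) ^ n * (\<Prod>j\<in>{..<n} - {i}. (1 - \<beta> j x) ^ n)"
          using that by (intro prod.remove) auto
        also have "\<dots> \<le> (1 - \<beta> i x) ^ n * 1"
          using be by (intro mult_left_mono prod_le_1) (auto intro!: power_le_one)
        finally show ?thesis by simp
      qed
      then have "\<forall>\<^sub>F n in sequentially. (\<Prod>j<n. (1 - \<beta> j x) ^ n) \<le> (1 - \<beta> i x) ^ n"
        by (rule eventually_mono[OF eventually_gt_at_top])
      moreover have "\<forall>\<^sub>F n in sequentially. 0 \<le> (\<Prod>j<n. (1 - \<beta> j x) ^ n)"
        using be by (auto intro!: always_eventually prod_nonneg)
      ultimately have "(\<lambda>n. (\<Prod>j<n. (1 - \<beta> j x) ^ n)) \<longlonglongrightarrow> 0"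
        by (rule_tac tendsto_sandwich[where f="\<lambda>_. 0" and h="\<lambda>n. (1 - \<beta> i x) ^ n"]) simp_all
      from tendsto_diff[OF tendsto_const[of 1] this] show ?thesis by (simp add: \<eta>_def)
    qed
  qed
qed


subsection \<open>Square integrable functions\<close>

text \<open>The measure is arbitrary because the same estimates are used on \<open>\<Omega>\<close>,
  on balls, on \<open>S\<close> and on the sets to be translated; the square in place of
  \<open>powr\<close> keeps the calculus with inner products algebraic.\<close>

definition L2 :: "'a measure \<Rightarrow> ('a \<Rightarrow> 'b::euclidean_space) set" where
  "L2 M = {u \<in> borel_measurable M. integrable M (\<lambda>x. (norm (u x))\<^sup>2)}"

definition l2norm :: "'a measure \<Rightarrow> ('a \<Rightarrow> 'b::euclidean_space) \<Rightarrow> real" where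
  "l2norm M u = sqrt (\<integral>x. (norm (u x))\<^sup>2 \<partial>M)"

lemma L2_measurable[measurable_dest]: "u \<in> L2 M \<Longrightarrow> u \<in> borel_measurable M"
  by (simp add: L2_def)

lemma L2_integrable: "u \<in> L2 M \<Longrightarrow> integrable M (\<lambda>x. (norm (u x))\<^sup>2)"
  by (simp add: L2_def)

lemma l2norm_nonneg: "0 \<le> l2norm M u"
  by (simp add: l2norm_def)

lemma l2norm_sq: "(l2norm M u)\<^sup>2 = (\<integral>x. (norm (u x))\<^sup>2 \<partial>M)"
  by (simp add: l2norm_def)

lemma norm_add_sq_le: "(norm (a + b))\<^sup>2 \<le> 2 * (norm a)\<^sup>2 + 2 * (norm (b::'b::real_inner))\<^sup>2"
proof -
  have "(norm (a + b))\<^sup>2 + (norm (a - b))\<^sup>2 = 2 * (norm a)\<^sup>2 + 2 * (norm b)\<^sup>2"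
    by (simp add: power2_norm_eq_inner inner_simps inner_commute)
  then show ?thesis by (smt (verit) zero_le_power2)
qed

lemma L2_bound:
  assumes "u \<in> borel_measurable M" "integrable M g" "\<And>x. (norm (u x))\<^sup>2 \<le> g x"
  shows "u \<in> L2 M"
proof -
  have "integrable M (\<lambda>x. (norm (u x))\<^sup>2)"
    by (rule Bochner_Integration.integrable_bound[OF assms(2)]) 
       (use assms in \<open>auto intro!: AE_I2 simp: abs_if intro: order_trans\<close>, smt (verit) zero_le_power2)
  then show ?thesis using assms by (simp add: L2_def)
qed

lemma L2_scaleR: "u \<in> L2 M \<Longrightarrow> (\<lambda>x. c *\<^sub>R u x) \<in> L2 M"
  by (auto simp: L2_def power_mult_distrib)

lemma L2_uminus: "u \<in> L2 M \<Longrightarrow> (\<lambda>x. - u x) \<in> L2 M"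
  using L2_scaleR[of u M "-1"] by simp

lemma L2_add: "u \<in> L2 M \<Longrightarrow> v \<in> L2 M \<Longrightarrow> (\<lambda>x. u x + v x) \<in> L2 M"
  by (rule L2_bound[where g="\<lambda>x. 2 * (norm (u x))\<^sup>2 + 2 * (norm (v x))\<^sup>2"])
     (auto simp: L2_integrable norm_add_sq_le intro!: borel_measurable_add L2_measurable)

lemma L2_diff: "u \<in> L2 M \<Longrightarrow> v \<in> L2 M \<Longrightarrow> (\<lambda>x. u x - v x) \<in> L2 M"
  using L2_add[of u M "\<lambda>x. - v x"] L2_uminus[of v M] by simp

lemma L2_const: "finite_measure M \<Longrightarrow> (\<lambda>x. c) \<in> L2 M"
  by (auto simp: L2_def finite_measure.integrable_const)

lemma L2_inner:
  assumes "u \<in> L2 M" "v \<in> L2 M"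
  shows "integrable M (\<lambda>x. u x \<bullet> v x)"
proof (rule Bochner_Integration.integrable_bound[where f="\<lambda>x. (norm (u x))\<^sup>2 + (norm (v x))\<^sup>2"])
  show "integrable M (\<lambda>x. (norm (u x))\<^sup>2 + (norm (v x))\<^sup>2)"
    using assms by (intro Bochner_Integration.integrable_add L2_integrable)
  show "(\<lambda>x. u x \<bullet> v x) \<in> borel_measurable M"
    using assms by (intro borel_measurable_inner L2_measurable)
  have "norm (u x \<bullet> v x) \<le> norm ((norm (u x))\<^sup>2 + (norm (v x))\<^sup>2)" for x
  proof -
    have "\<bar>u x \<bullet> v x\<bar> \<le> norm (u x) * norm (v x)" by (rule Cauchy_Schwarz_ineq2)
    also have "\<dots> \<le> (norm (u x))\<^sup>2 + (norm (v x))\<^sup>2"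
      using sum_squares_bound[of "norm (u x)" "norm (v x)"]
        mult_nonneg_nonneg[OF norm_ge_zero[of "u x"] norm_ge_zero[of "v x"]] by linarith
    finally show ?thesis by simp
  qed
  then show "AE x in M. norm (u x \<bullet> v x) \<le> norm ((norm (u x))\<^sup>2 + (norm (v x))\<^sup>2)" by simp
qed

lemma L2_mult:
  fixes u v :: "'a \<Rightarrow> real"
  shows "u \<in> L2 M \<Longrightarrow> v \<in> L2 M \<Longrightarrow> integrable M (\<lambda>x. u x * v x)"
  using L2_inner[of u M v] by simp

lemma L2_AE_zero:
  assumes "u \<in> L2 M" "l2norm M u = 0"
  shows "AE x in M. u x = 0"
proof -
  have "(\<integral>x. (norm (u x))\<^sup>2 \<partial>M) = 0" using assms(2) by (simp add: l2norm_def)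
  then have "AE x in M. (norm (u x))\<^sup>2 = 0"
    using integral_nonneg_eq_0_iff_AE[OF L2_integrable[OF assms(1)]] by simp
  then show ?thesis by simp
qed

text \<open>With a and b the norms of \<open>u\<close> and \<open>v\<close>, expanding the squared
  norm of b u - a v gives a b times the pairing at most (a b)^2. Dividing by a b requires both to be
  positive; otherwise the integrand vanishes almost everywhere.\<close>

lemma L2_Cauchy_Schwarz:
  assumes u: "u \<in> L2 M" and v: "v \<in> L2 M"
  shows "(\<integral>x. u x \<bullet> v x \<partial>M) \<le> l2norm M u * l2norm M v"
proof (cases "l2norm M u = 0 \<or> l2norm M v = 0")
  case True
  then have "AE x in M. u x \<bullet> v x = 0"
    using L2_AE_zero[OF u] L2_AE_zero[OF v] by (elim disjE) (auto elim: eventually_mono)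
  then have "(\<integral>x. u x \<bullet> v x \<partial>M) = 0" by (rule integral_eq_zero_AE)
  then show ?thesis by (simp add: l2norm_nonneg)
next
  case False
  define a b where "a = l2norm M u" and "b = l2norm M v"
  have ab: "a > 0" "b > 0" using False l2norm_nonneg[of M u] l2norm_nonneg[of M v]
    by (auto simp: a_def b_def)
  have eq: "(norm (b *\<^sub>R u x - a *\<^sub>R v x))\<^sup>2 =
      b\<^sup>2 * (norm (u x))\<^sup>2 - 2 * a * b * (u x \<bullet> v x) + a\<^sup>2 * (norm (v x))\<^sup>2" for x
    unfolding power2_norm_eq_inner
    by (simp add: inner_simps inner_commute[of "v x" "u x"] algebra_simps power2_eq_square)
  have "0 \<le> (\<integral>x. (norm (b *\<^sub>R u x - a *\<^sub>R v x))\<^sup>2 \<partial>M)" by simp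
  also have "\<dots> = b\<^sup>2 * a\<^sup>2 - 2 * a * b * (\<integral>x. u x \<bullet> v x \<partial>M) + a\<^sup>2 * b\<^sup>2"
    unfolding eq using L2_inner[OF u v] L2_integrable[OF u] L2_integrable[OF v]
    by (simp add: a_def b_def l2norm_sq)
  finally have "(a * b) * (\<integral>x. u x \<bullet> v x \<partial>M) \<le> (a * b) * (a * b)"
    by (simp add: algebra_simps power2_eq_square)
  then show ?thesis using ab by (simp add: a_def b_def)
qed

lemma l2norm_add_sq:
  assumes u: "u \<in> L2 M" and v: "v \<in> L2 M"
  shows "(l2norm M (\<lambda>x. u x + v x))\<^sup>2 = (l2norm M u)\<^sup>2 + 2 * (\<integral>x. u x \<bullet> v x \<partial>M) + (l2norm M v)\<^sup>2"
proof -
  have eq: "(norm (u x + v x))\<^sup>2 = (norm (u x))\<^sup>2 + 2 * (u x \<bullet> v x) + (norm (v x))\<^sup>2" for x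
    by (simp add: power2_norm_eq_inner inner_simps inner_commute)
  show ?thesis
    unfolding l2norm_sq eq using L2_inner[OF u v] L2_integrable[OF u] L2_integrable[OF v] by simp
qed

lemma l2norm_triangle:
  assumes u: "u \<in> L2 M" and v: "v \<in> L2 M"
  shows "l2norm M (\<lambda>x. u x + v x) \<le> l2norm M u + l2norm M v"
proof (rule power2_le_imp_le)
  show "(l2norm M (\<lambda>x. u x + v x))\<^sup>2 \<le> (l2norm M u + l2norm M v)\<^sup>2"
    using L2_Cauchy_Schwarz[OF u v] by (simp add: l2norm_add_sq[OF u v] power2_sum)
qed (simp add: l2norm_nonneg)

lemma l2norm_scaleR: "l2norm M (\<lambda>x. c *\<^sub>R u x) = \<bar>c\<bar> * l2norm M u"
  by (simp add: l2norm_def power_mult_distrib real_sqrt_mult)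

lemma l2norm_cong_AE:
  assumes "u \<in> borel_measurable M" "v \<in> borel_measurable M" "AE x in M. u x = v x"
  shows "l2norm M u = l2norm M v"
  unfolding l2norm_def using assms by (intro arg_cong[where f=sqrt] integral_cong_AE) auto

lemma L2_imp_L1:
  assumes "finite_measure M" and u: "u \<in> L2 M"
  shows "integrable M u" and "(\<integral>x. norm (u x) \<partial>M) \<le> l2norm M u * sqrt (measure M (space M))"
proof -
  have n: "(\<lambda>x. norm (u x)) \<in> L2 M" using u by (auto simp: L2_def)
  have "integrable M (\<lambda>x. norm (u x) \<bullet> (1::real))"
    by (rule L2_inner[OF n L2_const[OF assms(1)]])
  then show "integrable M u" using u by (simp add: integrable_norm_iff L2_measurable)
  have "l2norm M (\<lambda>x. norm (u x)) = l2norm M u" by (simp add: l2norm_def)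
  then show "(\<integral>x. norm (u x) \<partial>M) \<le> l2norm M u * sqrt (measure M (space M))"
    using L2_Cauchy_Schwarz[OF n L2_const[OF assms(1), of "1::real"]] by (simp add: l2norm_def)
qed

text \<open>On a finite measure an L^2 Cauchy sequence is L^1 Cauchy, so a subsequence converges
  almost everywhere. Fatou's lemma along this subsequence, with the other index fixed, bounds the
  distance of \<open>s i\<close> to the limit.\<close>

theorem L2_complete:
  fixes s :: "nat \<Rightarrow> 'a \<Rightarrow> 'b::euclidean_space"
  assumes "finite_measure M" and s: "\<And>n. s n \<in> L2 M"
    and cau: "\<And>e. e > 0 \<Longrightarrow> \<exists>N. \<forall>i\<ge>N. \<forall>j\<ge>N. l2norm M (\<lambda>x. s i x - s j x) < e"
  obtains w where "w \<in> L2 M" "(\<lambda>n. l2norm M (\<lambda>x. s n x - w x)) \<longlonglongrightarrow> 0"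
proof -
  interpret finite_measure M by fact
  define c where "c = sqrt (measure M (space M)) + 1"
  have c: "c > 0" by (auto simp: c_def add_nonneg_pos)
  have L1: "\<exists>N. \<forall>i\<ge>N. \<forall>j\<ge>N. (\<integral>x. norm (s i x - s j x) \<partial>M) < e" if e: "e > 0" for e
  proof -
    obtain N where N: "\<And>i j. i \<ge> N \<Longrightarrow> j \<ge> N \<Longrightarrow> l2norm M (\<lambda>x. s i x - s j x) < e / c"
      using cau[of "e / c"] e c by auto
    have "(\<integral>x. norm (s i x - s j x) \<partial>M) < e" if "i \<ge> N" "j \<ge> N" for i j
    proof -
      have "(\<integral>x. norm (s i x - s j x) \<partial>M) \<le> l2norm M (\<lambda>x. s i x - s j x) * sqrt (measure M (space M))"
        by (rule L2_imp_L1[OF assms(1)]) (intro L2_diff s)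
      also have "\<dots> \<le> l2norm M (\<lambda>x. s i x - s j x) * c"
        by (intro mult_left_mono) (auto simp: c_def l2norm_nonneg)
      also have "\<dots> < e" using N[OF that] c by (simp add: field_simps)
      finally show ?thesis .
    qed
    then show ?thesis by blast
  qed
  obtain r where r: "strict_mono r" "AE x in M. Cauchy (\<lambda>i. s (r i) x)"
    using cauchy_L1_AE_cauchy_subseq[of M s, OF L2_imp_L1(1)[OF assms(1) s] L1] by blast
  define w where "w x = lim (\<lambda>i. s (r i) x)" for x
  have [measurable]: "s n \<in> borel_measurable M" for n using s L2_measurable by blast
  have wm[measurable]: "w \<in> borel_measurable M" unfolding w_def by measurable
  have lim: "AE x in M. (\<lambda>i. s (r i) x) \<longlonglongrightarrow> w x"
    using r(2) by eventually_elim (simp add: w_def Cauchy_convergent_iff convergent_LIMSEQ_iff)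
  have est: "(\<integral>\<^sup>+x. ennreal ((norm (s i x - w x))\<^sup>2) \<partial>M) \<le> ennreal (e\<^sup>2)"
    if N: "\<And>i j. i \<ge> N \<Longrightarrow> j \<ge> N \<Longrightarrow> l2norm M (\<lambda>x. s i x - s j x) < e" and "i \<ge> N" for i N e
  proof -
    have "(\<integral>\<^sup>+x. ennreal ((norm (s i x - w x))\<^sup>2) \<partial>M)
        = (\<integral>\<^sup>+x. liminf (\<lambda>k. ennreal ((norm (s i x - s (r k) x))\<^sup>2)) \<partial>M)"
    proof (rule nn_integral_cong_AE)
      show "AE x in M. ennreal ((norm (s i x - w x))\<^sup>2) = liminf (\<lambda>k. ennreal ((norm (s i x - s (r k) x))\<^sup>2))"
        using lim
      proof eventually_elim
        case (elim x)
        then have "(\<lambda>k. ennreal ((norm (s i x - s (r k) x))\<^sup>2)) \<longlonglongrightarrow> ennreal ((norm (s i x - w x))\<^sup>2)"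
          by (intro tendsto_intros)
        then show ?case using lim_imp_Liminf[of sequentially] by force
      qed
    qed
    also have "\<dots> \<le> liminf (\<lambda>k. \<integral>\<^sup>+x. ennreal ((norm (s i x - s (r k) x))\<^sup>2) \<partial>M)"
      by (rule nn_integral_liminf) measurable
    also have "\<dots> \<le> ennreal (e\<^sup>2)"
    proof (rule Liminf_le)
      show "\<forall>\<^sub>F k in sequentially. (\<integral>\<^sup>+x. ennreal ((norm (s i x - s (r k) x))\<^sup>2) \<partial>M) \<le> ennreal (e\<^sup>2)"
        using eventually_ge_at_top[of N]
      proof eventually_elim
        case (elim k)
        then have "r k \<ge> N" using seq_suble[OF r(1), of k] by linarith
        have "(\<integral>\<^sup>+x. ennreal ((norm (s i x - s (r k) x))\<^sup>2) \<partial>M) = ennreal ((l2norm M (\<lambda>x. s i x - s (r k) x))\<^sup>2)"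
          unfolding l2norm_sq by (rule nn_integral_eq_integral[OF L2_integrable[OF L2_diff[OF s s]]]) simp
        also have "\<dots> \<le> ennreal (e\<^sup>2)"
          using N[OF \<open>i \<ge> N\<close> \<open>r k \<ge> N\<close>] l2norm_nonneg[of M "\<lambda>x. s i x - s (r k) x"]
          by (intro ennreal_leI power_mono) auto
        finally show ?case .
      qed
    qed simp
    finally show ?thesis .
  qed
  have diff: "(\<lambda>x. s i x - w x) \<in> L2 M \<and> l2norm M (\<lambda>x. s i x - w x) \<le> e"
    if N: "\<And>i j. i \<ge> N \<Longrightarrow> j \<ge> N \<Longrightarrow> l2norm M (\<lambda>x. s i x - s j x) < e" and "i \<ge> N" "e > 0" for i N e
  proof -
    have int: "integrable M (\<lambda>x. (norm (s i x - w x))\<^sup>2)"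
      using est[OF N \<open>i \<ge> N\<close>] by (intro integrableI_bounded) (auto intro: le_less_trans)
    then have "(\<lambda>x. s i x - w x) \<in> L2 M" unfolding L2_def by auto
    have "ennreal ((l2norm M (\<lambda>x. s i x - w x))\<^sup>2) \<le> ennreal (e\<^sup>2)"
      unfolding l2norm_sq using est[OF N \<open>i \<ge> N\<close>] by (subst nn_integral_eq_integral[OF int, symmetric]) auto
    then have "(l2norm M (\<lambda>x. s i x - w x))\<^sup>2 \<le> e\<^sup>2" by (subst (asm) ennreal_le_iff) auto
    then have "l2norm M (\<lambda>x. s i x - w x) \<le> e" using \<open>e > 0\<close> by (simp add: power2_le_iff_abs_le)
    with \<open>(\<lambda>x. s i x - w x) \<in> L2 M\<close> show ?thesis by simp
  qed
  show ?thesis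
  proof
    obtain N where N: "\<And>i j. i \<ge> N \<Longrightarrow> j \<ge> N \<Longrightarrow> l2norm M (\<lambda>x. s i x - s j x) < 1"
      using cau[of 1] by auto
    show "w \<in> L2 M" using L2_diff[OF s[of N] conjunct1[OF diff[of N 1 N]]] N by simp
    show "(\<lambda>n. l2norm M (\<lambda>x. s n x - w x)) \<longlonglongrightarrow> 0"
    proof (rule LIMSEQ_I)
      fix e :: real assume "e > 0"
      then obtain N where "\<And>i j. i \<ge> N \<Longrightarrow> j \<ge> N \<Longrightarrow> l2norm M (\<lambda>x. s i x - s j x) < e / 2"
        using cau[of "e / 2"] by auto
      from diff[OF this] \<open>e > 0\<close>
      show "\<exists>no. \<forall>n\<ge>no. norm (l2norm M (\<lambda>x. s n x - w x) - 0) < e"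
        by (intro exI[of _ N]) (force simp: l2norm_nonneg)
    qed
  qed
qed

lemma L2_tendsto_AE_subseq:
  fixes s :: "nat \<Rightarrow> 'a \<Rightarrow> 'b::euclidean_space"
  assumes "finite_measure M" and s: "\<And>n. s n \<in> L2 M" "w \<in> L2 M"
    and lim: "(\<lambda>n. l2norm M (\<lambda>x. s n x - w x)) \<longlonglongrightarrow> 0"
  obtains r where "strict_mono r" "AE x in M. (\<lambda>n. s (r n) x) \<longlonglongrightarrow> w x"
proof -
  have "(\<lambda>n. \<integral>x. norm (s n x - w x) \<partial>M) \<longlonglongrightarrow> 0"
  proof (rule tendsto_sandwich[where f="\<lambda>_. 0"])
    show "(\<lambda>n. l2norm M (\<lambda>x. s n x - w x) * sqrt (measure M (space M))) \<longlonglongrightarrow> 0"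
      using tendsto_mult_right[OF lim, of "sqrt (measure M (space M))"] by simp
    show "\<forall>\<^sub>F n in sequentially. (\<integral>x. norm (s n x - w x) \<partial>M) \<le> l2norm M (\<lambda>x. s n x - w x) * sqrt (measure M (space M))"
      by (intro always_eventually allI L2_imp_L1(2)[OF assms(1)] L2_diff s)
  qed auto
  from tendsto_L1_AE_subseq[OF _ this]
  obtain r where "strict_mono r" "AE x in M. (\<lambda>n. s (r n) x - w x) \<longlonglongrightarrow> 0"
    using L2_imp_L1(1)[OF assms(1) L2_diff[OF s(1) s(2)]] by blast
  then show ?thesis by (intro that[of r]) (auto simp: LIM_zero_iff)
qed

lemma Lp_2_eq: "Lp 2 S = L2 (lebesgue_on S)"
  by (simp add: Lp_def L2_def powr_numeral)

lemma Lp_norm_2_eq: "Lp_norm 2 S = l2norm (lebesgue_on S)"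
  by (simp add: Lp_norm_def l2norm_def powr_numeral fun_eq_iff powr_half_sqrt)

subsection \<open>Test functions are dense\<close>

text \<open>The truncations of \<open>w\<close> are limits of the test functions \<open>\<eta> n * p n\<close>, with polynomials \<open>p n\<close> from the Weierstrass theorem.\<close>

lemma L2_norm_le_by_test_functions:
  fixes w :: "real^2 \<Rightarrow> real"
  assumes E: "open E" "bounded E" and w: "w \<in> L2 (lebesgue_on E)" and "M \<ge> 0"
    and le: "\<And>\<phi>. \<phi> \<in> test_functions E \<Longrightarrow> (\<integral>x. w x * \<phi> x \<partial>lebesgue_on E) \<le> M * l2norm (lebesgue_on E) \<phi>"
  shows "l2norm (lebesgue_on E) w \<le> M"
proof -
  let ?\<mu> = "lebesgue_on E"
  have Em: "E \<in> lmeasurable" using E by (simp add: lmeasurable_open)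
  then have Es: "E \<in> sets lebesgue" by auto
  have fin: "finite_measure ?\<mu>" using Em by (rule finite_measure_lebesgue_on)
  have [measurable]: "w \<in> borel_measurable ?\<mu>" using w L2_measurable by blast
  obtain N g where N: "negligible N" "\<And>n. continuous_on UNIV (g n)"
    "\<And>x. x \<notin> N \<Longrightarrow> (\<lambda>n. g n x) \<longlonglongrightarrow> (if x \<in> E then w x else 0)"
    using measurable_on_iff_borel_measurable[OF Es, of w] L2_measurable[OF w]
    unfolding measurable_on_def by blast
  obtain \<eta> where eta: "\<And>n::nat. \<eta> n \<in> test_functions E" "\<And>n x. 0 \<le> \<eta> n x" "\<And>n x. \<eta> n x \<le> 1"
    "\<And>x. x \<in> E \<Longrightarrow> (\<lambda>n. \<eta> n x) \<longlonglongrightarrow> 1"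
    using smooth_cutoffs[OF E(1)] by blast
  have AE_N: "AE x in ?\<mu>. x \<in> E \<and> x \<notin> N"
  proof -
    have "AE x in lebesgue. x \<notin> N" using N(1) by (simp add: AE_not_in negligible_iff_null_sets)
    then show ?thesis using Es by (subst AE_restrict_space_iff) auto
  qed
  \<comment> \<open>Truncation at height m makes the approximating test functions uniformly bounded,
    so dominated convergence permits testing with cl w itself. Since (cl w)^2 is at most the product
    of w and cl w pointwise, the squared norm of cl w is at most \<open>M\<close> times its norm,
    and one factor cancels.\<close>
  have trunc: "l2norm ?\<mu> (\<lambda>x. max (-m) (min m (w x))) \<le> M" if m: "m > 0" for m :: real
  proof -
    define cl where "cl y = max (-m) (min m y)" for y
    have clb: "\<bar>cl y\<bar> \<le> m" for y using m by (auto simp: cl_def)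
    have ccl: "continuous_on UNIV cl" unfolding cl_def by (intro continuous_intros)
    then have [measurable]: "cl \<in> borel_measurable borel" by (rule borel_measurable_continuous_onI)
    have "\<exists>p. real_polynomial_function p \<and> (\<forall>x\<in>closure E. \<bar>cl (g n x) - p x\<bar> < 1 / Suc n)" for n
      using Stone_Weierstrass_real_polynomial_function[of "closure E" "\<lambda>x. cl (g n x)" "1 / Suc n"]
        continuous_on_compose2[OF ccl N(2)[of n]] E(2) continuous_on_subset[of UNIV _ "closure E"]
      by (metis compact_closure subset_UNIV zero_less_divide_1_iff of_nat_0_less_iff zero_less_Suc)
    then obtain p where p: "\<And>n. real_polynomial_function (p n)"
      "\<And>n x. x \<in> closure E \<Longrightarrow> \<bar>cl (g n x) - p n x\<bar> < 1 / Suc n" by metis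
    define \<phi> where "\<phi> n x = \<eta> n x * p n x" for n x
    have test: "\<phi> n \<in> test_functions E" for n unfolding \<phi>_def
      by (intro test_functions_mult eta Ck_real_polynomial p)
    have [measurable]: "\<phi> n \<in> borel_measurable ?\<mu>" for n
      using test_functionsD(4)[OF test[of n]] Es continuous_on_subset
      by (blast intro: continuous_imp_measurable_on_sets_lebesgue)
    have lim: "(\<lambda>n. \<phi> n x) \<longlonglongrightarrow> cl (w x)" if "x \<in> E" "x \<notin> N" for x
    proof -
      have "(\<lambda>n. cl (g n x) - p n x) \<longlonglongrightarrow> 0"
        using p(2)[of x] closure_subset that(1) 
        by (intro Lim_null_comparison[OF _ LIMSEQ_inverse_real_of_nat])
           (auto intro!: always_eventually less_imp_le simp: inverse_eq_divide)
      moreover have "(\<lambda>n. cl (g n x)) \<longlonglongrightarrow> cl (w x)"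
        using N(3)[of x] that ccl by (auto intro!: continuous_on_tendsto_compose[of UNIV cl])
      ultimately have "(\<lambda>n. p n x) \<longlonglongrightarrow> cl (w x)"
        using tendsto_diff[of "\<lambda>n. cl (g n x)" "cl (w x)" sequentially "\<lambda>n. cl (g n x) - p n x" 0] by simp
      from tendsto_mult[OF eta(4)[OF that(1)] this] show ?thesis by (simp add: \<phi>_def)
    qed
    have bd: "\<bar>\<phi> n x\<bar> \<le> m + 1" if "x \<in> E" for n x
    proof -
      have "\<bar>p n x\<bar> \<le> m + 1"
        using p(2)[of x n] closure_subset[of E] that clb[of "g n x"] divide_le_eq_1[of 1 "real (Suc n)"]
        by (smt (verit, best) of_nat_Suc subsetD of_nat_0_le_iff)
      moreover have "\<bar>\<phi> n x\<bar> \<le> 1 * \<bar>p n x\<bar>" unfolding \<phi>_def abs_mult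
        using eta(2,3)[of n x] by (intro mult_right_mono) auto
      ultimately show ?thesis by simp
    qed
    have wint: "integrable ?\<mu> w" by (rule L2_imp_L1[OF fin w])
    have l1: "(\<lambda>n. \<integral>x. w x * \<phi> n x \<partial>?\<mu>) \<longlonglongrightarrow> (\<integral>x. w x * cl (w x) \<partial>?\<mu>)"
    proof (rule integral_dominated_convergence[where w="\<lambda>x. \<bar>w x\<bar> * (m + 1)"])
      show "integrable ?\<mu> (\<lambda>x. \<bar>w x\<bar> * (m + 1))" using wint by auto
      show "AE x in ?\<mu>. (\<lambda>n. w x * \<phi> n x) \<longlonglongrightarrow> w x * cl (w x)"
        using AE_N by eventually_elim (auto intro!: tendsto_intros lim)
      show "AE x in ?\<mu>. norm (w x * \<phi> n x) \<le> \<bar>w x\<bar> * (m + 1)" for n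
        using AE_N by eventually_elim (auto simp: abs_mult intro!: mult_left_mono bd)
    qed measurable
    have l2: "(\<lambda>n. \<integral>x. (norm (\<phi> n x))\<^sup>2 \<partial>?\<mu>) \<longlonglongrightarrow> (\<integral>x. (norm (cl (w x)))\<^sup>2 \<partial>?\<mu>)"
    proof (rule integral_dominated_convergence[where w="\<lambda>x. (m + 1)\<^sup>2"])
      show "integrable ?\<mu> (\<lambda>x. (m + 1)\<^sup>2)" by (rule finite_measure.integrable_const[OF fin])
      show "AE x in ?\<mu>. (\<lambda>n. (norm (\<phi> n x))\<^sup>2) \<longlonglongrightarrow> (norm (cl (w x)))\<^sup>2"
        using AE_N by eventually_elim (auto intro!: tendsto_intros lim simp del: power2_abs)
      show "AE x in ?\<mu>. norm ((norm (\<phi> n x))\<^sup>2) \<le> (m + 1)\<^sup>2" for n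
        using AE_N by eventually_elim (use bd[of _ n] m in \<open>auto simp: abs_le_square_iff[symmetric]\<close>)
    qed measurable
    have "(\<integral>x. w x * cl (w x) \<partial>?\<mu>) \<le> M * sqrt (\<integral>x. (norm (cl (w x)))\<^sup>2 \<partial>?\<mu>)"
      using LIMSEQ_le[OF l1 tendsto_mult_left[OF tendsto_real_sqrt[OF l2], of M]] le[OF test]
      by (auto simp: l2norm_def)
    moreover have "(\<integral>x. (norm (cl (w x)))\<^sup>2 \<partial>?\<mu>) \<le> (\<integral>x. w x * cl (w x) \<partial>?\<mu>)"
    proof (rule integral_mono)
      show "integrable ?\<mu> (\<lambda>x. (norm (cl (w x)))\<^sup>2)"
        using clb m by (intro finite_measure.integrable_const_bound[OF fin, where B="m\<^sup>2"])
          (auto simp: abs_le_square_iff[symmetric])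
      show "integrable ?\<mu> (\<lambda>x. w x * cl (w x))"
        by (rule Bochner_Integration.integrable_bound[where f="\<lambda>x. \<bar>w x\<bar> * m"])
           (use wint clb m in \<open>auto simp: abs_mult intro!: mult_left_mono\<close>)
      show "(norm (cl (w x)))\<^sup>2 \<le> w x * cl (w x)" for x
      proof (cases "- m \<le> w x")
        case True
        then show ?thesis using m by (auto simp: cl_def power2_eq_square max_def min_def mult_right_mono)
      next
        case False
        then have "w x * (- m) \<ge> (- m) * (- m)" using m by (intro mult_right_mono_neg) auto
        then show ?thesis using False m by (simp add: cl_def power2_eq_square)
      qed
    qed
    ultimately have "(l2norm ?\<mu> (\<lambda>x. cl (w x)))\<^sup>2 \<le> M * l2norm ?\<mu> (\<lambda>x. cl (w x))"
      by (simp add: l2norm_sq) (simp add: l2norm_def)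
    then have "l2norm ?\<mu> (\<lambda>x. cl (w x)) \<le> M"
      using l2norm_nonneg[of ?\<mu> "\<lambda>x. cl (w x)"] \<open>M \<ge> 0\<close> 
      by (cases "l2norm ?\<mu> (\<lambda>x. cl (w x)) = 0") (auto simp: power2_eq_square)
    then show ?thesis by (simp add: cl_def)
  qed
  have "(\<lambda>k::nat. \<integral>x. (norm (max (- real (Suc k)) (min (real (Suc k)) (w x))))\<^sup>2 \<partial>?\<mu>) \<longlonglongrightarrow> (\<integral>x. (norm (w x))\<^sup>2 \<partial>?\<mu>)"
  proof (rule integral_dominated_convergence[where w="\<lambda>x. (norm (w x))\<^sup>2"])
    show "AE x in ?\<mu>. (\<lambda>k. (norm (max (- real (Suc k)) (min (real (Suc k)) (w x))))\<^sup>2) \<longlonglongrightarrow> (norm (w x))\<^sup>2"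
    proof (rule AE_I2)
      fix x
      obtain k0 where k0: "\<bar>w x\<bar> \<le> real k0" using real_arch_simple by blast
      have "\<forall>\<^sub>F k in sequentially. max (- real (Suc k)) (min (real (Suc k)) (w x)) = w x"
        using eventually_ge_at_top[of k0] by eventually_elim (use k0 in auto)
      then show "(\<lambda>k. (norm (max (- real (Suc k)) (min (real (Suc k)) (w x))))\<^sup>2) \<longlonglongrightarrow> (norm (w x))\<^sup>2"
        by (intro tendsto_eventually) (auto elim: eventually_mono)
    qed
    show "integrable ?\<mu> (\<lambda>x. (norm (w x))\<^sup>2)" by (rule L2_integrable[OF w])
    show "AE x in ?\<mu>. norm ((norm (max (- real (Suc k)) (min (real (Suc k)) (w x))))\<^sup>2) \<le> (norm (w x))\<^sup>2" for k
      by (rule AE_I2) (auto simp: abs_le_square_iff[symmetric])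
  qed measurable
  from LIMSEQ_le_const2[OF tendsto_real_sqrt[OF this]] trunc show ?thesis
    unfolding l2norm_def by (metis of_nat_0_less_iff zero_less_Suc)
qed


subsection \<open>Translations\<close>

lemma lebesgue_translation:
  fixes h :: "'a::euclidean_space"
  shows translation_measurable_lebesgue: "(\<lambda>x. x + h) \<in> lebesgue \<rightarrow>\<^sub>M lebesgue"
    and distr_lebesgue_translation: "distr lebesgue lebesgue (\<lambda>x. x + h) = lebesgue"
proof -
  have *: "(\<lambda>x. h + (\<Sum>j\<in>Basis. (1 * (x \<bullet> j)) *\<^sub>R j)) = (\<lambda>x. x + h)"
    by (auto simp: euclidean_representation add.commute)
  show "(\<lambda>x. x + h) \<in> lebesgue \<rightarrow>\<^sub>M lebesgue"
    using lebesgue_affine_measurable[of "\<lambda>_. 1" h] unfolding * by simp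
  show "distr lebesgue lebesgue (\<lambda>x. x + h) = lebesgue"
    using lebesgue_affine_euclidean[of "\<lambda>_. 1" h] unfolding * by (simp add: density_1)
qed

lemma translation_measurable:
  "f \<in> lebesgue \<rightarrow>\<^sub>M N \<Longrightarrow> (\<lambda>x. f (x + h)) \<in> lebesgue \<rightarrow>\<^sub>M N"
  using measurable_compose[OF translation_measurable_lebesgue] .

lemma integral_lebesgue_translation:
  fixes f :: "'a::euclidean_space \<Rightarrow> 'b::euclidean_space"
  assumes "f \<in> borel_measurable lebesgue"
  shows "(\<integral>x. f (x + h) \<partial>lebesgue) = (\<integral>x. f x \<partial>lebesgue)"
  using integral_distr[OF translation_measurable_lebesgue assms, of h]
  by (simp add: distr_lebesgue_translation)

lemma integrable_lebesgue_translation: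
  fixes f :: "'a::euclidean_space \<Rightarrow> 'b::euclidean_space"
  assumes "integrable lebesgue f"
  shows "integrable lebesgue (\<lambda>x. f (x + h))"
  using integrable_distr_eq[OF translation_measurable_lebesgue, of f h] assms
  by (simp add: distr_lebesgue_translation borel_measurable_integrable)

lemma lebesgue_on_zero_off:
  fixes f :: "'a::euclidean_space \<Rightarrow> 'b::euclidean_space"
  assumes "S \<in> sets lebesgue" "\<And>x. x \<notin> S \<Longrightarrow> f x = 0"
  shows integral_lebesgue_on_zero_off: "(\<integral>x. f x \<partial>lebesgue_on S) = (\<integral>x. f x \<partial>lebesgue)"
    and integrable_lebesgue_on_zero_off: "integrable (lebesgue_on S) f \<longleftrightarrow> integrable lebesgue f"
proof -
  have "(\<lambda>x. indicator S x *\<^sub>R f x) = f" using assms(2) by (auto simp: indicator_def)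
  then show "(\<integral>x. f x \<partial>lebesgue_on S) = (\<integral>x. f x \<partial>lebesgue)"
    "integrable (lebesgue_on S) f \<longleftrightarrow> integrable lebesgue f"
    using assms(1) by (simp_all add: integral_restrict_space integrable_restrict_space)
qed

lemma bounded_continuous_L2:
  fixes \<phi> :: "'a::euclidean_space \<Rightarrow> real"
  assumes "S \<in> lmeasurable" "continuous_on UNIV \<phi>" "\<And>x. \<bar>\<phi> x\<bar> \<le> B"
  shows "\<phi> \<in> L2 (lebesgue_on S)"
proof (rule L2_bound[where g="\<lambda>_. B\<^sup>2"])
  show "\<phi> \<in> borel_measurable (lebesgue_on S)"
    using assms by (intro continuous_imp_measurable_on_sets_lebesgue) (auto intro: continuous_on_subset)
  show "integrable (lebesgue_on S) (\<lambda>_. B\<^sup>2)"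
    using finite_measure_lebesgue_on[OF assms(1)] by (rule finite_measure.integrable_const)
  show "(norm (\<phi> x))\<^sup>2 \<le> B\<^sup>2" for x
    using assms(3)[of x] by (simp add: abs_le_square_iff[symmetric])
qed

lemma frechet_derivative_eq_partials:
  assumes "\<phi> differentiable (at x)"
  shows "frechet_derivative \<phi> (at x) h = (\<Sum>i\<in>UNIV. h $ i * partial_deriv i \<phi> x)"
proof -
  interpret linear "frechet_derivative \<phi> (at x)" by (rule linear_frechet_derivative[OF assms])
  have "h = (\<Sum>i\<in>UNIV. h $ i *\<^sub>R axis i 1)"
    using basis_expansion[of h] by (simp add: scalar_mult_eq_scaleR)
  then have "frechet_derivative \<phi> (at x) h = frechet_derivative \<phi> (at x) (\<Sum>i\<in>UNIV. h $ i *\<^sub>R axis i 1)"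
    by simp
  then show ?thesis by (simp add: sum scale partial_deriv_def)
qed

lemma test_function_bounded:
  assumes "\<phi> \<in> test_functions E"
  obtains B where "B \<ge> 0" "\<And>x. \<bar>\<phi> x\<bar> \<le> B" "\<And>i x. \<bar>partial_deriv i \<phi> x\<bar> \<le> B"
proof -
  let ?C = "closure {x. \<phi> x \<noteq> 0}"
  have bnd: "\<exists>B. \<forall>x. \<bar>\<psi> x\<bar> \<le> B" if "continuous_on UNIV \<psi>" "\<And>x. x \<notin> ?C \<Longrightarrow> \<psi> x = 0" for \<psi> :: "real^2 \<Rightarrow> real"
  proof -
    have "compact (\<psi> ` ?C)"
      using that(1) test_functionsD(6)[OF assms] by (intro compact_continuous_image) (auto intro: continuous_on_subset)
    then obtain B where "\<forall>x\<in>?C. \<bar>\<psi> x\<bar> \<le> B" by (force dest!: compact_imp_bounded simp: bounded_iff)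
    then have "\<bar>\<psi> x\<bar> \<le> max B 0" for x using that(2)[of x] by (cases "x \<in> ?C") auto
    then show ?thesis by blast
  qed
  have "\<exists>B. \<forall>x. \<bar>\<phi> x\<bar> \<le> B"
  proof (rule bnd[OF test_functionsD(4)[OF assms]])
    show "\<phi> x = 0" if "x \<notin> ?C" for x
      using that subsetD[OF closure_subset[of "{x. \<phi> x \<noteq> 0}"], of x] by auto
  qed
  then obtain B0 where B0: "\<And>x. \<bar>\<phi> x\<bar> \<le> B0" by blast
  have "\<exists>B. \<forall>x. \<bar>partial_deriv i \<phi> x\<bar> \<le> B" for i
  proof (rule bnd[OF test_functionsD(5)[OF assms]])
    fix x assume x: "x \<notin> ?C"
    have "((\<lambda>_. 0) has_derivative (\<lambda>_. 0)) (at x)" by simp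
    then have "(\<phi> has_derivative (\<lambda>_. 0)) (at x)"
    proof (rule has_derivative_transform_within_open[where s="- ?C"])
      show "0 = \<phi> y" if "y \<in> - ?C" for y
        using that subsetD[OF closure_subset[of "{x. \<phi> x \<noteq> 0}"], of y] by auto
    qed (use x in auto)
    then show "partial_deriv i \<phi> x = 0" by (simp add: partial_deriv_eq)
  qed
  then obtain B where B: "\<And>i x. \<bar>partial_deriv i \<phi> x\<bar> \<le> B i" by metis
  show ?thesis
  proof (rule that[of "\<bar>B0\<bar> + (\<Sum>i\<in>UNIV. \<bar>B i\<bar>)"])
    show "\<bar>\<phi> x\<bar> \<le> \<bar>B0\<bar> + (\<Sum>i\<in>UNIV. \<bar>B i\<bar>)" for x
    proof -
      have "0 \<le> (\<Sum>i\<in>UNIV. \<bar>B i\<bar>)" by (simp add: sum_nonneg)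
      then show ?thesis using B0[of x] by linarith
    qed
    show "\<bar>partial_deriv i \<phi> x\<bar> \<le> \<bar>B0\<bar> + (\<Sum>i\<in>UNIV. \<bar>B i\<bar>)" for i x
      using B[of i x] member_le_sum[of i UNIV "\<lambda>i. \<bar>B i\<bar>"] by auto
  qed (auto intro!: add_nonneg_nonneg sum_nonneg)
qed

lemma test_function_L2:
  assumes "\<phi> \<in> test_functions E" "S \<in> lmeasurable"
  shows "\<phi> \<in> L2 (lebesgue_on S)" "partial_deriv i \<phi> \<in> L2 (lebesgue_on S)"
proof -
  obtain B where B: "B \<ge> 0" "\<And>x. \<bar>\<phi> x\<bar> \<le> B" "\<And>i x. \<bar>partial_deriv i \<phi> x\<bar> \<le> B"
    by (rule test_function_bounded[OF assms(1)]) (rule that)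
  show "\<phi> \<in> L2 (lebesgue_on S)"
    by (rule bounded_continuous_L2[OF assms(2) test_functionsD(4)[OF assms(1)] B(2)])
  show "partial_deriv i \<phi> \<in> L2 (lebesgue_on S)"
    by (rule bounded_continuous_L2[OF assms(2) test_functionsD(5)[OF assms(1)] B(3)])
qed

text \<open>The derivative falls on the smooth factor, so integrability of \<open>u\<close> suffices
  for differentiating under the integral: by the mean value theorem the difference quotients of
  \<open>\<phi>\<close> in direction \<open>h\<close> are bounded by \<open>B'\<close>, and
  \<open>B'\<close> times the absolute value of \<open>u\<close> dominates.\<close>

lemma translated_pairing_deriv:
  assumes "\<phi> \<in> test_functions E" and u: "integrable lebesgue u"
  shows "((\<lambda>s. \<integral>x. u x * \<phi> (x - s *\<^sub>R h) \<partial>lebesgue) has_field_derivative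
     (- (\<integral>x. u x * (\<Sum>i\<in>UNIV. h $ i * partial_deriv i \<phi> (x - s *\<^sub>R h)) \<partial>lebesgue))) (at s)"
proof -
  obtain B where B: "B \<ge> 0" "\<And>x. \<bar>\<phi> x\<bar> \<le> B" "\<And>i x. \<bar>partial_deriv i \<phi> x\<bar> \<le> B"
    by (rule test_function_bounded[OF assms(1)]) (rule that)
  define d where "d x = (\<Sum>i\<in>UNIV. h $ i * partial_deriv i \<phi> x)" for x
  define B' where "B' = (\<Sum>i\<in>UNIV. \<bar>h $ i\<bar> * B)"
  have dB: "\<bar>d x\<bar> \<le> B'" for x
    unfolding d_def B'_def
    by (rule order_trans[OF sum_abs]) (auto simp: abs_mult intro!: sum_mono mult_left_mono B)
  have meas: "continuous_on UNIV f \<Longrightarrow> (\<lambda>x. f (x - a)) \<in> borel_measurable lebesgue"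
    for f :: "real^2 \<Rightarrow> real" and a
    using continuous_imp_measurable_on_sets_lebesgue[of UNIV "\<lambda>x. f (x - a)"]
      continuous_on_compose2[of UNIV f UNIV "\<lambda>x. x - a"]
    by (auto simp: continuous_intros)
  have [measurable]: "u \<in> borel_measurable lebesgue" using u by auto
  have [measurable]: "(\<lambda>x. \<phi> (x - a)) \<in> borel_measurable lebesgue" for a
    by (rule meas[OF test_functionsD(4)[OF assms(1)]])
  have [measurable]: "(\<lambda>x. d (x - a)) \<in> borel_measurable lebesgue" for a
    unfolding d_def by (rule meas) (intro continuous_intros test_functionsD(5)[OF assms(1)])
  have D: "((\<lambda>s. \<phi> (x - s *\<^sub>R h)) has_field_derivative (- d (x - s *\<^sub>R h))) (at s)" for x s
  proof -
    have diff: "\<phi> differentiable (at (x - s *\<^sub>R h))" by (rule test_functionsD(3)[OF assms(1)])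
    have "((\<lambda>s. x - s *\<^sub>R h) has_derivative (\<lambda>v. - (v *\<^sub>R h))) (at s)"
      by (auto intro!: derivative_eq_intros)
    from has_derivative_compose[OF this diff[unfolded frechet_derivative_works]]
    have "((\<lambda>s. \<phi> (x - s *\<^sub>R h)) has_derivative (\<lambda>v. frechet_derivative \<phi> (at (x - s *\<^sub>R h)) (- (v *\<^sub>R h)))) (at s)" .
    moreover have "frechet_derivative \<phi> (at (x - s *\<^sub>R h)) (- (v *\<^sub>R h)) = - d (x - s *\<^sub>R h) * v" for v
      unfolding frechet_derivative_eq_partials[OF diff] d_def
      by (simp add: sum_distrib_left sum_distrib_right sum_negf mult_ac)
    moreover have "(*) (- d (x - s *\<^sub>R h)) = (\<lambda>v. - d (x - s *\<^sub>R h) * v)" by (rule ext) simp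
    ultimately show ?thesis by (simp only: has_field_derivative_def)
  qed
  have int: "integrable lebesgue (\<lambda>x. u x * \<phi> (x - a))" for a
    by (rule Bochner_Integration.integrable_bound[where f="\<lambda>x. u x * B"])
       (use u B in \<open>auto simp: abs_mult intro!: mult_left_mono\<close>)
  have "((\<lambda>y. ((\<integral>x. u x * \<phi> (x - y *\<^sub>R h) \<partial>lebesgue) - (\<integral>x. u x * \<phi> (x - s *\<^sub>R h) \<partial>lebesgue)) / (y - s)) 
     \<longlongrightarrow> - (\<integral>x. u x * d (x - s *\<^sub>R h) \<partial>lebesgue)) (at s)"
    unfolding tendsto_at_iff_sequentially
  proof (intro allI impI)
    fix X assume X: "\<forall>i. X i \<in> UNIV - {s}" "X \<longlonglongrightarrow> s"
    define q where "q n x = (\<phi> (x - X n *\<^sub>R h) - \<phi> (x - s *\<^sub>R h)) / (X n - s)" for n x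
    have [measurable]: "q n \<in> borel_measurable lebesgue" for n unfolding q_def by measurable
    have qb: "\<bar>q n x\<bar> \<le> B'" for n x
    proof -
      have mvt: "\<bar>\<phi> (x - b *\<^sub>R h) - \<phi> (x - a *\<^sub>R h)\<bar> \<le> B' * \<bar>b - a\<bar>" if ab: "a < b" for a b
      proof -
        obtain z where "\<phi> (x - b *\<^sub>R h) - \<phi> (x - a *\<^sub>R h) = (b - a) * (- d (x - z *\<^sub>R h))"
          using MVT2[OF ab, of "\<lambda>s. \<phi> (x - s *\<^sub>R h)" "\<lambda>s. - d (x - s *\<^sub>R h)"] D by blast
        then show ?thesis using dB[of "x - z *\<^sub>R h"] ab
          by (simp add: abs_mult mult.commute mult_left_mono)
      qed
      have "X n \<noteq> s" using X by auto
      then show ?thesis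
        using mvt[of s "X n"] mvt[of "X n" s] unfolding q_def
        by (cases "X n < s") (auto simp: abs_divide divide_le_eq abs_minus_commute)
    qed
    have "(\<lambda>n. \<integral>x. u x * q n x \<partial>lebesgue) \<longlonglongrightarrow> (\<integral>x. u x * (- d (x - s *\<^sub>R h)) \<partial>lebesgue)"
    proof (rule integral_dominated_convergence[where w="\<lambda>x. \<bar>u x\<bar> * B'"])
      show "integrable lebesgue (\<lambda>x. \<bar>u x\<bar> * B')" using u by auto
      show "AE x in lebesgue. norm (u x * q n x) \<le> \<bar>u x\<bar> * B'" for n
        by (rule AE_I2) (auto simp: abs_mult intro!: mult_left_mono qb)
      show "AE x in lebesgue. (\<lambda>n. u x * q n x) \<longlonglongrightarrow> u x * (- d (x - s *\<^sub>R h))"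
      proof (rule AE_I2)
        fix x
        have "(\<lambda>n. q n x) \<longlonglongrightarrow> - d (x - s *\<^sub>R h)"
          using D[of x s] X unfolding has_field_derivative_iff tendsto_at_iff_sequentially
          by (auto simp: q_def[abs_def] o_def)
        then show "(\<lambda>n. u x * q n x) \<longlonglongrightarrow> u x * (- d (x - s *\<^sub>R h))" by (intro tendsto_intros)
      qed
    qed measurable
    moreover have "(\<integral>x. u x * q n x \<partial>lebesgue) =
        ((\<integral>x. u x * \<phi> (x - X n *\<^sub>R h) \<partial>lebesgue) - (\<integral>x. u x * \<phi> (x - s *\<^sub>R h) \<partial>lebesgue)) / (X n - s)" for n
    proof -
      have "(\<integral>x. u x * q n x \<partial>lebesgue) = (\<integral>x. (u x * \<phi> (x - X n *\<^sub>R h) - u x * \<phi> (x - s *\<^sub>R h)) / (X n - s) \<partial>lebesgue)"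
        by (intro Bochner_Integration.integral_cong) (auto simp: q_def algebra_simps)
      then show ?thesis using int by simp
    qed
    ultimately show "((\<lambda>y. ((\<integral>x. u x * \<phi> (x - y *\<^sub>R h) \<partial>lebesgue) - (\<integral>x. u x * \<phi> (x - s *\<^sub>R h) \<partial>lebesgue)) / (y - s)) \<circ> X)
       \<longlonglongrightarrow> - (\<integral>x. u x * d (x - s *\<^sub>R h) \<partial>lebesgue)"
      by (simp add: o_def)
  qed
  then show ?thesis by (simp add: has_field_derivative_iff d_def)
qed

subsection \<open>Weak gradients\<close>

locale bounded_open =
  fixes \<Omega> :: "(real^2) set"
  assumes open_Omega: "open \<Omega>" and bounded_Omega: "bounded \<Omega>"
begin

abbreviation "\<mu> \<equiv> lebesgue_on \<Omega>"

abbreviation "wgrad \<equiv> has_weak_gradient \<Omega>"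

lemma lmeasurable_Omega: "\<Omega> \<in> lmeasurable"
  by (simp add: bounded_Omega lmeasurable_open open_Omega)

lemma sets_Omega: "\<Omega> \<in> sets lebesgue"
  using lmeasurable_Omega by auto

lemma finite_mu: "finite_measure \<mu>"
  by (rule finite_measure_lebesgue_on[OF lmeasurable_Omega])

lemma has_weak_gradientD:
  assumes "wgrad u g"
  shows "u \<in> L2 \<mu>" "g \<in> L2 \<mu>"
    "\<phi> \<in> test_functions \<Omega> \<Longrightarrow>
       (\<integral>x. u x * partial_deriv i \<phi> x \<partial>\<mu>) = - (\<integral>x. (g x $ i) * \<phi> x \<partial>\<mu>)"
  using assms by (auto simp: has_weak_gradient_def Lp_2_eq)

lemma L2_component:
  fixes g :: "real^2 \<Rightarrow> real^2"
  assumes "g \<in> L2 M"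
  shows "(\<lambda>x. g x $ i) \<in> L2 M"
proof (rule L2_bound[where g="\<lambda>x. (norm (g x))\<^sup>2"])
  show "(\<lambda>x. g x $ i) \<in> borel_measurable M"
    using L2_measurable[OF assms] borel_measurable_inner[of g M "\<lambda>_. axis i 1"]
    by (simp add: inner_axis)
  show "(norm (g x $ i))\<^sup>2 \<le> (norm (g x))\<^sup>2" for x
    by (intro power_mono Finite_Cartesian_Product.norm_nth_le) auto
qed (rule L2_integrable[OF assms])

lemma L2_inner_const:
  assumes "g \<in> L2 M"
  shows "(\<lambda>x. h \<bullet> g x) \<in> L2 M" "l2norm M (\<lambda>x. h \<bullet> g x) \<le> norm h * l2norm M g"
proof -
  have le: "(norm (h \<bullet> g x))\<^sup>2 \<le> (norm h)\<^sup>2 * (norm (g x))\<^sup>2" for x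
    using Cauchy_Schwarz_ineq2[of h "g x"] abs_le_square_iff[of "h \<bullet> g x" "norm h * norm (g x)"]
    by (simp add: power_mult_distrib)
  have int: "integrable M (\<lambda>x. (norm h)\<^sup>2 * (norm (g x))\<^sup>2)" using L2_integrable[OF assms] by simp
  show L: "(\<lambda>x. h \<bullet> g x) \<in> L2 M"
    by (rule L2_bound[OF _ int le]) (use L2_measurable[OF assms] in measurable)
  have "(l2norm M (\<lambda>x. h \<bullet> g x))\<^sup>2 \<le> (norm h * l2norm M g)\<^sup>2"
    unfolding power_mult_distrib l2norm_sq using integral_mono[OF L2_integrable[OF L] int le] by simp
  then show "l2norm M (\<lambda>x. h \<bullet> g x) \<le> norm h * l2norm M g"
    by (rule power2_le_imp_le) (simp add: l2norm_nonneg)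
qed

lemma weak_gradient_add:
  assumes u: "wgrad u g" and v: "wgrad v k"
  shows "wgrad (\<lambda>x. u x + v x) (\<lambda>x. g x + k x)"
proof -
  note U = has_weak_gradientD[OF u] and V = has_weak_gradientD[OF v]
  have "(\<integral>x. (u x + v x) * partial_deriv i \<phi> x \<partial>\<mu>) = - (\<integral>x. ((g x + k x) $ i) * \<phi> x \<partial>\<mu>)"
    if phi: "\<phi> \<in> test_functions \<Omega>" for \<phi> i
  proof -
    note T = test_function_L2[OF phi lmeasurable_Omega]
    show ?thesis
      using U(3)[OF phi, of i] V(3)[OF phi, of i]
        L2_mult[OF U(1) T(2)[of i]] L2_mult[OF V(1) T(2)[of i]]
        L2_mult[OF L2_component[OF U(2)] T(1), of i] L2_mult[OF L2_component[OF V(2)] T(1), of i]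
      by (simp add: distrib_right)
  qed
  then show ?thesis unfolding has_weak_gradient_def Lp_2_eq
    by (intro conjI L2_add U V ballI allI) auto
qed

lemma weak_gradient_scaleR:
  assumes u: "wgrad u g"
  shows "wgrad (\<lambda>x. c * u x) (\<lambda>x. c *\<^sub>R g x)"
proof -
  note U = has_weak_gradientD[OF u]
  have "(\<integral>x. (c * u x) * partial_deriv i \<phi> x \<partial>\<mu>) = - (\<integral>x. ((c *\<^sub>R g x) $ i) * \<phi> x \<partial>\<mu>)"
    if phi: "\<phi> \<in> test_functions \<Omega>" for \<phi> i
    using U(3)[OF phi, of i] by (simp add: mult.assoc)
  then show ?thesis unfolding has_weak_gradient_def Lp_2_eq
    using L2_scaleR[OF U(1), of c] L2_scaleR[OF U(2), of c] by auto
qed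

lemma weak_gradient_diff:
  assumes "wgrad u g" "wgrad v k"
  shows "wgrad (\<lambda>x. u x - v x) (\<lambda>x. g x - k x)"
  using weak_gradient_add[OF assms(1) weak_gradient_scaleR[OF assms(2), of "-1"]] by simp

lemma weak_gradient_zero: "wgrad (\<lambda>x. 0) (\<lambda>x. 0)"
  using L2_const[OF finite_mu, where c="0::real"] L2_const[OF finite_mu, where c="0::real^2"]
  by (simp add: has_weak_gradient_def Lp_2_eq)

text \<open>Each component of \<open>g\<close> pairs to 0 with every test function, so the duality
  bound applies with the constant 0.\<close>

lemma weak_gradient_AE_zero:
  assumes u: "wgrad u g" and "AE x in \<mu>. u x = 0"
  shows "AE x in \<mu>. g x = 0"
proof -
  note U = has_weak_gradientD[OF u]
  have "AE x in \<mu>. g x $ i = 0" for i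
  proof -
    have "l2norm \<mu> (\<lambda>x. g x $ i) \<le> 0"
    proof (rule L2_norm_le_by_test_functions[OF open_Omega bounded_Omega L2_component[OF U(2)]])
      fix \<phi> assume "\<phi> \<in> test_functions \<Omega>"
      then have "(\<integral>x. g x $ i * \<phi> x \<partial>\<mu>) = - (\<integral>x. u x * partial_deriv i \<phi> x \<partial>\<mu>)"
        using U(3) by simp
      also have "(\<integral>x. u x * partial_deriv i \<phi> x \<partial>\<mu>) = 0"
        by (rule integral_eq_zero_AE) (use assms(2) in \<open>auto elim: eventually_mono\<close>)
      finally show "(\<integral>x. g x $ i * \<phi> x \<partial>\<mu>) \<le> 0 * l2norm \<mu> \<phi>" by simp
    qed simp
    then show ?thesis
      using L2_AE_zero[OF L2_component[OF U(2)]] l2norm_nonneg[of \<mu> "\<lambda>x. g x $ i"] by force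
  qed
  then have "AE x in \<mu>. \<forall>i\<in>UNIV. g x $ i = 0" by (intro AE_finite_allI) auto
  then show ?thesis by (rule eventually_mono) (auto simp: vec_eq_iff)
qed

lemma weak_gradient_unique:
  assumes "wgrad u g" "wgrad v k" "AE x in \<mu>. u x = v x"
  shows "AE x in \<mu>. g x = k x"
proof -
  have "AE x in \<mu>. u x - v x = 0" using assms(3) by (rule eventually_mono) simp
  from weak_gradient_AE_zero[OF weak_gradient_diff[OF assms(1,2)] this]
  show ?thesis by (rule eventually_mono) simp
qed

lemma weak_gradient_works: "u \<in> W12 \<Omega> \<Longrightarrow> wgrad u (weak_gradient \<Omega> u)"
  unfolding W12_def weak_gradient_def using someI_ex[of "wgrad u"] by simp

lemma weak_gradient_AE_eq:
  assumes "wgrad u g"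
  shows "AE x in \<mu>. weak_gradient \<Omega> u x = g x"
  using assms weak_gradient_works[of u] weak_gradient_unique[of u _ u g] by (auto simp: W12_def)

lemma W12_norm_eq:
  assumes "wgrad u g"
  shows "W12_norm \<Omega> u = sqrt ((l2norm \<mu> u)\<^sup>2 + (l2norm \<mu> g)\<^sup>2)"
proof -
  have "wgrad u (weak_gradient \<Omega> u)"
    using weak_gradient_works assms by (auto simp: W12_def)
  then have "l2norm \<mu> (weak_gradient \<Omega> u) = l2norm \<mu> g"
    by (intro l2norm_cong_AE weak_gradient_AE_eq assms) (use has_weak_gradientD(2) assms L2_measurable in blast)+
  then show ?thesis by (simp add: W12_norm_def Lp_norm_2_eq)
qed

text \<open>Closedness of the weak gradient: against a fixed test function both sides of the
  defining identity are continuous in L^2 by Cauchy-Schwarz. Together with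
  \<open>L2_complete\<close> it plays the role of the completeness of W^{1,2}.\<close>

lemma weak_gradient_limit:
  assumes s: "\<And>n::nat. wgrad (s n) (g n)"
    and u: "u \<in> L2 \<mu>" "(\<lambda>n. l2norm \<mu> (\<lambda>x. s n x - u x)) \<longlonglongrightarrow> 0"
    and k: "k \<in> L2 \<mu>" "(\<lambda>n. l2norm \<mu> (\<lambda>x. g n x - k x)) \<longlonglongrightarrow> 0"
  shows "wgrad u k"
proof -
  note S = has_weak_gradientD[OF s]
  have lim: "(\<lambda>n. \<integral>x. a n x * \<psi> x \<partial>\<mu>) \<longlonglongrightarrow> (\<integral>x. b x * \<psi> x \<partial>\<mu>)"
    if a: "\<And>n. a n \<in> L2 \<mu>" "b \<in> L2 \<mu>" "(\<lambda>n. l2norm \<mu> (\<lambda>x. a n x - b x)) \<longlonglongrightarrow> 0" "\<psi> \<in> L2 \<mu>"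
    for a :: "nat \<Rightarrow> real^2 \<Rightarrow> real" and b \<psi> 
  proof -
    have bd: "\<bar>(\<integral>x. a n x * \<psi> x \<partial>\<mu>) - (\<integral>x. b x * \<psi> x \<partial>\<mu>)\<bar> \<le> l2norm \<mu> (\<lambda>x. a n x - b x) * l2norm \<mu> \<psi>" for n
    proof -
      have eq: "(\<integral>x. a n x * \<psi> x \<partial>\<mu>) - (\<integral>x. b x * \<psi> x \<partial>\<mu>) = (\<integral>x. (a n x - b x) * \<psi> x \<partial>\<mu>)"
        using L2_mult[OF a(1) a(4)] L2_mult[OF a(2) a(4)] by (simp add: left_diff_distrib)
      \<comment> \<open>\<open>L2_Cauchy_Schwarz\<close> is one-sided; applying it to the difference
        and to its negative bounds the absolute value.\<close>
      have "(\<lambda>x. - (a n x - b x)) \<in> L2 \<mu>" "l2norm \<mu> (\<lambda>x. - (a n x - b x)) = l2norm \<mu> (\<lambda>x. a n x - b x)"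
        using L2_uminus[OF L2_diff[OF a(1)[of n] a(2)]] l2norm_scaleR[of \<mu> "-1" "\<lambda>x. a n x - b x"] by simp_all
      moreover have "(\<integral>x. (- (a n x - b x)) * \<psi> x \<partial>\<mu>) = - (\<integral>x. (a n x - b x) * \<psi> x \<partial>\<mu>)"
        by (subst integral_minus[symmetric]) (simp add: algebra_simps)
      ultimately show ?thesis unfolding eq
        using L2_Cauchy_Schwarz[OF L2_diff[OF a(1)[of n] a(2)] a(4)]
          L2_Cauchy_Schwarz[of "\<lambda>x. - (a n x - b x)" \<mu> \<psi>] a(4) by (simp add: abs_le_iff)
    qed
    have "(\<lambda>n. l2norm \<mu> (\<lambda>x. a n x - b x) * l2norm \<mu> \<psi>) \<longlonglongrightarrow> 0"
      using tendsto_mult_right[OF a(3)] by simp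
    then have "(\<lambda>n. (\<integral>x. a n x * \<psi> x \<partial>\<mu>) - (\<integral>x. b x * \<psi> x \<partial>\<mu>)) \<longlonglongrightarrow> 0"
      by (rule Lim_null_comparison[rotated]) (use bd in simp)
    then show ?thesis by (simp add: LIM_zero_iff)
  qed
  have "(\<integral>x. u x * partial_deriv i \<phi> x \<partial>\<mu>) = - (\<integral>x. (k x $ i) * \<phi> x \<partial>\<mu>)"
    if phi: "\<phi> \<in> test_functions \<Omega>" for \<phi> i
  proof -
    note T = test_function_L2[OF phi lmeasurable_Omega]
    have ki: "(\<lambda>n. l2norm \<mu> (\<lambda>x. g n x $ i - k x $ i)) \<longlonglongrightarrow> 0"
    proof (rule tendsto_sandwich[where f="\<lambda>_. 0", OF _ _ tendsto_const k(2)])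
      have "l2norm \<mu> (\<lambda>x. g n x $ i - k x $ i) \<le> l2norm \<mu> (\<lambda>x. g n x - k x)" for n
        using L2_inner_const(2)[OF L2_diff[OF S(2)[of n] k(1)], of "axis i 1"]
        by (simp add: inner_axis' inner_commute)
      then show "\<forall>\<^sub>F n in sequentially. l2norm \<mu> (\<lambda>x. g n x $ i - k x $ i) \<le> l2norm \<mu> (\<lambda>x. g n x - k x)"
        by simp
    qed (simp add: l2norm_nonneg)
    have "(\<lambda>n. \<integral>x. s n x * partial_deriv i \<phi> x \<partial>\<mu>) \<longlonglongrightarrow> (\<integral>x. u x * partial_deriv i \<phi> x \<partial>\<mu>)"
      by (rule lim[OF S(1) u T(2)])
    moreover have "(\<lambda>n. - (\<integral>x. (g n x $ i) * \<phi> x \<partial>\<mu>)) \<longlonglongrightarrow> - (\<integral>x. (k x $ i) * \<phi> x \<partial>\<mu>)"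
      by (intro tendsto_minus lim[OF _ _ ki T(1)] L2_component S k)
    ultimately show ?thesis unfolding S(3)[OF phi] using LIMSEQ_unique by blast
  qed
  then show ?thesis using u k by (auto simp: has_weak_gradient_def Lp_2_eq)
qed

text \<open>By duality it suffices to test against \<open>\<phi>\<close>, and there the translation can be moved to \<open>\<phi>\<close>,
  where the mean value theorem and the definition of the weak gradient apply.\<close>

lemma translation_estimate:
  assumes u: "wgrad u g" and E: "open E"
    and tube: "\<And>x s. x \<in> E \<Longrightarrow> 0 \<le> s \<Longrightarrow> s \<le> 1 \<Longrightarrow> x + s *\<^sub>R h \<in> \<Omega>"
  shows "(\<lambda>x. u (x + h)) \<in> L2 (lebesgue_on E)" "u \<in> L2 (lebesgue_on E)"
    and "l2norm (lebesgue_on E) (\<lambda>x. u (x + h) - u x) \<le> norm h * l2norm \<mu> g"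
proof -
  note U = has_weak_gradientD[OF u]
  have EO: "E \<subseteq> \<Omega>" using tube[of _ 0] by auto
  have bE: "bounded E" using EO bounded_Omega bounded_subset by blast
  have lE: "E \<in> lmeasurable" using E bE by (simp add: lmeasurable_open)
  then have sE: "E \<in> sets lebesgue" by auto
  have hO: "x + h \<in> \<Omega>" if "x \<in> E" for x using tube[OF that, of 1] by simp
  \<comment> \<open>Extension by 0 moves the integrals to the whole plane, where translation
    invariance is available. The extension need not be weakly differentiable there.\<close>
  define u0 where "u0 x = (if x \<in> \<Omega> then u x else 0)" for x
  have u0O: "u0 \<in> L2 \<mu>"
  proof -
    have "u0 \<in> borel_measurable \<mu> \<longleftrightarrow> u \<in> borel_measurable \<mu>"
      "integrable \<mu> (\<lambda>x. (norm (u0 x))\<^sup>2) \<longleftrightarrow> integrable \<mu> (\<lambda>x. (norm (u x))\<^sup>2)"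
      by (auto intro!: measurable_cong Bochner_Integration.integrable_cong simp: u0_def)
    then show ?thesis using U(1) by (simp add: L2_def)
  qed
  have u0m[measurable]: "u0 \<in> borel_measurable lebesgue"
    using L2_measurable[OF U(1)] sets_Omega unfolding u0_def
    by (simp add: borel_measurable_if_I)
  have u0sq: "integrable lebesgue (\<lambda>x. (norm (u0 x))\<^sup>2)"
    using L2_integrable[OF u0O] integrable_lebesgue_on_zero_off[OF sets_Omega, of "\<lambda>x. (norm (u0 x))\<^sup>2"]
    by (simp add: u0_def)
  have u0i: "integrable lebesgue u0"
    using L2_imp_L1(1)[OF finite_mu u0O] integrable_lebesgue_on_zero_off[OF sets_Omega, of u0]
    by (simp add: u0_def)
  have mE: "f \<in> borel_measurable lebesgue \<Longrightarrow> f \<in> borel_measurable (lebesgue_on E)" for f :: "real^2 \<Rightarrow> real"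
    by (rule measurable_restrict_space1)
  have iE: "integrable lebesgue f \<Longrightarrow> integrable (lebesgue_on E) f" for f :: "real^2 \<Rightarrow> real"
    using integrable_mult_indicator[of E lebesgue f] sE by (simp add: integrable_restrict_space)
  have cong: "v \<in> L2 (lebesgue_on E)" if "v' \<in> L2 (lebesgue_on E)" "\<And>x. x \<in> E \<Longrightarrow> v' x = v x" for v v' :: "real^2 \<Rightarrow> real"
  proof -
    have "v \<in> borel_measurable (lebesgue_on E) \<longleftrightarrow> v' \<in> borel_measurable (lebesgue_on E)"
      "integrable (lebesgue_on E) (\<lambda>x. (norm (v x))\<^sup>2) \<longleftrightarrow> integrable (lebesgue_on E) (\<lambda>x. (norm (v' x))\<^sup>2)"
      using that(2) by (auto intro!: measurable_cong Bochner_Integration.integrable_cong)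
    then show ?thesis using that(1) by (simp add: L2_def)
  qed
  have "u0 \<in> L2 (lebesgue_on E)" using mE[OF u0m] iE[OF u0sq] by (simp add: L2_def)
  then show uE: "u \<in> L2 (lebesgue_on E)" by (rule cong) (use EO in \<open>auto simp: u0_def\<close>)
  have "(\<lambda>x. u0 (x + h)) \<in> L2 (lebesgue_on E)"
    using mE[OF translation_measurable[OF u0m]] iE[OF integrable_lebesgue_translation[OF u0sq]]
    by (simp add: L2_def)
  then show uhE: "(\<lambda>x. u (x + h)) \<in> L2 (lebesgue_on E)" by (rule cong) (use hO in \<open>auto simp: u0_def\<close>)
  show "l2norm (lebesgue_on E) (\<lambda>x. u (x + h) - u x) \<le> norm h * l2norm \<mu> g"
  proof (rule L2_norm_le_by_test_functions[OF E bE L2_diff[OF uhE uE]])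
    fix \<phi> assume phi: "\<phi> \<in> test_functions E"
    obtain B where B: "B \<ge> 0" "\<And>x. \<bar>\<phi> x\<bar> \<le> B" "\<And>i x. \<bar>partial_deriv i \<phi> x\<bar> \<le> B"
      by (rule test_function_bounded[OF phi]) (rule that)
    have pm: "\<phi> \<in> borel_measurable lebesgue"
      using continuous_imp_measurable_on_sets_lebesgue[OF test_functionsD(4)[OF phi]] by simp
    have pm': "(\<lambda>x. \<phi> (x - a)) \<in> borel_measurable lebesgue" for a
      using translation_measurable[OF pm, of "-a"] by simp
    define \<Phi> where "\<Phi> s = (\<integral>x. u0 x * \<phi> (x - s *\<^sub>R h) \<partial>lebesgue)" for s
    have int: "integrable lebesgue (\<lambda>x. u0 x * \<phi> (x - a))" for a
      by (rule Bochner_Integration.integrable_bound[where f="\<lambda>x. u0 x * B"])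
         (use u0i B(1,2) pm'[of a] in \<open>auto simp: abs_mult intro!: mult_left_mono\<close>)
    have "(\<integral>x. (u (x + h) - u x) * \<phi> x \<partial>lebesgue_on E) = (\<integral>x. (u0 (x + h) - u0 x) * \<phi> x \<partial>lebesgue_on E)"
      by (rule Bochner_Integration.integral_cong) (use EO hO in \<open>auto simp: u0_def\<close>)
    also have "\<dots> = (\<integral>x. (u0 (x + h) - u0 x) * \<phi> x \<partial>lebesgue)"
      by (rule integral_lebesgue_on_zero_off[OF sE]) (use test_functionsD(2)[OF phi] in auto)
    also have "\<dots> = (\<integral>x. u0 (x + h) * \<phi> x \<partial>lebesgue) - (\<integral>x. u0 x * \<phi> x \<partial>lebesgue)"
      using integrable_lebesgue_translation[OF int[of h], of h] int[of 0]
      by (simp add: left_diff_distrib)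
    also have "(\<integral>x. u0 (x + h) * \<phi> x \<partial>lebesgue) = (\<integral>x. u0 x * \<phi> (x - h) \<partial>lebesgue)"
      using integral_lebesgue_translation[of "\<lambda>x. u0 x * \<phi> (x - h)" h] pm'[of h] by simp
    finally have eq: "(\<integral>x. (u (x + h) - u x) * \<phi> x \<partial>lebesgue_on E) = \<Phi> 1 - \<Phi> 0"
      by (simp add: \<Phi>_def)
    obtain s where s: "0 < s" "s < 1"
      "\<Phi> 1 - \<Phi> 0 = - (\<integral>x. u0 x * (\<Sum>i\<in>UNIV. h $ i * partial_deriv i \<phi> (x - s *\<^sub>R h)) \<partial>lebesgue)"
      using MVT2[of 0 1 \<Phi> "\<lambda>s. - (\<integral>x. u0 x * (\<Sum>i\<in>UNIV. h $ i * partial_deriv i \<phi> (x - s *\<^sub>R h)) \<partial>lebesgue)"]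
        translated_pairing_deriv[OF phi u0i] unfolding \<Phi>_def by auto
    \<comment> \<open>By \<open>tube\<close> the translate of \<open>E\<close> by
      \<open>s *\<^sub>R h\<close> lies in \<open>\<Omega>\<close>, so \<open>\<psi>\<close> is a
      legitimate test function for the weak gradient of \<open>u\<close> although its support may
      leave \<open>E\<close>.\<close>
    define \<psi> where "\<psi> x = \<phi> (x - s *\<^sub>R h)" for x
    have psi: "\<psi> \<in> test_functions \<Omega>" unfolding \<psi>_def
      by (rule test_functions_translate[OF phi]) (use tube s in auto)
    have pd: "partial_deriv i \<psi> = (\<lambda>x. partial_deriv i \<phi> (x - s *\<^sub>R h))" for i
      unfolding \<psi>_def by (rule partial_deriv_translate(2)) (rule test_functionsD(3)[OF phi])
    note T = test_function_L2[OF psi lmeasurable_Omega]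
    have "- (\<integral>x. u0 x * (\<Sum>i\<in>UNIV. h $ i * partial_deriv i \<phi> (x - s *\<^sub>R h)) \<partial>lebesgue)
        = - (\<integral>x. u0 x * (\<Sum>i\<in>UNIV. h $ i * partial_deriv i \<psi> x) \<partial>\<mu>)"
      by (subst integral_lebesgue_on_zero_off[OF sets_Omega]) (auto simp: u0_def pd)
    also have "\<dots> = - (\<integral>x. (\<Sum>i\<in>UNIV. h $ i * (u x * partial_deriv i \<psi> x)) \<partial>\<mu>)"
      by (intro arg_cong[where f=uminus] Bochner_Integration.integral_cong)
         (auto simp: u0_def sum_distrib_left mult_ac)
    also have "\<dots> = - (\<Sum>i\<in>UNIV. h $ i * (\<integral>x. u x * partial_deriv i \<psi> x \<partial>\<mu>))"
      by (subst Bochner_Integration.integral_sum) (auto intro!: L2_mult U(1) T(2))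
    also have "\<dots> = (\<Sum>i\<in>UNIV. h $ i * (\<integral>x. (g x $ i) * \<psi> x \<partial>\<mu>))"
      by (simp add: U(3)[OF psi] sum_negf)
    also have "\<dots> = (\<integral>x. (\<Sum>i\<in>UNIV. h $ i * ((g x $ i) * \<psi> x)) \<partial>\<mu>)"
      by (subst Bochner_Integration.integral_sum) (auto intro!: L2_mult L2_component U(2) T(1))
    also have "\<dots> = (\<integral>x. (h \<bullet> g x) \<bullet> \<psi> x \<partial>\<mu>)"
      by (intro Bochner_Integration.integral_cong) (auto simp: inner_vec_def sum_distrib_left mult_ac)
    also have "\<dots> \<le> l2norm \<mu> (\<lambda>x. h \<bullet> g x) * l2norm \<mu> \<psi>"
      by (rule L2_Cauchy_Schwarz[OF L2_inner_const(1)[OF U(2)] T(1)])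
    also have "\<dots> \<le> (norm h * l2norm \<mu> g) * l2norm (lebesgue_on E) \<phi>"
    proof (rule mult_mono)
      have "(\<integral>x. (norm (\<psi> x))\<^sup>2 \<partial>\<mu>) = (\<integral>x. (norm (\<psi> x))\<^sup>2 \<partial>lebesgue)"
        by (rule integral_lebesgue_on_zero_off[OF sets_Omega]) (use test_functionsD(2)[OF psi] in auto)
      also have "\<dots> = (\<integral>x. (norm (\<phi> x))\<^sup>2 \<partial>lebesgue)"
        using integral_lebesgue_translation[of "\<lambda>x. (norm (\<psi> x))\<^sup>2" "s *\<^sub>R h"] pm'[of "s *\<^sub>R h"]
        by (simp add: \<psi>_def)
      also have "\<dots> = (\<integral>x. (norm (\<phi> x))\<^sup>2 \<partial>lebesgue_on E)"
        by (rule integral_lebesgue_on_zero_off[OF sE, symmetric]) (use test_functionsD(2)[OF phi] in auto)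
      finally show "l2norm \<mu> \<psi> \<le> l2norm (lebesgue_on E) \<phi>" by (simp add: l2norm_def)
    qed (auto simp: L2_inner_const(2)[OF U(2)] l2norm_nonneg)
    finally show "(\<integral>x. (u (x + h) - u x) * \<phi> x \<partial>lebesgue_on E) \<le> norm h * l2norm \<mu> g * l2norm (lebesgue_on E) \<phi>"
      using eq s(3) by simp
  qed (simp add: l2norm_nonneg)
qed

end


subsection \<open>A Poincare inequality\<close>

text \<open>As a nonnegative integral over the whole space with an indicator, the squared norm can
  be compared between different domains and can be translated.\<close>

lemma l2norm_sq_nn:
  assumes "u \<in> L2 (lebesgue_on A)" "A \<in> sets lebesgue"
  shows "ennreal ((l2norm (lebesgue_on A) u)\<^sup>2) = (\<integral>\<^sup>+x. ennreal ((norm (u x))\<^sup>2) * indicator A x \<partial>lebesgue)"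
  unfolding l2norm_sq using assms(2)
  by (subst nn_integral_eq_integral[OF L2_integrable[OF assms(1)], symmetric])
     (simp_all add: nn_integral_restrict_space)

lemma L2_subset:
  assumes "u \<in> L2 (lebesgue_on S)" "A \<subseteq> S" "A \<in> sets lebesgue" "S \<in> sets lebesgue"
  shows "u \<in> L2 (lebesgue_on A)"
proof -
  have m: "u \<in> borel_measurable (lebesgue_on A)"
    using L2_measurable[OF assms(1)] assms(2) by (rule measurable_restrict_mono)
  have "(\<integral>\<^sup>+x. ennreal ((norm (u x))\<^sup>2) \<partial>lebesgue_on A) \<le> (\<integral>\<^sup>+x. ennreal ((norm (u x))\<^sup>2) \<partial>lebesgue_on S)"
    using assms(2-4) by (auto simp: nn_integral_restrict_space indicator_def intro!: nn_integral_mono)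
  also have "\<dots> < \<infinity>"
    by (subst nn_integral_eq_integral[OF L2_integrable[OF assms(1)]]) auto
  finally have "integrable (lebesgue_on A) (\<lambda>x. (norm (u x))\<^sup>2)"
    using m by (intro integrableI_bounded) auto
  then show ?thesis using m by (simp add: L2_def)
qed

lemma l2norm_sq_mono:
  assumes "u \<in> L2 (lebesgue_on B)" "A \<subseteq> B" "A \<in> sets lebesgue" "B \<in> sets lebesgue"
  shows "(l2norm (lebesgue_on A) u)\<^sup>2 \<le> (l2norm (lebesgue_on B) u)\<^sup>2"
proof -
  have "ennreal ((l2norm (lebesgue_on A) u)\<^sup>2) \<le> ennreal ((l2norm (lebesgue_on B) u)\<^sup>2)"
    unfolding l2norm_sq_nn[OF assms(1,4)] l2norm_sq_nn[OF L2_subset[OF assms] assms(3)]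
    using assms(2) by (intro nn_integral_mono) (auto simp: indicator_def)
  then show ?thesis by (subst (asm) ennreal_le_iff) auto
qed

lemma l2norm_sq_Un:
  assumes "u \<in> L2 (lebesgue_on (A \<union> B))" "A \<in> sets lebesgue" "B \<in> sets lebesgue"
  shows "(l2norm (lebesgue_on (A \<union> B)) u)\<^sup>2 \<le> (l2norm (lebesgue_on A) u)\<^sup>2 + (l2norm (lebesgue_on B) u)\<^sup>2"
proof -
  have AB: "A \<union> B \<in> sets lebesgue" using assms by auto
  have u: "u \<in> L2 (lebesgue_on A)" "u \<in> L2 (lebesgue_on B)"
    using L2_subset[OF assms(1) _ _ AB] assms by auto
  have um: "(\<lambda>x. ennreal ((norm (u x))\<^sup>2) * indicator C x) \<in> borel_measurable lebesgue" 
    if "u \<in> L2 (lebesgue_on C)" "C \<in> sets lebesgue" for C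
  proof -
    have "(\<lambda>x. ennreal ((norm (u x))\<^sup>2)) \<in> borel_measurable (lebesgue_on C)"
      using L2_measurable[OF that(1)] by measurable
    then show ?thesis using that(2)
      by (subst (asm) borel_measurable_restrict_space_iff_ennreal) auto
  qed
  have "ennreal ((l2norm (lebesgue_on (A \<union> B)) u)\<^sup>2) \<le>
      (\<integral>\<^sup>+x. ennreal ((norm (u x))\<^sup>2) * indicator A x + ennreal ((norm (u x))\<^sup>2) * indicator B x \<partial>lebesgue)"
    unfolding l2norm_sq_nn[OF assms(1) AB] by (intro nn_integral_mono) (auto simp: indicator_def)
  also have "\<dots> = ennreal ((l2norm (lebesgue_on A) u)\<^sup>2) + ennreal ((l2norm (lebesgue_on B) u)\<^sup>2)"
    by (subst nn_integral_add) (auto simp: l2norm_sq_nn u assms um)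
  also have "\<dots> = ennreal ((l2norm (lebesgue_on A) u)\<^sup>2 + (l2norm (lebesgue_on B) u)\<^sup>2)"
    by (rule ennreal_plus[symmetric]) auto
  finally show ?thesis by (subst (asm) ennreal_le_iff) auto
qed

context bounded_open
begin

lemma has_weak_gradient_L2:
  assumes "wgrad u g" "A \<subseteq> \<Omega>" "A \<in> sets lebesgue"
  shows "u \<in> L2 (lebesgue_on A)"
  by (rule L2_subset[OF has_weak_gradientD(1)[OF assms(1)] assms(2,3) sets_Omega])

text \<open>A localized Poincare inequality: only the left side depends on \<open>A\<close>, while
  the gradient on all of \<open>\<Omega>\<close> and the integral over the fixed set
  \<open>S\<close> stay on the right. In this form it passes to subsets, finite unions and
  translates, and can be propagated from a single ball.\<close>

definition controlled :: "(real^2) set \<Rightarrow> (real^2) set \<Rightarrow> bool" where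
  "controlled S A \<longleftrightarrow> A \<subseteq> \<Omega> \<and> A \<in> sets lebesgue \<and> (\<exists>C\<ge>0. \<forall>u g. wgrad u g \<longrightarrow>
     (l2norm (lebesgue_on A) u)\<^sup>2 \<le> C * ((l2norm \<mu> g)\<^sup>2 + (\<integral>x. u x \<partial>lebesgue_on S)\<^sup>2))"

lemma controlled_subset:
  assumes "controlled S B" "A \<subseteq> B" "A \<in> sets lebesgue"
  shows "controlled S A"
proof -
  obtain C where C: "C \<ge> 0" "B \<subseteq> \<Omega>" "B \<in> sets lebesgue" "\<And>u g. wgrad u g \<Longrightarrow>
     (l2norm (lebesgue_on B) u)\<^sup>2 \<le> C * ((l2norm \<mu> g)\<^sup>2 + (\<integral>x. u x \<partial>lebesgue_on S)\<^sup>2)"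
    using assms(1) unfolding controlled_def by blast
  have "(l2norm (lebesgue_on A) u)\<^sup>2 \<le> C * ((l2norm \<mu> g)\<^sup>2 + (\<integral>x. u x \<partial>lebesgue_on S)\<^sup>2)"
    if "wgrad u g" for u g
    by (rule order_trans[OF l2norm_sq_mono[OF has_weak_gradient_L2[OF that C(2,3)] assms(2,3) C(3)] C(4)[OF that]])
  then show ?thesis using C(1,2) assms(2,3) unfolding controlled_def by blast
qed

lemma controlled_Un:
  assumes "controlled S A" "controlled S B"
  shows "controlled S (A \<union> B)"
proof -
  let ?R = "\<lambda>u g. (l2norm \<mu> g)\<^sup>2 + (\<integral>x. u x \<partial>lebesgue_on S)\<^sup>2"
  obtain C where C: "C \<ge> 0" "A \<subseteq> \<Omega>" "A \<in> sets lebesgue" "\<And>u g. wgrad u g \<Longrightarrow>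
     (l2norm (lebesgue_on A) u)\<^sup>2 \<le> C * ?R u g"
    using assms(1) unfolding controlled_def by blast
  obtain D where D: "D \<ge> 0" "B \<subseteq> \<Omega>" "B \<in> sets lebesgue" "\<And>u g. wgrad u g \<Longrightarrow>
     (l2norm (lebesgue_on B) u)\<^sup>2 \<le> D * ?R u g"
    using assms(2) unfolding controlled_def by blast
  have AB: "A \<union> B \<subseteq> \<Omega>" "A \<union> B \<in> sets lebesgue" using C D by auto
  have "(l2norm (lebesgue_on (A \<union> B)) u)\<^sup>2 \<le> (C + D) * ?R u g" if w: "wgrad u g" for u g
    using l2norm_sq_Un[OF has_weak_gradient_L2[OF w AB] C(3) D(3)] C(4)[OF w] D(4)[OF w]
    by (simp add: distrib_right)
  then show ?thesis using AB C(1) D(1) unfolding controlled_def 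
    by (intro conjI exI[of _ "C + D"] allI impI) auto
qed

lemma controlled_empty: "controlled S {}"
  unfolding controlled_def by (auto simp: l2norm_def integral_restrict_space intro!: exI[of _ 0])

lemma controlled_UN:
  "finite I \<Longrightarrow> (\<And>i. i \<in> I \<Longrightarrow> controlled S (A i)) \<Longrightarrow> controlled S (\<Union>i\<in>I. A i)"
  by (induction I rule: finite_induct) (auto intro: controlled_Un controlled_empty)

text \<open>On \<open>E\<close>, \<open>u\<close> differs from its translate by a function that the
  translation estimate bounds through the gradient, and the translate on \<open>E\<close> is
  \<open>u\<close> on a subset of \<open>B\<close>.\<close>

lemma controlled_translate:
  assumes B: "controlled S B" and E: "open E" "(\<lambda>x. x + h) ` E \<subseteq> B"
    and tube: "\<And>x s. x \<in> E \<Longrightarrow> 0 \<le> s \<Longrightarrow> s \<le> 1 \<Longrightarrow> x + s *\<^sub>R h \<in> \<Omega>"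
  shows "controlled S E"
proof -
  let ?R = "\<lambda>u g. (l2norm \<mu> g)\<^sup>2 + (\<integral>x. u x \<partial>lebesgue_on S)\<^sup>2"
  obtain C where C: "C \<ge> 0" "B \<subseteq> \<Omega>" "B \<in> sets lebesgue" "\<And>u g. wgrad u g \<Longrightarrow>
     (l2norm (lebesgue_on B) u)\<^sup>2 \<le> C * ?R u g"
    using B unfolding controlled_def by blast
  have sE: "E \<in> sets lebesgue" using E by auto
  have EO: "E \<subseteq> \<Omega>" using tube[of _ 0] by auto
  have "(l2norm (lebesgue_on E) u)\<^sup>2 \<le> (2 * (norm h)\<^sup>2 + 2 * C) * ?R u g" if w: "wgrad u g" for u g
  proof -
    note T = translation_estimate[OF w E(1) tube]
    have uB: "u \<in> L2 (lebesgue_on B)" by (rule has_weak_gradient_L2[OF w C(2,3)])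
    have "(\<lambda>x. ennreal ((norm (u x))\<^sup>2)) \<in> borel_measurable (lebesgue_on B)"
      using L2_measurable[OF uB] by measurable
    then have m: "(\<lambda>x. ennreal ((norm (u x))\<^sup>2) * indicator B x) \<in> borel_measurable lebesgue"
      using C(3) by (subst (asm) borel_measurable_restrict_space_iff_ennreal) auto
    have "ennreal ((l2norm (lebesgue_on E) (\<lambda>x. u (x + h)))\<^sup>2) =
        (\<integral>\<^sup>+x. ennreal ((norm (u (x + h)))\<^sup>2) * indicator E x \<partial>lebesgue)"
      by (rule l2norm_sq_nn[OF T(1) sE]) auto
    also have "\<dots> \<le> (\<integral>\<^sup>+x. ennreal ((norm (u (x + h)))\<^sup>2) * indicator B (x + h) \<partial>lebesgue)"
      using E(2) by (intro nn_integral_mono) (auto simp: indicator_def)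
    also have "\<dots> = (\<integral>\<^sup>+x. ennreal ((norm (u x))\<^sup>2) * indicator B x \<partial>lebesgue)"
      using nn_integral_distr[OF translation_measurable_lebesgue, of _ h] m
      by (simp add: distr_lebesgue_translation)
    also have "\<dots> = ennreal ((l2norm (lebesgue_on B) u)\<^sup>2)" by (rule l2norm_sq_nn[OF uB C(3), symmetric])
    finally have le: "(l2norm (lebesgue_on E) (\<lambda>x. u (x + h)))\<^sup>2 \<le> (l2norm (lebesgue_on B) u)\<^sup>2"
      by (subst (asm) ennreal_le_iff) auto
    have "l2norm (lebesgue_on E) (\<lambda>x. u (x + h) - (u (x + h) - u x)) \<le> 
        l2norm (lebesgue_on E) (\<lambda>x. u (x + h)) + l2norm (lebesgue_on E) (\<lambda>x. u (x + h) - u x)"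
      using l2norm_triangle[OF T(1) L2_uminus[OF L2_diff[OF T(1,2)]]]
        l2norm_scaleR[of "lebesgue_on E" "-1" "\<lambda>x. u (x + h) - u x"] by simp
    also have "\<dots> \<le> l2norm (lebesgue_on E) (\<lambda>x. u (x + h)) + norm h * l2norm \<mu> g"
      using T(3) by simp
    finally have "l2norm (lebesgue_on E) u \<le> l2norm (lebesgue_on E) (\<lambda>x. u (x + h)) + norm h * l2norm \<mu> g" by simp
    then have "(l2norm (lebesgue_on E) u)\<^sup>2 \<le> (l2norm (lebesgue_on E) (\<lambda>x. u (x + h)) + norm h * l2norm \<mu> g)\<^sup>2"
      by (intro power_mono) (auto simp: l2norm_nonneg)
    also have "\<dots> \<le> 2 * (l2norm (lebesgue_on E) (\<lambda>x. u (x + h)))\<^sup>2 + 2 * (norm h * l2norm \<mu> g)\<^sup>2"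
      using norm_add_sq_le[of "l2norm (lebesgue_on E) (\<lambda>x. u (x + h))" "norm h * l2norm \<mu> g"] by simp
    also have "\<dots> \<le> 2 * (C * ?R u g) + 2 * ((norm h)\<^sup>2 * ?R u g)"
    proof (intro add_mono mult_left_mono)
      show "(l2norm (lebesgue_on E) (\<lambda>x. u (x + h)))\<^sup>2 \<le> C * ?R u g"
        using le C(4)[OF w] by simp
      show "(norm h * l2norm \<mu> g)\<^sup>2 \<le> (norm h)\<^sup>2 * ?R u g"
        unfolding power_mult_distrib by (intro mult_left_mono) auto
    qed auto
    finally show ?thesis by (simp add: algebra_simps)
  qed
  then show ?thesis using EO sE C(1) unfolding controlled_def
    by (intro conjI exI[of _ "2 * (norm h)\<^sup>2 + 2 * C"] allI impI) auto
qed

lemma weak_gradient_cong_AE: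
  assumes w: "wgrad u g" and v: "v \<in> borel_measurable \<mu>" "AE x in \<mu>. u x = v x"
  shows "wgrad v g"
proof -
  note W = has_weak_gradientD[OF w]
  have um: "u \<in> borel_measurable \<mu>" using W(1) L2_measurable by blast
  have "integrable \<mu> (\<lambda>x. (norm (u x))\<^sup>2) \<longleftrightarrow> integrable \<mu> (\<lambda>x. (norm (v x))\<^sup>2)"
    using um v by (intro integrable_cong_AE) (auto elim: eventually_mono)
  then have "v \<in> L2 \<mu>" using v(1) L2_integrable[OF W(1)] by (simp add: L2_def)
  moreover have "(\<integral>x. u x * partial_deriv i \<phi> x \<partial>\<mu>) = (\<integral>x. v x * partial_deriv i \<phi> x \<partial>\<mu>)"
    if phi: "\<phi> \<in> test_functions \<Omega>" for \<phi> i
    using L2_measurable[OF test_function_L2(2)[OF phi lmeasurable_Omega, of i]] um v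
    by (intro integral_cong_AE) (auto elim: eventually_mono)
  ultimately show ?thesis using W by (simp add: has_weak_gradient_def Lp_2_eq)
qed

lemma indicator_ball: "indicator (ball a r) y = (if dist a y < r then 1 else 0)"
  by (simp add: indicator_def)

text \<open>Substitute y = x + h and exchange the integrals. For fixed h the integral over x is a
  squared translation difference on the set where x and x + h both lie in the ball; by convexity the
  segments between them do too, so the translation estimate applies. Only h of length less than 2r
  contribute.\<close>

lemma double_integral_ball:
  assumes w: "wgrad u g" and [measurable]: "u \<in> borel_measurable borel"
    and B: "ball a r \<subseteq> \<Omega>" "r > 0"
  shows "(\<integral>\<^sup>+x. (\<integral>\<^sup>+y. ennreal ((u x - u y)\<^sup>2) * indicator (ball a r) y \<partial>lborel) * indicator (ball a r) x \<partial>lborel)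
    \<le> ennreal ((2 * r)\<^sup>2 * (l2norm \<mu> g)\<^sup>2) * emeasure lborel (ball (0::real^2) (2 * r))"
proof -
  let ?B = "ball a r"
  define F where "F x y = ennreal ((u x - u y)\<^sup>2) * indicator ?B y * indicator ?B x" for x y
  have [measurable]: "(\<lambda>(x, y). F x y) \<in> borel_measurable (borel \<Otimes>\<^sub>M borel)"
    unfolding F_def indicator_ball by measurable
  have inner: "(\<integral>\<^sup>+x. F x (x + h) \<partial>lborel)
      \<le> ennreal ((2 * r)\<^sup>2 * (l2norm \<mu> g)\<^sup>2) * indicator (ball 0 (2 * r)) h" for h
  proof (cases "norm h < 2 * r")
    case False
    have "F x (x + h) = 0" for x
    proof -
      have "\<not> (x \<in> ?B \<and> x + h \<in> ?B)"
        using False norm_triangle_ineq4[of "a - x" "a - (x + h)"] by (auto simp: dist_norm)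
      then show ?thesis by (auto simp: F_def)
    qed
    then show ?thesis by simp
  next
    case True
    define E where "E = ?B \<inter> (\<lambda>x. x + h) -` ?B"
    have oE: "open E" unfolding E_def
      by (intro open_Int open_ball open_vimage continuous_intros)
    have tube: "x + s *\<^sub>R h \<in> \<Omega>" if "x \<in> E" "0 \<le> s" "s \<le> 1" for x s
    proof -
      have "(1 - s) *\<^sub>R x + s *\<^sub>R (x + h) \<in> ?B"
        using that by (intro convexD[OF convex_ball]) (auto simp: E_def)
      then show ?thesis using B by (auto simp: algebra_simps)
    qed
    note T = translation_estimate[OF w oE tube]
    have "(\<integral>\<^sup>+x. F x (x + h) \<partial>lborel) = (\<integral>\<^sup>+x. F x (x + h) \<partial>lebesgue)"
      by (rule nn_integral_completion[symmetric])
    also have "\<dots> = (\<integral>\<^sup>+x. ennreal ((norm (u (x + h) - u x))\<^sup>2) * indicator E x \<partial>lebesgue)"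
      by (intro nn_integral_cong) (auto simp: F_def E_def indicator_def power2_commute)
    also have "\<dots> = ennreal ((l2norm (lebesgue_on E) (\<lambda>x. u (x + h) - u x))\<^sup>2)"
      using oE by (intro l2norm_sq_nn[symmetric] L2_diff T) auto
    also have "\<dots> \<le> ennreal ((2 * r)\<^sup>2 * (l2norm \<mu> g)\<^sup>2)"
    proof (rule ennreal_leI)
      have "l2norm (lebesgue_on E) (\<lambda>x. u (x + h) - u x) \<le> (2 * r) * l2norm \<mu> g"
        using T(3) mult_right_mono[of "norm h" "2 * r" "l2norm \<mu> g"] True l2norm_nonneg[of \<mu> g] by linarith
      then show "(l2norm (lebesgue_on E) (\<lambda>x. u (x + h) - u x))\<^sup>2 \<le> (2 * r)\<^sup>2 * (l2norm \<mu> g)\<^sup>2"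
        unfolding power_mult_distrib[symmetric] by (intro power_mono l2norm_nonneg)
    qed
    finally show ?thesis using True by simp
  qed
  have "(\<integral>\<^sup>+x. (\<integral>\<^sup>+y. ennreal ((u x - u y)\<^sup>2) * indicator ?B y \<partial>lborel) * indicator ?B x \<partial>lborel)
      = (\<integral>\<^sup>+x. (\<integral>\<^sup>+y. F x y \<partial>lborel) \<partial>lborel)"
  proof (rule nn_integral_cong)
    fix x
    have "(\<lambda>y. ennreal ((u x - u y)\<^sup>2) * indicator ?B y) \<in> borel_measurable lborel"
      unfolding indicator_ball by measurable
    then show "(\<integral>\<^sup>+y. ennreal ((u x - u y)\<^sup>2) * indicator ?B y \<partial>lborel) * indicator ?B x = (\<integral>\<^sup>+y. F x y \<partial>lborel)"
      unfolding F_def by (rule nn_integral_multc[symmetric])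
  qed
  also have "\<dots> = (\<integral>\<^sup>+x. (\<integral>\<^sup>+h. F x (x + h) \<partial>lborel) \<partial>lborel)"
  proof (rule nn_integral_cong)
    fix x
    have "(\<lambda>y. F x y) \<in> borel_measurable borel" by measurable
    then have "(\<integral>\<^sup>+y. F x y \<partial>distr lborel borel ((+) x)) = (\<integral>\<^sup>+h. F x (x + h) \<partial>lborel)"
      by (subst nn_integral_distr) auto
    then show "(\<integral>\<^sup>+y. F x y \<partial>lborel) = (\<integral>\<^sup>+h. F x (x + h) \<partial>lborel)"
      by (simp add: lborel_distr_plus)
  qed
  also have "\<dots> = (\<integral>\<^sup>+h. (\<integral>\<^sup>+x. F x (x + h) \<partial>lborel) \<partial>lborel)"
    by (rule lborel_pair.Fubini') measurable
  also have "\<dots> \<le> (\<integral>\<^sup>+h. ennreal ((2 * r)\<^sup>2 * (l2norm \<mu> g)\<^sup>2) * indicator (ball (0::real^2) (2 * r)) h \<partial>lborel)"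
    by (rule nn_integral_mono) (rule inner)
  also have "\<dots> = ennreal ((2 * r)\<^sup>2 * (l2norm \<mu> g)\<^sup>2) * emeasure lborel (ball (0::real^2) (2 * r))"
    by (rule nn_integral_cmult_indicator) simp
  finally show ?thesis .
qed

text \<open>With k the measure of \<open>S\<close> and s the integral of \<open>u\<close> over
  \<open>S\<close>, the number k u(x) - s is the integral of u(x) - u(y) over y in \<open>S\<close>.
  Cauchy-Schwarz bounds its square by k times the integral of (u(x) - u(y))^2, and enlarging
  \<open>S\<close> to the ball and integrating over x leads to the double integral.\<close>

lemma controlled_start:
  assumes B: "ball a r \<subseteq> \<Omega>" "r > 0" and S: "S \<subseteq> ball a r" "S \<in> sets lebesgue" "emeasure lebesgue S > 0"
  shows "controlled S (ball a r)"
proof -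
  let ?B = "ball a r"
  have lB: "ball b s \<in> lmeasurable" for b :: "real^2" and s by (simp add: lmeasurable_open)
  have sB: "?B \<in> sets lebesgue" by simp
  have lS: "S \<in> lmeasurable" by (rule fmeasurableI2[OF lB[of a r] S(1,2)])
  have SO: "S \<subseteq> \<Omega>" using S B by auto
  define k where "k = measure lebesgue S"
  have k: "k > 0" using S(3) lS by (simp add: k_def emeasure_eq_measure2)
  define c where "c = measure lebesgue (ball (0::real^2) (2 * r))"
  define b where "b = measure lebesgue ?B"
  have cb: "emeasure lborel (ball (0::real^2) (2 * r)) = ennreal c" "emeasure lborel ?B = ennreal b"
    using emeasure_eq_measure2[OF lB] by (simp_all add: c_def b_def)
  have finS: "finite_measure (lebesgue_on S)" by (rule finite_measure_lebesgue_on[OF lS])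
  have borel_case: "k\<^sup>2 * (l2norm (lebesgue_on ?B) u)\<^sup>2 \<le>
      2 * k * ((2 * r)\<^sup>2 * (l2norm \<mu> g)\<^sup>2 * c) + 2 * (\<integral>x. u x \<partial>lebesgue_on S)\<^sup>2 * b"
    if w: "wgrad u g" and [measurable]: "u \<in> borel_measurable borel" for u g
  proof -
    define s where "s = (\<integral>x. u x \<partial>lebesgue_on S)"
    have uS: "u \<in> L2 (lebesgue_on S)" by (rule has_weak_gradient_L2[OF w SO S(2)])
    have uB: "u \<in> L2 (lebesgue_on ?B)" by (rule has_weak_gradient_L2[OF w B(1) sB])
    define I where "I x = (\<integral>\<^sup>+y. ennreal ((u x - u y)\<^sup>2) * indicator ?B y \<partial>lborel)" for x
    have [measurable]: "I \<in> borel_measurable borel" unfolding I_def indicator_ball by measurable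
    have pt: "ennreal (k\<^sup>2 * (u x)\<^sup>2) \<le> ennreal (2 * k) * I x + ennreal (2 * s\<^sup>2)" for x
    proof -
      have d: "(\<lambda>y. u x - u y) \<in> L2 (lebesgue_on S)" by (intro L2_diff L2_const finS uS)
      define q where "q = (l2norm (lebesgue_on S) (\<lambda>y. u x - u y))\<^sup>2"
      have mS: "measure (lebesgue_on S) (space (lebesgue_on S)) = k"
        using S(2) by (simp add: k_def measure_restrict_space)
      have "(\<integral>y. u x - u y \<partial>lebesgue_on S) = k * u x - s"
        using mS by (subst Bochner_Integration.integral_diff[OF finite_measure.integrable_const[OF finS] 
            L2_imp_L1(1)[OF finS uS]]) (simp add: s_def)
      moreover have "\<bar>\<integral>y. u x - u y \<partial>lebesgue_on S\<bar> \<le> l2norm (lebesgue_on S) (\<lambda>y. u x - u y) * sqrt k"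
        using order_trans[OF integral_norm_bound L2_imp_L1(2)[OF finS d, unfolded mS]]
        by (simp only: real_norm_def)
      ultimately have "(k * u x - s)\<^sup>2 \<le> (l2norm (lebesgue_on S) (\<lambda>y. u x - u y) * sqrt k)\<^sup>2"
        by (metis abs_ge_zero power2_abs power_mono)
      then have "(k * u x - s)\<^sup>2 \<le> k * q" using k by (simp add: q_def power_mult_distrib mult.commute)
      then have "k\<^sup>2 * (u x)\<^sup>2 \<le> 2 * k * q + 2 * s\<^sup>2"
        using norm_add_sq_le[of "k * u x - s" s] by (simp add: power_mult_distrib)
      then have "ennreal (k\<^sup>2 * (u x)\<^sup>2) \<le> ennreal (2 * k * q + 2 * s\<^sup>2)" by (rule ennreal_leI)
      also have "\<dots> = ennreal (2 * k) * ennreal q + ennreal (2 * s\<^sup>2)"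
        using k by (simp add: ennreal_plus ennreal_mult q_def)
      also have "\<dots> \<le> ennreal (2 * k) * I x + ennreal (2 * s\<^sup>2)"
      proof (intro add_mono mult_left_mono)
        have "ennreal q = (\<integral>\<^sup>+y. ennreal ((u x - u y)\<^sup>2) * indicator S y \<partial>lebesgue)"
          unfolding q_def by (subst l2norm_sq_nn[OF d S(2)]) simp
        also have "\<dots> \<le> (\<integral>\<^sup>+y. ennreal ((u x - u y)\<^sup>2) * indicator ?B y \<partial>lebesgue)"
          using S(1) by (intro nn_integral_mono) (auto simp: indicator_def)
        finally show "ennreal q \<le> I x" by (simp add: I_def nn_integral_completion)
      qed auto
      finally show ?thesis .
    qed
    have "ennreal (k\<^sup>2 * (l2norm (lebesgue_on ?B) u)\<^sup>2) = ennreal (k\<^sup>2) * (\<integral>\<^sup>+x. ennreal ((u x)\<^sup>2) * indicator ?B x \<partial>lborel)"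
      using l2norm_sq_nn[OF uB sB] by (simp add: ennreal_mult nn_integral_completion)
    also have "\<dots> = (\<integral>\<^sup>+x. ennreal (k\<^sup>2 * (u x)\<^sup>2) * indicator ?B x \<partial>lborel)"
    proof (subst nn_integral_cmult[symmetric])
      show "(\<lambda>x. ennreal ((u x)\<^sup>2) * indicator ?B x) \<in> borel_measurable lborel"
        unfolding indicator_ball by measurable
    qed (simp add: ennreal_mult mult.assoc)
    also have "\<dots> \<le> (\<integral>\<^sup>+x. ennreal (2 * k) * (I x * indicator ?B x) + ennreal (2 * s\<^sup>2) * indicator ?B x \<partial>lborel)"
      using pt by (intro nn_integral_mono) (auto simp: indicator_def)
    also have "\<dots> = ennreal (2 * k) * (\<integral>\<^sup>+x. I x * indicator ?B x \<partial>lborel) + ennreal (2 * s\<^sup>2) * ennreal b"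
    proof -
      have m: "(\<lambda>x. I x * indicator ?B x) \<in> borel_measurable lborel"
        "(\<lambda>x. ennreal (2 * s\<^sup>2) * indicator ?B x) \<in> borel_measurable lborel"
        unfolding indicator_ball by measurable
      have m': "(\<lambda>x. ennreal (2 * k) * (I x * indicator ?B x)) \<in> borel_measurable lborel"
        using borel_measurable_times_ennreal[OF borel_measurable_const m(1)] .
      show ?thesis
        unfolding nn_integral_add[OF m' m(2)] nn_integral_cmult[OF m(1)]
        by (subst nn_integral_cmult_indicator) (simp_all add: cb)
    qed
    also have "\<dots> \<le> ennreal (2 * k) * (ennreal ((2 * r)\<^sup>2 * (l2norm \<mu> g)\<^sup>2) * ennreal c) + ennreal (2 * s\<^sup>2) * ennreal b"
      unfolding I_def cb(1)[symmetric]
      by (intro add_mono mult_left_mono double_integral_ball[OF w _ B]) auto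
    also have "\<dots> = ennreal (2 * k * ((2 * r)\<^sup>2 * (l2norm \<mu> g)\<^sup>2 * c) + 2 * s\<^sup>2 * b)"
    proof -
      have "ennreal p * (ennreal q * ennreal c') + ennreal m * ennreal b' = ennreal (p * (q * c') + m * b')"
        if "0 \<le> p" "0 \<le> q" "0 \<le> c'" "0 \<le> m" "0 \<le> b'" for p q c' m b' :: real
        using that by (simp add: ennreal_plus ennreal_mult)
      then show ?thesis using k by (simp add: c_def b_def del: ennreal_numeral)
    qed
    finally show ?thesis using k by (subst (asm) ennreal_le_iff) (auto simp: s_def c_def b_def)
  qed
  define C where "C = (2 * k * (2 * r)\<^sup>2 * c + 2 * b) / k\<^sup>2"
  have nn: "c \<ge> 0" "b \<ge> 0" by (auto simp: c_def b_def)
  have C0: "C \<ge> 0" using k nn by (simp add: C_def)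
  have "(l2norm (lebesgue_on ?B) u)\<^sup>2 \<le> C * ((l2norm \<mu> g)\<^sup>2 + (\<integral>x. u x \<partial>lebesgue_on S)\<^sup>2)"
    if w: "wgrad u g" for u g
  proof -
    \<comment> \<open>The double integral was estimated for Borel functions, to which Fubini's
      theorem for \<open>lborel\<close> applies. A weakly differentiable \<open>u\<close> is only
      Lebesgue measurable; it agrees almost everywhere on \<open>\<Omega>\<close> with a Borel
      function, which has the same weak gradient and the same integrals.\<close>
    define u0 where "u0 x = (if x \<in> \<Omega> then u x else 0)" for x
    have "u0 \<in> borel_measurable lebesgue"
      using L2_measurable[OF has_weak_gradientD(1)[OF w]] sets_Omega unfolding u0_def
      by (simp add: borel_measurable_if_I)
    then obtain v where v: "v \<in> borel_measurable lborel" "AE x in lborel. u0 x = v x"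
      using completion_ex_borel_measurable_real by blast
    have AE: "AE x in lebesgue_on A. u x = v x" if "A \<subseteq> \<Omega>" "A \<in> sets lebesgue" for A
    proof -
      have "AE x in lebesgue. x \<in> A \<longrightarrow> u x = v x"
        using AE_completion[OF v(2)] by eventually_elim (use that(1) in \<open>auto simp: u0_def\<close>)
      then show ?thesis using that by (subst AE_restrict_space_iff) auto
    qed
    have vm: "v \<in> borel_measurable (lebesgue_on A)" for A
      using v(1) by (intro measurable_restrict_space1 measurable_completion)
    have um: "u \<in> borel_measurable (lebesgue_on A)" if "A \<subseteq> \<Omega>" "A \<in> sets lebesgue" for A
      using has_weak_gradient_L2[OF w that] L2_measurable by blast
    have wv: "wgrad v g"
      by (rule weak_gradient_cong_AE[OF w vm AE[OF order_refl sets_Omega]])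
    have e1: "l2norm (lebesgue_on ?B) u = l2norm (lebesgue_on ?B) v"
      using B sB by (intro l2norm_cong_AE um vm AE)
    have e2: "(\<integral>x. u x \<partial>lebesgue_on S) = (\<integral>x. v x \<partial>lebesgue_on S)"
      by (intro integral_cong_AE um vm AE SO S)
    have "k\<^sup>2 * (l2norm (lebesgue_on ?B) u)\<^sup>2 \<le>
        (2 * k * (2 * r)\<^sup>2 * c) * (l2norm \<mu> g)\<^sup>2 + (2 * b) * (\<integral>x. u x \<partial>lebesgue_on S)\<^sup>2"
      using borel_case[OF wv] v(1) by (simp add: e1 e2 mult_ac)
    also have "\<dots> \<le> (2 * k * (2 * r)\<^sup>2 * c + 2 * b) * (l2norm \<mu> g)\<^sup>2 + (2 * k * (2 * r)\<^sup>2 * c + 2 * b) * (\<integral>x. u x \<partial>lebesgue_on S)\<^sup>2"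
      using k nn by (intro add_mono mult_right_mono) auto
    finally show ?thesis using k by (simp add: C_def field_simps)
  qed
  then show ?thesis using B(1) C0 unfolding controlled_def by auto
qed

end

section \<open>Spreading the Poincare inequality over the domain\<close>

locale lipschitz_data = bounded_open +
  fixes K :: "(real^2) set"
  assumes lip: "lipschitz_domain \<Omega>"
    and K: "K \<in> sets lebesgue" "K \<subseteq> \<Omega>" "emeasure lebesgue K > 0"
begin

text \<open>A set all of whose points have relative neighbourhoods of measure 0 is itself null.
  Hence some point of \<open>K\<close> has only neighbourhoods that meet \<open>K\<close> in
  positive measure, and \<open>S\<close> is the part of \<open>K\<close> in a small ball around
  it.\<close>

lemma exists_controlled_ball:
  obtains S a r where "S \<subseteq> K" "S \<in> sets lebesgue" "r > 0" "ball a r \<subseteq> \<Omega>" "controlled S (ball a r)"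
proof -
  have "\<not> negligible K"
    using K(3) null_setsD1[of K lebesgue] by (auto simp: negligible_iff_null_sets)
  then obtain a where a: "a \<in> K" "\<And>U. openin (top_of_set K) U \<Longrightarrow> a \<in> U \<Longrightarrow> \<not> negligible U"
    using locally_negligible_alt[of K] by blast
  then obtain r where r: "r > 0" "ball a r \<subseteq> \<Omega>"
    using K(2) open_contains_ball[THEN iffD1, OF open_Omega] by (metis subsetD)
  have "\<not> negligible (K \<inter> ball a r)" using a r by (intro a(2)) (auto simp: openin_open_Int)
  moreover have "K \<inter> ball a r \<in> sets lebesgue" using K by auto
  ultimately have "emeasure lebesgue (K \<inter> ball a r) > 0"
    using null_setsI[of lebesgue "K \<inter> ball a r"]
    unfolding negligible_iff_null_sets zero_less_iff_neq_zero by blast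
  then have "controlled (K \<inter> ball a r) (ball a r)"
    using K by (intro controlled_start[OF r(2,1)]) auto
  with r K show ?thesis by (intro that[of "K \<inter> ball a r" r a]) auto
qed

text \<open>Translating small balls along \<open>\<Omega>\<close> spreads control from one ball to every compact subset;
  near the boundary one translates inwards along the axis of the Lipschitz chart.\<close>

lemma controlled_Omega:
  assumes "r0 > 0" "ball a0 r0 \<subseteq> \<Omega>" "controlled S (ball a0 r0)"
  shows "controlled S \<Omega>"
proof -
  \<comment> \<open>Connectedness enters through this property: near every point of
    \<open>\<Omega>\<close> it passes from one point to another, so it holds everywhere once it
    holds at \<open>a0\<close>.\<close>
  define P where "P x \<longleftrightarrow> (\<exists>r>0. ball x r \<subseteq> \<Omega> \<and> controlled S (ball x r))" for x
  have P: "P b" if "b \<in> \<Omega>" for b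
  proof (rule connected_induction_simple[of \<Omega> a0 b P])
    show "connected \<Omega>" using lip by (simp add: lipschitz_domain_def)
    show "a0 \<in> \<Omega>" "P a0" using assms by (auto simp: P_def)
    show "b \<in> \<Omega>" by fact
    fix a assume "a \<in> \<Omega>"
    then obtain e where e: "e > 0" "ball a e \<subseteq> \<Omega>" using open_Omega open_contains_ball by blast
    \<comment> \<open>Half the radius: for x and y within \<open>\<rho>\<close> of a, a ball around
      y of radius at most \<open>\<rho>\<close> travels straight to x without leaving the ball of
      radius 2\<open>\<rho>\<close> around a.\<close>
    define \<rho> where "\<rho> = e / 2"
    have rho: "\<rho> > 0" "ball a (2 * \<rho>) \<subseteq> \<Omega>" using e by (auto simp: \<rho>_def)
    have "P y" if x: "x \<in> ball a \<rho>" and y: "y \<in> ball a \<rho>" and "P x" for x y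
    proof -
      obtain r where r: "r > 0" "ball x r \<subseteq> \<Omega>" "controlled S (ball x r)"
        using \<open>P x\<close> by (auto simp: P_def)
      define r' where "r' = min r \<rho>"
      have r': "r' > 0" "r' \<le> r" "r' \<le> \<rho>" using r rho by (auto simp: r'_def)
      have tube: "z + s *\<^sub>R (x - y) \<in> \<Omega>" if "z \<in> ball y r'" "0 \<le> s" "s \<le> 1" for z s
      proof -
        have "(1 - s) *\<^sub>R y + s *\<^sub>R x \<in> ball a \<rho>"
          using x y that by (intro convexD[OF convex_ball]) auto
        then have "norm (((1 - s) *\<^sub>R y + s *\<^sub>R x - a) + (z - y)) < \<rho> + \<rho>"
          using that r' by (intro norm_add_less) (auto simp: dist_norm norm_minus_commute)
        then have "z + s *\<^sub>R (x - y) \<in> ball a (2 * \<rho>)"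
          by (simp add: dist_norm norm_minus_commute algebra_simps)
        then show ?thesis using rho by blast
      qed
      have "controlled S (ball y r')"
      proof (rule controlled_translate[OF r(3) open_ball _ tube])
        show "(\<lambda>z. z + (x - y)) ` ball y r' \<subseteq> ball x r"
          using r' by (auto simp: dist_norm algebra_simps)
      qed
      then show ?thesis using tube[of _ 0] r' unfolding P_def by (intro exI[of _ r']) auto
    qed
    moreover have "ball a \<rho> \<subseteq> ball a (2 * \<rho>)" using rho by (intro subset_ball) simp
    then have "openin (top_of_set \<Omega>) (ball a \<rho>)" "a \<in> ball a \<rho>"
      using rho by (auto simp: openin_open_eq open_Omega)
    ultimately show "\<exists>T. openin (top_of_set \<Omega>) T \<and> a \<in> T \<and> (\<forall>x\<in>T. \<forall>y\<in>T. P x \<longrightarrow> P y)"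
      by blast
  qed
  have comp: "controlled S C" if C: "compact C" "C \<subseteq> \<Omega>" for C
  proof -
    obtain r where r: "\<And>x. x \<in> C \<Longrightarrow> r x > 0 \<and> controlled S (ball x (r x))"
      using P C unfolding P_def by (metis subsetD)
    obtain D where D: "D \<subseteq> C" "finite D" "C \<subseteq> (\<Union>x\<in>D. ball x (r x))"
    proof (rule compactE_image[OF C(1), of C "\<lambda>x. ball x (r x)"])
      show "C \<subseteq> (\<Union>x\<in>C. ball x (r x))" using r centre_in_ball by blast
    qed auto
    have "controlled S (\<Union>x\<in>D. ball x (r x))" using D r by (intro controlled_UN) auto
    then show ?thesis by (rule controlled_subset[OF _ D(3)]) (rule fmeasurableD[OF lmeasurable_compact[OF C(1)]])
  qed
  have bdry: "\<exists>\<rho>>0. controlled S (\<Omega> \<inter> ball p \<rho>)" if p: "p \<in> frontier \<Omega>" for p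
  proof -
    obtain r A \<gamma> L where r: "r > 0" and A: "orthogonal_transformation (A :: real^2 \<Rightarrow> real^2)"
      and gam: "L-lipschitz_on UNIV \<gamma>" and chart: "\<Omega> \<inter> ball p r = {x \<in> ball p r. \<gamma> (A x $ 1) < A x $ 2}"
      using lip p unfolding lipschitz_domain_def by blast
    have L: "L \<ge> 0" by (rule lipschitz_on_nonneg[OF gam])
    obtain e where e: "A e = axis 2 1"
      using orthogonal_transformation_surj[OF A] by (metis surjD)
    have ne: "norm e = 1" using orthogonal_transformation_norm[OF A, of e] by (simp add: e)
    have linA: "linear A" using A by (simp add: orthogonal_transformation_linear)
    have Ae: "A (x + t *\<^sub>R e) $ 1 = A x $ 1" "A (x + t *\<^sub>R e) $ 2 = A x $ 2 + t" for x t
      using linear_add[OF linA] linear_scale[OF linA] by (simp_all add: e axis_def)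
    have Ad: "\<bar>A x $ i - A y $ i\<bar> \<le> norm (x - y)" for x y i
      using component_le_norm_cart[of "A (x - y)" i] orthogonal_transformation_norm[OF A, of "x - y"]
        linear_diff[OF linA, of x y] by simp
    have gd: "\<bar>\<gamma> s - \<gamma> t\<bar> \<le> L * \<bar>s - t\<bar>" for s t
      using lipschitz_onD[OF gam, of s t] by (simp add: dist_real_def)
    \<comment> \<open>The vector \<open>e\<close> points upwards in the chart. A point z within
      \<open>\<rho>\<close> of p is within 2\<open>\<rho>\<close> of some y in
      \<open>\<Omega>\<close>, which lies above the graph; from y to z the height drops by at most
      2\<open>\<rho>\<close> and the graph rises by at most 2L\<open>\<rho>\<close>, so a lift by s
      = 2(L + 1)\<open>\<rho>\<close> brings z above the graph. The denominator 2L + 4 keeps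
      \<open>\<rho>\<close> + s = (2L + 3)\<open>\<rho>\<close> below r.\<close>
    define \<rho> where "\<rho> = r / (2 * L + 4)"
    define s where "s = 2 * (L + 1) * \<rho>"
    have rho: "\<rho> > 0" using r L by (simp add: \<rho>_def)
    have s: "s \<ge> 0" using rho L by (simp add: s_def)
    have rs: "\<rho> + s < r"
    proof -
      have "(2 * L + 4) * \<rho> = r" using L by (simp add: \<rho>_def)
      then have "\<rho> + s = r - \<rho>" by (simp add: s_def algebra_simps)
      then show ?thesis using rho by simp
    qed
    have inr: "x + t *\<^sub>R e \<in> ball p r" if "dist p x \<le> \<rho>" "0 \<le> t" "t \<le> s" for x t
    proof -
      have "dist p (x + t *\<^sub>R e) \<le> dist p x + dist x (x + t *\<^sub>R e)" by (rule dist_triangle)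
      also have "\<dots> \<le> \<rho> + s" using that by (intro add_mono) (auto simp: dist_norm ne)
      finally show ?thesis using rs by simp
    qed
    have mem: "x \<in> \<Omega> \<longleftrightarrow> \<gamma> (A x $ 1) < A x $ 2" if "x \<in> ball p r" for x
      using chart that by blast
    have "p \<in> closure \<Omega>" using p by (simp add: frontier_def)
    then obtain y where y: "y \<in> \<Omega>" "dist y p < \<rho>" using rho closure_approachable by blast
    have yr: "y \<in> ball p r" using y(2) rs s by (simp add: dist_commute)
    have gy: "\<gamma> (A y $ 1) < A y $ 2" using mem[OF yr] y(1) by simp
    have shift: "z + s *\<^sub>R e \<in> \<Omega>" if z: "z \<in> cball p \<rho>" for z
    proof -
      have "norm (z - y) \<le> 2 * \<rho>"
        using dist_triangle[of z y p] z y(2) by (simp add: dist_norm norm_minus_commute)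
      then have d: "\<bar>A z $ 1 - A y $ 1\<bar> \<le> 2 * \<rho>" "\<bar>A z $ 2 - A y $ 2\<bar> \<le> 2 * \<rho>"
        using Ad[of z _ y] by (meson order_trans)+
      have "\<gamma> (A z $ 1) \<le> \<gamma> (A y $ 1) + L * (2 * \<rho>)"
        using gd[of "A z $ 1" "A y $ 1"] mult_left_mono[OF d(1) L] by linarith
      also have "\<dots> < A y $ 2 + L * (2 * \<rho>)" using gy by simp
      also have "\<dots> \<le> A z $ 2 + s" using d(2) by (simp add: s_def algebra_simps)
      finally show ?thesis using mem[OF inr[of z s]] z s by (simp add: Ae)
    qed
    \<comment> \<open>The lifted closed ball is a compact subset of \<open>\<Omega>\<close>, hence
      already controlled. Points above the graph stay above it while they are lifted, which is the
      tube condition.\<close>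
    have "controlled S (\<Omega> \<inter> ball p \<rho>)"
    proof (rule controlled_translate[where h="s *\<^sub>R e"])
      show "controlled S ((\<lambda>z. z + s *\<^sub>R e) ` cball p \<rho>)"
        using shift by (intro comp compact_continuous_image continuous_intros) auto
      show "open (\<Omega> \<inter> ball p \<rho>)" using open_Omega by auto
      show "(\<lambda>x. x + s *\<^sub>R e) ` (\<Omega> \<inter> ball p \<rho>) \<subseteq> (\<lambda>z. z + s *\<^sub>R e) ` cball p \<rho>" by auto
      fix x t assume x: "x \<in> \<Omega> \<inter> ball p \<rho>" and t: "(0::real) \<le> t" "t \<le> 1"
      have ts: "0 \<le> t * s" "t * s \<le> s" using t s by (auto intro: mult_left_le_one_le)
      have xr: "x \<in> ball p r" using x rs s by auto
      have "\<gamma> (A x $ 1) < A x $ 2" using mem[OF xr] x by auto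
      then show "x + t *\<^sub>R s *\<^sub>R e \<in> \<Omega>"
        using mem[OF inr[of x "t * s"]] x ts by (simp add: Ae)
    qed
    then show ?thesis using rho by blast
  qed
  have "\<exists>\<rho>>0. controlled S (\<Omega> \<inter> ball x \<rho>)" if "x \<in> closure \<Omega>" for x
  proof (cases "x \<in> \<Omega>")
    case True
    then obtain r where "r > 0" "ball x r \<subseteq> \<Omega>" "controlled S (ball x r)" using P by (auto simp: P_def)
    then show ?thesis by (intro exI[of _ r]) (auto simp: Int_absorb1)
  next
    case False
    then show ?thesis using bdry[of x] that open_Omega by (auto simp: frontier_def interior_open)
  qed
  then obtain \<rho> where rho: "\<And>x. x \<in> closure \<Omega> \<Longrightarrow> \<rho> x > 0 \<and> controlled S (\<Omega> \<inter> ball x (\<rho> x))" by metis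
  have "compact (closure \<Omega>)" using bounded_Omega by simp
  then obtain D where D: "D \<subseteq> closure \<Omega>" "finite D" "closure \<Omega> \<subseteq> (\<Union>x\<in>D. ball x (\<rho> x))"
  proof (rule compactE_image[of "closure \<Omega>" "closure \<Omega>" "\<lambda>x. ball x (\<rho> x)"])
    show "closure \<Omega> \<subseteq> (\<Union>x\<in>closure \<Omega>. ball x (\<rho> x))" using rho centre_in_ball by blast
  qed auto
  have "controlled S (\<Union>x\<in>D. \<Omega> \<inter> ball x (\<rho> x))" using D rho by (intro controlled_UN) auto
  moreover have "\<Omega> \<subseteq> (\<Union>x\<in>D. \<Omega> \<inter> ball x (\<rho> x))" using D(3) closure_subset[of \<Omega>] by blast
  ultimately show ?thesis using sets_Omega by (rule controlled_subset)
qed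

theorem poincare:
  obtains S C where "S \<subseteq> K" "S \<in> sets lebesgue" "C \<ge> 0"
    "\<And>u g. wgrad u g \<Longrightarrow>
       (l2norm \<mu> u)\<^sup>2 \<le> C * ((l2norm \<mu> g)\<^sup>2 + (\<integral>x. u x \<partial>lebesgue_on S)\<^sup>2)"
proof -
  obtain S a r where S: "S \<subseteq> K" "S \<in> sets lebesgue" "r > 0" "ball a r \<subseteq> \<Omega>" "controlled S (ball a r)"
    by (rule exists_controlled_ball)
  then have "controlled S \<Omega>" by (intro controlled_Omega)
  then show ?thesis using that S unfolding controlled_def by metis
qed

end


subsection \<open>The Brouwer and Schauder fixed point theorems\<close>

text \<open>Compactness of the cube, by extracting a further subsequence for one coordinate after
  the other.\<close>

lemma bolzano_weierstrass_coordinates: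
  fixes Q :: "nat \<Rightarrow> nat \<Rightarrow> real"
  assumes "\<And>k i. i < n \<Longrightarrow> Q k i \<in> {0..1}"
  obtains r x where "strict_mono (r::nat \<Rightarrow> nat)" "\<And>i. i < n \<Longrightarrow> x i \<in> {0..1::real}"
    "\<And>i. i < n \<Longrightarrow> (\<lambda>k. Q (r k) i) \<longlonglongrightarrow> x i"
proof -
  have "\<exists>(r::nat \<Rightarrow> nat) x. strict_mono r \<and> (\<forall>i<n. x i \<in> {0..1} \<and> (\<lambda>k. Q (r k) i) \<longlonglongrightarrow> x i)"
    using assms
  proof (induction n)
    case 0
    show ?case by (intro exI[of _ id]) (simp add: strict_mono_def)
  next
    case (Suc n)
    then obtain r x where r: "strict_mono (r::nat \<Rightarrow> nat)" "\<And>i. i < n \<Longrightarrow> x i \<in> {0..1::real}"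
      "\<And>i. i < n \<Longrightarrow> (\<lambda>k. Q (r k) i) \<longlonglongrightarrow> x i" by (metis less_SucI)
    have "\<forall>k. Q (r k) n \<in> {0..1}" using Suc.prems by blast
    then obtain l s where s: "l \<in> {0..1}" "strict_mono (s::nat \<Rightarrow> nat)" "((\<lambda>k. Q (r k) n) \<circ> s) \<longlonglongrightarrow> l"
      using compact_Icc[of "0::real" 1, unfolded compact_def] by metis
    have "(\<lambda>k. Q (r (s k)) i) \<longlonglongrightarrow> x i" if "i < n" for i
      using LIMSEQ_subseq_LIMSEQ[OF r(3)[OF that] s(2)] by (simp add: o_def)
    then have "strict_mono (r \<circ> s) \<and> (\<forall>i<Suc n. (x(n := l)) i \<in> {0..1} \<and> (\<lambda>k. Q ((r \<circ> s) k) i) \<longlonglongrightarrow> (x(n := l)) i)"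
      using r s by (auto simp: o_def less_Suc_eq intro: strict_mono_o[unfolded o_def])
    then show ?case by blast
  qed
  then show ?thesis using that by blast
qed

text \<open>Points of the cube are functions of which only the first \<open>n\<close> values matter,
  so that \<open>n\<close> may be a number obtained inside a proof; continuity is sequential in
  these coordinates. Kuhn's combinatorial lemma gives, in every grid, a cell in which each
  coordinate is somewhere not decreased and somewhere not increased by \<open>f\<close>; as the mesh
  tends to 0 such cells accumulate at a fixed point.\<close>

lemma brouwer_cube_coordinates:
  fixes f :: "(nat \<Rightarrow> real) \<Rightarrow> nat \<Rightarrow> real" and n :: nat
  defines "cube \<equiv> {x :: nat \<Rightarrow> real. \<forall>i<n. x i \<in> {0..1}}"
  assumes maps: "\<And>x i. x \<in> cube \<Longrightarrow> i < n \<Longrightarrow> f x i \<in> {0..1}"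
    and cont: "\<And>X x i. (\<And>k::nat. X k \<in> cube) \<Longrightarrow> x \<in> cube \<Longrightarrow> (\<And>j. j < n \<Longrightarrow> (\<lambda>k. X k j) \<longlonglongrightarrow> x j) \<Longrightarrow>
      i < n \<Longrightarrow> (\<lambda>k. f (X k) i) \<longlonglongrightarrow> f x i"
  obtains x where "x \<in> cube" "\<And>i. i < n \<Longrightarrow> f x i = x i"
proof -
  define sc where "sc p x i = real (x i) / real p" for p and x :: "nat \<Rightarrow> nat" and i :: nat
  have sc_cube: "sc p x \<in> cube" if "p > 0" "\<And>i. i < n \<Longrightarrow> x i \<le> p" for p x
    using that by (auto simp: cube_def sc_def)
  have ex: "\<exists>q. (\<forall>i<n. q i < p) \<and> (\<forall>i<n. \<exists>r s.
      (\<forall>j<n. q j \<le> r j \<and> r j \<le> q j + 1) \<and> (\<forall>j<n. q j \<le> s j \<and> s j \<le> q j + 1) \<and>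
      sc p r i \<le> f (sc p r) i \<and> f (sc p s) i \<le> sc p s i)" if p: "p > 0" for p
  proof -
    \<comment> \<open>Label 0 asserts that \<open>f\<close> does not decrease the coordinate, label
      1 that it does not increase it. Kuhn's lemma prescribes the labels on the faces 0 and
      \<open>p\<close>; there they are still truthful because \<open>f\<close> maps into the
      cube.\<close>
    define label where "label x i = (if x i = 0 \<or> (x i \<noteq> p \<and> sc p x i \<le> f (sc p x) i) then 0 else 1::nat)" for x i
    obtain q where q: "\<forall>i<n. q i < p" "\<forall>i<n. \<exists>r s. (\<forall>j<n. q j \<le> r j \<and> r j \<le> q j + 1) \<and>
        (\<forall>j<n. q j \<le> s j \<and> s j \<le> q j + 1) \<and> label r i \<noteq> label s i"
      by (rule kuhn_lemma[OF p, of n label]) (use p in \<open>auto simp: label_def\<close>)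
    have l: "label r i = 0 \<Longrightarrow> sc p r i \<le> f (sc p r) i" "label r i \<noteq> 0 \<Longrightarrow> f (sc p r) i \<le> sc p r i"
      if "\<forall>j<n. q j \<le> r j \<and> r j \<le> q j + 1" "i < n" for r i
    proof -
      have "r j \<le> p" if "j < n" for j
        using that \<open>\<forall>j<n. q j \<le> r j \<and> r j \<le> q j + 1\<close> q(1)
        by (metis Suc_eq_plus1 Suc_leI le_trans)
      then have c: "f (sc p r) i \<in> {0..1}" by (intro maps sc_cube p that) 
      show "label r i = 0 \<Longrightarrow> sc p r i \<le> f (sc p r) i" "label r i \<noteq> 0 \<Longrightarrow> f (sc p r) i \<le> sc p r i"
        using c p by (auto simp: label_def sc_def split: if_splits)
    qed
    have "\<exists>r s. (\<forall>j<n. q j \<le> r j \<and> r j \<le> q j + 1) \<and> (\<forall>j<n. q j \<le> s j \<and> s j \<le> q j + 1) \<and>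
      sc p r i \<le> f (sc p r) i \<and> f (sc p s) i \<le> sc p s i" if i: "i < n" for i
    proof -
      obtain r s where rs: "\<forall>j<n. q j \<le> r j \<and> r j \<le> q j + 1"
        "\<forall>j<n. q j \<le> s j \<and> s j \<le> q j + 1" "label r i \<noteq> label s i"
        using q(2) i by blast
      show ?thesis
      proof (cases "label r i = 0")
        case True
        then show ?thesis using l(1)[OF rs(1) i] l(2)[OF rs(2) i] rs by auto
      next
        case False
        then have "label s i = 0" using rs(3) by (auto simp: label_def split: if_splits)
        then show ?thesis using l(2)[OF rs(1) i False] l(1)[OF rs(2) i] rs(1,2) by auto
      qed
    qed
    then show ?thesis using q(1) by blast
  qed
  have "\<forall>k. \<exists>q. (\<forall>i<n. q i < Suc k) \<and> (\<forall>i<n. \<exists>r s.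
      (\<forall>j<n. q j \<le> r j \<and> r j \<le> q j + 1) \<and> (\<forall>j<n. q j \<le> s j \<and> s j \<le> q j + 1) \<and>
      sc (Suc k) r i \<le> f (sc (Suc k) r) i \<and> f (sc (Suc k) s) i \<le> sc (Suc k) s i)"
    using ex by blast
  then obtain q where q: "\<And>k i. i < n \<Longrightarrow> q k i < Suc k" and
    q': "\<And>k i. i < n \<Longrightarrow> \<exists>r s. (\<forall>j<n. q k j \<le> r j \<and> r j \<le> q k j + 1) \<and> (\<forall>j<n. q k j \<le> s j \<and> s j \<le> q k j + 1) \<and>
      sc (Suc k) r i \<le> f (sc (Suc k) r) i \<and> f (sc (Suc k) s) i \<le> sc (Suc k) s i"
    by metis
  define P where "P k i r s \<longleftrightarrow> (\<forall>j<n. q k j \<le> r j \<and> r j \<le> q k j + 1) \<and> (\<forall>j<n. q k j \<le> s j \<and> s j \<le> q k j + 1) \<and>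
      sc (Suc k) r i \<le> f (sc (Suc k) r) i \<and> f (sc (Suc k) s) i \<le> sc (Suc k) s i" for k i r s
  have "\<forall>k i. \<exists>r s. i < n \<longrightarrow> P k i r s" using q' unfolding P_def by blast
  then have "\<exists>R S. \<forall>k i. i < n \<longrightarrow> P k i (R k i) (S k i)" by (simp only: choice_iff)
  then obtain R S where "\<And>k i. i < n \<Longrightarrow> P k i (R k i) (S k i)" by blast
  then have R: "\<And>k i j. i < n \<Longrightarrow> j < n \<Longrightarrow> q k j \<le> R k i j \<and> R k i j \<le> q k j + 1"
      "\<And>k i. i < n \<Longrightarrow> sc (Suc k) (R k i) i \<le> f (sc (Suc k) (R k i)) i"
    and S: "\<And>k i j. i < n \<Longrightarrow> j < n \<Longrightarrow> q k j \<le> S k i j \<and> S k i j \<le> q k j + 1"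
      "\<And>k i. i < n \<Longrightarrow> f (sc (Suc k) (S k i)) i \<le> sc (Suc k) (S k i) i"
    unfolding P_def by simp_all
  have Q01: "sc (Suc k) (q k) i \<in> {0..1}" if "i < n" for k i
    using q[OF that, of k] by (auto simp: sc_def)
  obtain r x where r: "strict_mono r" "\<And>i. i < n \<Longrightarrow> x i \<in> {0..1}"
    "\<And>i. i < n \<Longrightarrow> (\<lambda>k. sc (Suc (r k)) (q (r k)) i) \<longlonglongrightarrow> x i"
  proof (rule bolzano_weierstrass_coordinates[of n "\<lambda>k. sc (Suc k) (q k)"])
    show "sc (Suc k) (q k) i \<in> {0..1}" if "i < n" for k i by (rule Q01[OF that])
  next
    fix r x
    assume "strict_mono (r :: nat \<Rightarrow> nat)" "\<And>i. i < n \<Longrightarrow> x i \<in> {0..1}"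
      "\<And>i. i < n \<Longrightarrow> (\<lambda>k. sc (Suc (r k)) (q (r k)) i) \<longlonglongrightarrow> x i"
    then show thesis by (rule that)
  qed
  have xc: "x \<in> cube" using r(2) by (auto simp: cube_def)
  \<comment> \<open>All grid points of the chosen cells converge to the same \<open>x\<close>, since
    they differ from the corners \<open>q\<close> by at most one mesh width. This is used for
    \<open>R\<close> and \<open>S\<close>, which depend on the coordinate i.\<close>
  have near: "(\<lambda>k. f (sc (Suc (r k)) (Y (r k))) i) \<longlonglongrightarrow> f x i \<and> (\<lambda>k. sc (Suc (r k)) (Y (r k)) i) \<longlonglongrightarrow> x i"
    if Y: "\<And>k j. j < n \<Longrightarrow> q k j \<le> Y k j \<and> Y k j \<le> q k j + 1" and i: "i < n" for Y i
  proof -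
    have lim: "(\<lambda>k. sc (Suc (r k)) (Y (r k)) j) \<longlonglongrightarrow> x j" if j: "j < n" for j
    proof -
      have inv0: "(\<lambda>k. 1 / real (Suc (r k))) \<longlonglongrightarrow> 0"
        using LIMSEQ_subseq_LIMSEQ[OF LIMSEQ_inverse_real_of_nat r(1)] by (simp add: o_def inverse_eq_divide)
      have "(\<lambda>k. sc (Suc (r k)) (Y (r k)) j - sc (Suc (r k)) (q (r k)) j) \<longlonglongrightarrow> 0"
      proof (rule Lim_null_comparison[OF _ inv0], rule always_eventually, rule allI)
        fix k
        have "real (q (r k) j) \<le> real (Y (r k) j)" "real (Y (r k) j) \<le> real (q (r k) j) + 1"
          using Y[OF j, of "r k"] by linarith+
        then show "norm (sc (Suc (r k)) (Y (r k)) j - sc (Suc (r k)) (q (r k)) j) \<le> 1 / real (Suc (r k))"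
          unfolding sc_def diff_divide_distrib[symmetric] by (simp add: divide_right_mono)
      qed
      from tendsto_add[OF this r(3)[OF j]] show ?thesis by simp
    qed
    have "sc (Suc (r k)) (Y (r k)) \<in> cube" for k
    proof (rule sc_cube)
      show "Y (r k) j \<le> Suc (r k)" if "j < n" for j
        using Y[OF that, of "r k"] q[OF that, of "r k"] by simp
    qed simp
    then show ?thesis using cont[OF _ xc lim i] lim i by blast
  qed
  show ?thesis
  proof (rule that[OF xc])
    fix i assume i: "i < n"
    have "x i \<le> f x i"
      using near[of "\<lambda>k. R k i" i] R i by (intro LIMSEQ_le[of _ "x i" _ "f x i"]) auto
    moreover have "f x i \<le> x i"
      using near[of "\<lambda>k. S k i" i] S i by (intro LIMSEQ_le[of _ "f x i" _ "x i"]) auto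
    ultimately show "f x i = x i" by simp
  qed
qed

section \<open>Schauder's theorem for a seminorm\<close>

text \<open>The members are functions and not classes, so \<open>N\<close> may vanish at nonzero
  functions and limits are determined only up to distance 0.\<close>

locale seminormed_functions =
  fixes W :: "('x \<Rightarrow> real) set" and N :: "('x \<Rightarrow> real) \<Rightarrow> real"
  assumes zero_in: "(\<lambda>x. 0) \<in> W"
    and add_in: "\<And>u v. u \<in> W \<Longrightarrow> v \<in> W \<Longrightarrow> (\<lambda>x. u x + v x) \<in> W"
    and scale_in: "\<And>c u. u \<in> W \<Longrightarrow> (\<lambda>x. c * u x) \<in> W"
    and N_add: "\<And>u v. u \<in> W \<Longrightarrow> v \<in> W \<Longrightarrow> N (\<lambda>x. u x + v x) \<le> N u + N v"
    and N_scale: "\<And>c u. u \<in> W \<Longrightarrow> N (\<lambda>x. c * u x) = \<bar>c\<bar> * N u"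
begin

lemma N_zero: "N (\<lambda>x. 0) = 0"
  using N_scale[OF zero_in, of 0] by simp

lemma diff_in: "u \<in> W \<Longrightarrow> v \<in> W \<Longrightarrow> (\<lambda>x. u x - v x) \<in> W"
  using add_in[of u "\<lambda>x. (-1) * v x"] scale_in[of v "-1"] by simp

lemma N_nonneg: "u \<in> W \<Longrightarrow> 0 \<le> N u"
  using N_add[of u "\<lambda>x. (-1) * u x"] N_scale[of u "-1"] scale_in[of u "-1"] N_zero by simp

definition d :: "('x \<Rightarrow> real) \<Rightarrow> ('x \<Rightarrow> real) \<Rightarrow> real" where
  "d u v = N (\<lambda>x. u x - v x)"

lemma d_nonneg: "u \<in> W \<Longrightarrow> v \<in> W \<Longrightarrow> 0 \<le> d u v"
  by (simp add: d_def N_nonneg diff_in)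

lemma d_commute: "u \<in> W \<Longrightarrow> v \<in> W \<Longrightarrow> d u v = d v u"
  using N_scale[OF diff_in[of u v], of "-1"] by (simp add: d_def algebra_simps)

lemma d_triangle: "u \<in> W \<Longrightarrow> v \<in> W \<Longrightarrow> w \<in> W \<Longrightarrow> d u w \<le> d u v + d v w"
  using N_add[OF diff_in[of u v] diff_in[of v w]] by (simp add: d_def)

lemma sum_in:
  "finite I \<Longrightarrow> (\<And>i. i \<in> I \<Longrightarrow> u i \<in> W) \<Longrightarrow> (\<lambda>x. \<Sum>i\<in>I. a i * u i x) \<in> W"
proof (induction I rule: finite_induct)
  case (insert j I)
  then show ?case using add_in[OF scale_in[of "u j" "a j"], of "\<lambda>x. \<Sum>i\<in>I. a i * u i x"] by simp
qed (simp add: zero_in)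

lemma N_sum:
  "finite I \<Longrightarrow> (\<And>i. i \<in> I \<Longrightarrow> u i \<in> W) \<Longrightarrow> N (\<lambda>x. \<Sum>i\<in>I. a i * u i x) \<le> (\<Sum>i\<in>I. \<bar>a i\<bar> * N (u i))"
proof (induction I rule: finite_induct)
  case (insert j I)
  have "N (\<lambda>x. a j * u j x + (\<Sum>i\<in>I. a i * u i x)) \<le> N (\<lambda>x. a j * u j x) + N (\<lambda>x. \<Sum>i\<in>I. a i * u i x)"
    using insert by (intro N_add scale_in sum_in) auto
  also have "\<dots> \<le> \<bar>a j\<bar> * N (u j) + (\<Sum>i\<in>I. \<bar>a i\<bar> * N (u i))"
    using insert by (intro add_mono) (auto simp: N_scale)
  finally show ?case using insert by simp
qed (simp add: N_zero)

text \<open>Convexity is given for two points; the induction splits off one point and normalizes the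
  remaining weights by their sum, which may be 0.\<close>

lemma convex_sum_in:
  fixes B :: "('x \<Rightarrow> real) set" and a :: "'i \<Rightarrow> real"
  assumes conv: "\<And>u v s. u \<in> B \<Longrightarrow> v \<in> B \<Longrightarrow> 0 \<le> s \<Longrightarrow> s \<le> 1 \<Longrightarrow> (\<lambda>x. (1 - s) * u x + s * v x) \<in> B"
  shows "finite I \<Longrightarrow> (\<And>i. i \<in> I \<Longrightarrow> u i \<in> B) \<Longrightarrow> (\<And>i. i \<in> I \<Longrightarrow> 0 \<le> a i) \<Longrightarrow> sum a I = 1 \<Longrightarrow>
    (\<lambda>x. \<Sum>i\<in>I. a i * u i x) \<in> B"
proof (induction I arbitrary: a rule: finite_induct)
  case (insert j I a)
  have nn: "0 \<le> sum a I" by (rule sum_nonneg) (use insert.prems(2) in blast)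
  have s1: "a j + sum a I = 1" using insert by simp
  have le1: "sum a I \<le> 1" using s1 insert.prems(2)[of j] by auto
  show ?case
  proof (cases "sum a I = 0")
    case True
    then have "\<forall>i\<in>I. a i = 0" using insert by (subst (asm) sum_nonneg_eq_0_iff) auto
    then have "(\<lambda>x. \<Sum>i\<in>insert j I. a i * u i x) = u j" using insert s1 True by auto
    then show ?thesis using insert by simp
  next
    case False
    define b where "b i = a i / sum a I" for i
    have "(\<lambda>x. \<Sum>i\<in>I. b i * u i x) \<in> B"
      using insert nn False by (intro insert.IH) (auto simp: b_def sum_divide_distrib[symmetric])
    then have "(\<lambda>x. (1 - sum a I) * u j x + sum a I * (\<Sum>i\<in>I. b i * u i x)) \<in> B"
      using insert nn le1 by (intro conv) auto
    moreover have "(1 - sum a I) * u j x + sum a I * (\<Sum>i\<in>I. b i * u i x) = (\<Sum>i\<in>insert j I. a i * u i x)" for x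
      using insert s1 False by (simp add: sum_distrib_left b_def)
    ultimately show ?thesis by simp
  qed
qed simp

text \<open>The image of \<open>T\<close> has a finite e-net, and averaging the net points with
  suitable continuous weights moves a point of the image by at most e. Brouwer's theorem for the
  weights gives approximate fixed points, and the compactness of the image produces a limit of
  them.\<close>

theorem schauder:
  fixes B :: "('x \<Rightarrow> real) set" and T :: "('x \<Rightarrow> real) \<Rightarrow> 'x \<Rightarrow> real"
  assumes BW: "B \<subseteq> W" and ne: "B \<noteq> {}"
    and conv: "\<And>u v s. u \<in> B \<Longrightarrow> v \<in> B \<Longrightarrow> 0 \<le> s \<Longrightarrow> s \<le> 1 \<Longrightarrow> (\<lambda>x. (1 - s) * u x + s * v x) \<in> B"
    and TB: "\<And>w. w \<in> B \<Longrightarrow> T w \<in> B"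
    and cont: "\<And>w z. (\<And>n::nat. w n \<in> B) \<Longrightarrow> z \<in> B \<Longrightarrow> (\<lambda>n. d (w n) z) \<longlonglongrightarrow> 0 \<Longrightarrow> (\<lambda>n. d (T (w n)) (T z)) \<longlonglongrightarrow> 0"
    and comp: "\<And>w. (\<And>n::nat. w n \<in> B) \<Longrightarrow> \<exists>z\<in>B. \<exists>r::nat \<Rightarrow> nat. strict_mono r \<and> (\<lambda>n. d (T (w (r n))) z) \<longlonglongrightarrow> 0"
  obtains z where "z \<in> B" "d (T z) z = 0"
proof -
  have W: "u \<in> W" if "u \<in> B" for u using that BW by blast
  have net: "\<exists>F. finite F \<and> F \<subseteq> B \<and> (\<forall>w\<in>B. \<exists>y\<in>F. d (T w) (T y) < e)" if e: "e > 0" for e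
  proof (rule ccontr)
    assume no: "\<not> ?thesis"
    have "\<forall>F. \<exists>w. finite F \<and> F \<subseteq> B \<longrightarrow> w \<in> B \<and> (\<forall>y\<in>F. e \<le> d (T w) (T y))"
      using no by (meson not_le)
    then obtain c where c: "\<And>F. finite F \<Longrightarrow> F \<subseteq> B \<Longrightarrow> c F \<in> B \<and> (\<forall>y\<in>F. e \<le> d (T (c F)) (T y))"
      by metis
    \<comment> \<open>\<open>L n\<close> lists the points chosen in the first n steps. The image of
      each new point has distance at least e from all earlier images, which contradicts the
      convergent subsequence given by \<open>comp\<close>.\<close>
    define L where "L = rec_nat [] (\<lambda>_ l. c (set l) # l)"
    have LS: "L (Suc n) = c (set (L n)) # L n" for n by (simp add: L_def)
    have LB: "set (L n) \<subseteq> B" for n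
      by (induction n) (use c in \<open>auto simp: L_def\<close>)
    define w where "w n = c (set (L n))" for n
    have wB: "w n \<in> B" for n using c[OF _ LB] by (simp add: w_def)
    have wL: "k < n \<Longrightarrow> w k \<in> set (L n)" for k n
      by (induction n) (auto simp: LS w_def less_Suc_eq)
    have sep: "e \<le> d (T (w n)) (T (w k))" if "k < n" for k n
      using c[OF _ LB[of n]] wL[OF that] by (simp add: w_def)
    obtain z r where z: "z \<in> B" "strict_mono (r::nat \<Rightarrow> nat)" "(\<lambda>n. d (T (w (r n))) z) \<longlonglongrightarrow> 0"
      using comp[of w] wB by blast
    from LIMSEQ_D[OF z(3), of "e / 2"] e obtain n0 where
      n0: "\<And>n. n \<ge> n0 \<Longrightarrow> \<bar>d (T (w (r n))) z\<bar> < e / 2" by auto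
    have "r n0 < r (Suc n0)" using z(2) by (simp add: strict_mono_Suc_iff)
    then have "e \<le> d (T (w (r (Suc n0)))) (T (w (r n0)))" by (rule sep)
    also have "\<dots> \<le> d (T (w (r (Suc n0)))) z + d z (T (w (r n0)))"
      by (intro d_triangle W TB wB z)
    also have "d z (T (w (r n0))) = d (T (w (r n0))) z" by (intro d_commute W TB wB z)
    finally show False using n0[of n0] n0[of "Suc n0"] by auto
  qed
  have approx: "\<exists>w\<in>B. d (T w) w \<le> e" if e: "e > 0" for e
  proof -
    obtain F where F: "finite F" "F \<subseteq> B" "\<And>w. w \<in> B \<Longrightarrow> \<exists>y\<in>F. d (T w) (T y) < e"
      using net[OF e] by metis
    obtain l where l: "set l = F" using finite_list[OF F(1)] by blast
    have "F \<noteq> {}" using F(3) ne by blast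
    then obtain m where m: "length l = Suc m" using l by (cases l) auto
    define y where "y i = T (l ! i)" for i
    have yB: "y i \<in> B" if "i \<le> m" for i
      unfolding y_def using that l m F(2) by (intro TB) (metis le_imp_less_Suc nth_mem subsetD)
    have yW: "y i \<in> W" if "i \<le> m" for i using W yB that by blast
    have ynet: "\<exists>i\<le>m. d (T w) (y i) < e" if w: "w \<in> B" for w
    proof -
      obtain u where "u \<in> set l" "d (T w) (T u) < e" using F(3)[OF w] l by blast
      then show ?thesis using m by (metis in_set_conv_nth less_Suc_eq_le y_def)
    qed
    \<comment> \<open>The weights of the Schauder projection: \<open>\<nu> v i\<close> is positive
      exactly if \<open>y i\<close> is within e of v. For v = T w the net provides such an i, so the
      normalizing sum is positive.\<close>
    define \<nu> where "\<nu> v i = max 0 (e - d v (y i))" for v i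
    define \<Lambda> where "\<Lambda> v = (\<Sum>i\<le>m. \<nu> v i)" for v
    define lam where "lam v i = \<nu> v i / \<Lambda> v" for v i
    have nu0: "0 \<le> \<nu> v i" for v i by (simp add: \<nu>_def)
    have Lpos: "\<Lambda> (T w) > 0" if w: "w \<in> B" for w
    proof -
      obtain i where "i \<le> m" "d (T w) (y i) < e" using ynet[OF w] by blast
      then have "0 < \<nu> (T w) i" by (simp add: \<nu>_def)
      then show ?thesis unfolding \<Lambda>_def using \<open>i \<le> m\<close> nu0 by (intro sum_pos2[of _ i]) auto
    qed
    have lam0: "0 \<le> lam (T w) i" for w i using nu0 by (simp add: lam_def \<Lambda>_def sum_nonneg)
    have lamsum: "(\<Sum>i\<le>m. lam (T w) i) = 1" if "w \<in> B" for w
      using Lpos[OF that] by (simp add: lam_def sum_divide_distrib[symmetric] \<Lambda>_def)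
    have lam1: "lam (T w) i \<le> 1" if "w \<in> B" "i \<le> m" for w i
      using member_le_sum[of i "{..m}" "lam (T w)"] lam0 lamsum that by auto
    \<comment> \<open>Brouwer's theorem is stated for a cube and not for the simplex of weights. The
      m coordinates prescribe the weights with indices 1 to m and index 0 receives the rest;
      dividing by the maximum of 1 and the sum maps the cube continuously to weights that are
      nonnegative with sum 1. At the fixed point the sum is at most 1 and the division has no
      effect.\<close>
    define wt where "wt a i = (case i of 0 \<Rightarrow> 1 - (\<Sum>j<m. a j) / max 1 (\<Sum>j<m. a j)
        | Suc j \<Rightarrow> a j / max 1 (\<Sum>j<m. a j))" for a :: "nat \<Rightarrow> real" and i
    define w where "w a = (\<lambda>x. \<Sum>i\<le>m. wt a i * y i x)" for a
    have sum_split: "(\<Sum>i\<le>m. g i) = g 0 + (\<Sum>j<m. g (Suc j))" for g :: "nat \<Rightarrow> real"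
      unfolding lessThan_Suc_atMost[symmetric] by (rule sum.lessThan_Suc_shift)
    have wB: "w a \<in> B" if a: "\<forall>i<m. a i \<in> {0..1}" for a
      unfolding w_def
    proof (rule convex_sum_in[OF conv])
      have s: "0 \<le> (\<Sum>j<m. a j)" using a by (intro sum_nonneg) auto
      show "0 \<le> wt a i" if "i \<in> {..m}" for i
        using a that s by (cases i) (auto simp: wt_def divide_le_eq)
      show "sum (wt a) {..m} = 1" unfolding sum_split by (simp add: wt_def sum_divide_distrib[symmetric])
    qed (use yB in auto)
    obtain a where a: "a \<in> {x. \<forall>i<m. x i \<in> {0..1}}" "\<And>i. i < m \<Longrightarrow> lam (T (w a)) (Suc i) = a i"
    proof (rule brouwer_cube_coordinates[of m "\<lambda>a i. lam (T (w a)) (Suc i)"])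
      show "lam (T (w x)) (Suc i) \<in> {0..1}" if "x \<in> {x. \<forall>i<m. x i \<in> {0..1}}" "i < m" for x i
        using lam0 lam1[OF wB, of x "Suc i"] that by auto
      fix X x i
      assume X: "\<And>k::nat. X k \<in> {x. \<forall>i<m. x i \<in> {0..1::real}}" and x: "x \<in> {x. \<forall>i<m. x i \<in> {0..1::real}}"
        and lim: "\<And>j. j < m \<Longrightarrow> (\<lambda>k. X k j) \<longlonglongrightarrow> x j" and i: "i < m"
      have XB: "w (X k) \<in> B" for k using wB X by blast
      have xB: "w x \<in> B" using wB x by blast
      have s: "(\<lambda>k. \<Sum>j<m. X k j) \<longlonglongrightarrow> (\<Sum>j<m. x j)" by (intro tendsto_sum lim) auto
      have wt: "(\<lambda>k. wt (X k) j) \<longlonglongrightarrow> wt x j" if "j \<le> m" for j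
        using that by (cases j) (auto simp: wt_def intro!: tendsto_intros s lim)
      have "(\<lambda>k. d (w (X k)) (w x)) \<longlonglongrightarrow> 0"
      proof (rule tendsto_sandwich[where f="\<lambda>_. 0"])
        have "d (w (X k)) (w x) \<le> (\<Sum>j\<le>m. \<bar>wt (X k) j - wt x j\<bar> * N (y j))" for k
          using N_sum[of "{..m}" y "\<lambda>j. wt (X k) j - wt x j"] yW
          by (simp add: d_def w_def sum_subtractf left_diff_distrib)
        then show "\<forall>\<^sub>F k in sequentially. d (w (X k)) (w x) \<le> (\<Sum>j\<le>m. \<bar>wt (X k) j - wt x j\<bar> * N (y j))"
          by simp
        have "(\<lambda>k. \<Sum>j\<le>m. \<bar>wt (X k) j - wt x j\<bar> * N (y j)) \<longlonglongrightarrow> (\<Sum>j\<le>m. \<bar>wt x j - wt x j\<bar> * N (y j))"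
          by (intro tendsto_intros wt) auto
        then show "(\<lambda>k. \<Sum>j\<le>m. \<bar>wt (X k) j - wt x j\<bar> * N (y j)) \<longlonglongrightarrow> 0" by simp
      qed (use XB xB W in \<open>auto intro!: always_eventually d_nonneg\<close>)
      then have Tlim: "(\<lambda>k. d (T (w (X k))) (T (w x))) \<longlonglongrightarrow> 0" by (rule cont[OF XB xB])
      have dlim: "(\<lambda>k. d (T (w (X k))) (y j)) \<longlonglongrightarrow> d (T (w x)) (y j)" if j: "j \<le> m" for j
      proof -
        have "\<bar>d (T (w (X k))) (y j) - d (T (w x)) (y j)\<bar> \<le> d (T (w (X k))) (T (w x))" for k
          using d_triangle[of "T (w (X k))" "T (w x)" "y j"] d_triangle[of "T (w x)" "T (w (X k))" "y j"]
            d_commute[of "T (w x)" "T (w (X k))"] W TB XB xB yW[OF j] by (simp add: abs_le_iff)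
        then have "(\<lambda>k. d (T (w (X k))) (y j) - d (T (w x)) (y j)) \<longlonglongrightarrow> 0"
          by (intro Lim_null_comparison[OF _ Tlim]) auto
        then show ?thesis by (simp add: LIM_zero_iff)
      qed
      have nulim: "(\<lambda>k. \<nu> (T (w (X k))) j) \<longlonglongrightarrow> \<nu> (T (w x)) j" if j: "j \<le> m" for j
        unfolding \<nu>_def by (intro tendsto_intros dlim j)
      show "(\<lambda>k. lam (T (w (X k))) (Suc i)) \<longlonglongrightarrow> lam (T (w x)) (Suc i)"
        unfolding lam_def \<Lambda>_def using i Lpos[OF xB] by (intro tendsto_intros nulim) (auto simp: \<Lambda>_def)
    qed blast
    define v where "v = T (w a)"
    have waB: "w a \<in> B" using wB a(1) by blast
    have vB: "v \<in> B" unfolding v_def by (intro TB waB)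
    have s: "(\<Sum>j<m. a j) = 1 - lam v 0"
    proof -
      have "(\<Sum>j<m. a j) = (\<Sum>j<m. lam v (Suc j))" by (intro sum.cong) (auto simp: a(2) v_def)
      then show ?thesis using lamsum[OF waB] unfolding sum_split by (simp add: v_def)
    qed
    have M: "max 1 (\<Sum>j<m. a j) = 1" using lam0[of "w a" 0] unfolding s v_def by simp
    have wtl: "wt a i = lam v i" if "i \<le> m" for i
      using that a(2) s unfolding wt_def M by (cases i) (auto simp: v_def)
    \<comment> \<open>At the fixed point \<open>w a\<close> is the Schauder projection of its own
      image v. Hence v - w a averages the differences v - y i, and only those with d v (y i) < e
      carry weight.\<close>
    have eq: "v x - w a x = (\<Sum>i\<le>m. lam v i * (v x - y i x))" for x
    proof -
      have "w a x = (\<Sum>i\<le>m. lam v i * y i x)" unfolding w_def by (intro sum.cong) (auto simp: wtl)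
      moreover have "v x = (\<Sum>i\<le>m. lam v i * v x)"
        using lamsum[OF waB] by (simp add: sum_distrib_right[symmetric] v_def)
      ultimately show ?thesis by (simp add: sum_subtractf right_diff_distrib)
    qed
    have "d v (w a) = N (\<lambda>x. \<Sum>i\<le>m. lam v i * (v x - y i x))" by (simp add: d_def eq)
    also have "\<dots> \<le> (\<Sum>i\<le>m. \<bar>lam v i\<bar> * d v (y i))"
      unfolding d_def by (rule N_sum) (use yW vB W in \<open>auto intro!: diff_in\<close>)
    also have "\<dots> \<le> (\<Sum>i\<le>m. lam v i * e)"
    proof (rule sum_mono)
      fix i assume "i \<in> {..m}"
      show "\<bar>lam v i\<bar> * d v (y i) \<le> lam v i * e"
      proof (cases "d v (y i) < e")
        case True
        then show ?thesis using lam0[of "w a" i] by (auto simp: v_def intro: mult_left_mono)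
      next
        case False
        then show ?thesis by (simp add: lam_def \<nu>_def)
      qed
    qed
    also have "\<dots> = e" using lamsum[OF waB] by (simp add: sum_distrib_right[symmetric] v_def)
    finally show ?thesis using waB by (auto simp: v_def)
  qed
  \<comment> \<open>The errors tend to 0, so a limit of the images is also a limit of the points,
    and continuity of \<open>T\<close> puts it at distance 0 from its image.\<close>
  have "\<forall>n. \<exists>w\<in>B. d (T w) w \<le> 1 / real (Suc n)" using approx by simp
  then obtain w where w: "\<And>n. w n \<in> B" "\<And>n. d (T (w n)) (w n) \<le> 1 / real (Suc n)" by metis
  obtain z r where z: "z \<in> B" "strict_mono (r::nat \<Rightarrow> nat)" "(\<lambda>n. d (T (w (r n))) z) \<longlonglongrightarrow> 0"
    using comp[of w] w by blast
  have inv0: "(\<lambda>n. 1 / real (Suc (r n))) \<longlonglongrightarrow> 0"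
    using LIMSEQ_subseq_LIMSEQ[OF LIMSEQ_inverse_real_of_nat z(2)] by (simp add: o_def inverse_eq_divide)
  have "(\<lambda>n. d (w (r n)) z) \<longlonglongrightarrow> 0"
  proof (rule tendsto_sandwich[where f="\<lambda>_. 0"])
    have "d (w (r n)) z \<le> 1 / real (Suc (r n)) + d (T (w (r n))) z" for n
      using d_triangle[of "w (r n)" "T (w (r n))" z] d_commute[of "w (r n)" "T (w (r n))"] w(2)[of "r n"]
        W TB w(1) z(1) by (smt (verit))
    then show "\<forall>\<^sub>F n in sequentially. d (w (r n)) z \<le> 1 / real (Suc (r n)) + d (T (w (r n))) z" by simp
    show "(\<lambda>n. 1 / real (Suc (r n)) + d (T (w (r n))) z) \<longlonglongrightarrow> 0"
      using tendsto_add[OF inv0 z(3)] by simp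
  qed (use w z W in \<open>auto intro!: always_eventually d_nonneg\<close>)
  then have "(\<lambda>n. d (T (w (r n))) (T z)) \<longlonglongrightarrow> 0" by (intro cont w z)
  from tendsto_add[OF this z(3)] have "(\<lambda>n. d (T (w (r n))) (T z) + d (T (w (r n))) z) \<longlonglongrightarrow> 0" by simp
  moreover have "d (T z) z \<le> d (T (w (r n))) (T z) + d (T (w (r n))) z" for n
    using d_triangle[of "T z" "T (w (r n))" z] d_commute[of "T z" "T (w (r n))"] W TB w(1) z(1)
    by (smt (verit))
  ultimately have "d (T z) z \<le> 0" by (intro LIMSEQ_le_const) auto
  moreover have "0 \<le> d (T z) z" by (intro d_nonneg W TB z)
  ultimately show ?thesis using that[OF z(1)] by simp
qed

end


subsection \<open>Minimizers of the functional\<close>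

text \<open>For positive \<open>x\<close> and \<open>y\<close> this is the convexity of the power;
  if one of them is 0, it reduces to c^t <= c for c in [0,1].\<close>

lemma powr_convex_nonneg:
  fixes x y s t :: real
  assumes t: "t \<ge> 1" and "0 \<le> x" "0 \<le> y" "0 \<le> s" "s \<le> 1"
  shows "((1 - s) * x + s * y) powr t \<le> (1 - s) * x powr t + s * y powr t"
proof -
  have sub: "c powr t \<le> c" if "0 \<le> c" "c \<le> 1" for c :: real
    using powr_mono'[of 1 t c] that t by simp
  consider "x = 0" | "y = 0" | "x > 0" "y > 0" using assms by linarith
  then show ?thesis
  proof cases
    case 1
    then show ?thesis using sub[of s] assms by (auto simp: powr_mult intro: mult_right_mono)
  next
    case 2
    then show ?thesis using sub[of "1 - s"] assms by (auto simp: powr_mult intro: mult_right_mono)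
  next
    case 3
    then show ?thesis using convex_onD[OF powr_convex[OF t], of s x y] assms by simp
  qed
qed

lemma abs_powr_convex:
  fixes a b s t :: real
  assumes t: "t \<ge> 1" and s: "0 \<le> s" "s \<le> 1"
  shows "\<bar>(1 - s) * a + s * b\<bar> powr t \<le> (1 - s) * \<bar>a\<bar> powr t + s * \<bar>b\<bar> powr t"
proof -
  have "\<bar>(1 - s) * a + s * b\<bar> \<le> (1 - s) * \<bar>a\<bar> + s * \<bar>b\<bar>"
    using abs_triangle_ineq[of "(1 - s) * a" "s * b"] s by (simp add: abs_mult)
  then have "\<bar>(1 - s) * a + s * b\<bar> powr t \<le> ((1 - s) * \<bar>a\<bar> + s * \<bar>b\<bar>) powr t"
    using t by (intro powr_mono2) auto
  also have "\<dots> \<le> (1 - s) * \<bar>a\<bar> powr t + s * \<bar>b\<bar> powr t"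
    using s t by (intro powr_convex_nonneg) auto
  finally show ?thesis .
qed

lemma abs_powr_midpoint:
  fixes a b t c :: real
  assumes "t \<ge> 1"
  shows "\<bar>(a + b) / 2\<bar> powr t \<le> (\<bar>a\<bar> powr t + \<bar>b\<bar> powr t) / 2"
proof -
  have "(1 - 1/2) * a + 1/2 * b = (a + b) / 2" by (simp add: field_simps)
  then show ?thesis using abs_powr_convex[OF assms, of "1/2" a b] by (simp add: add_divide_distrib)
qed

text \<open>The mean value theorem on the two halves of the interval compares the increments,
  because the derivative t z^(t-1) is strictly increasing. The case x = 0 rests on (1/2)^t <
  1/2.\<close>

lemma powr_midpoint_strict:
  fixes x y t :: real
  assumes t: "t > 1" and "0 \<le> x" "x < y"
  shows "((x + y) / 2) powr t < (x powr t + y powr t) / 2"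
proof (cases "x = 0")
  case True
  have "(1 / 2 :: real) powr t < (1 / 2) powr 1" using t by (intro powr_less_mono') auto
  then have "(1 / 2) powr t * y powr t < 1 / 2 * y powr t" using assms by (intro mult_strict_right_mono) auto
  moreover have "(y / 2) powr t = (1 / 2) powr t * y powr t"
    using powr_mult[of "1 / 2" y t] assms by simp
  ultimately show ?thesis using True by simp
next
  case False
  define m where "m = (x + y) / 2"
  have xm: "0 < x" "x < m" "m < y" "y - m = m - x" using False assms by (auto simp: m_def field_simps)
  have D: "((\<lambda>z. z powr t) has_real_derivative t * z powr (t - 1)) (at z)" if "z > 0" for z
    using has_real_derivative_powr[OF that] .
  obtain \<xi> where xi: "x < \<xi>" "\<xi> < m" "m powr t - x powr t = (m - x) * (t * \<xi> powr (t - 1))"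
    using MVT2[OF xm(2), of "\<lambda>z. z powr t" "\<lambda>z. t * z powr (t - 1)"] D xm by force
  obtain \<zeta> where ze: "m < \<zeta>" "\<zeta> < y" "y powr t - m powr t = (y - m) * (t * \<zeta> powr (t - 1))"
    using MVT2[OF xm(3), of "\<lambda>z. z powr t" "\<lambda>z. t * z powr (t - 1)"] D xm by force
  have "\<xi> powr (t - 1) < \<zeta> powr (t - 1)" using xi ze xm t by (intro powr_less_mono2) auto
  then have "m powr t - x powr t < y powr t - m powr t"
    unfolding xi(3) ze(3) xm(4) using t xm by (intro mult_strict_left_mono) auto
  then show ?thesis by (simp add: m_def)
qed

lemma abs_powr_midpoint_strict:
  fixes a b t :: real
  assumes t: "t > 1" and "a \<noteq> b"
  shows "\<bar>(a + b) / 2\<bar> powr t < (\<bar>a\<bar> powr t + \<bar>b\<bar> powr t) / 2"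
proof -
  have *: "\<bar>(a + b) / 2\<bar> powr t < (\<bar>a\<bar> powr t + \<bar>b\<bar> powr t) / 2" if "\<bar>a\<bar> < \<bar>b\<bar>" for a b :: real
  proof -
    have "\<bar>(a + b) / 2\<bar> powr t \<le> ((\<bar>a\<bar> + \<bar>b\<bar>) / 2) powr t"
      using t by (intro powr_mono2) auto
    then show ?thesis using powr_midpoint_strict[OF t _ that] by simp
  qed
  \<comment> \<open>If the absolute values agree and a differs from b, then b = -a and the left side
    is 0.\<close>
  consider "\<bar>a\<bar> < \<bar>b\<bar>" | "\<bar>b\<bar> < \<bar>a\<bar>" | "b = - a" "a \<noteq> 0" using assms(2) by linarith
  then show ?thesis
  proof cases
    case 1 then show ?thesis using * by blast
  next
    case 2 then show ?thesis using *[of b a] by (simp add: add.commute)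
  qed simp
qed

text \<open>The norm of a matrix is here the Frobenius norm, the Euclidean norm of the row norms, so
  Cauchy-Schwarz is applied row by row.\<close>

lemma norm_matrix_vector_le:
  fixes M :: "real^'n^'m"
  shows "norm (M *v Q) \<le> norm M * norm Q"
proof -
  have "norm (M *v Q) = L2_set (\<lambda>i. norm ((M *v Q) $ i)) UNIV" by (rule norm_vec_def)
  also have "\<dots> \<le> L2_set (\<lambda>i. norm (M $ i) * norm Q) UNIV"
    by (intro L2_set_mono) (auto simp: matrix_vector_mul_component Cauchy_Schwarz_ineq2)
  also have "\<dots> = L2_set (\<lambda>i. norm (M $ i)) UNIV * norm Q"
    by (rule L2_set_left_distrib[symmetric]) simp
  also have "L2_set (\<lambda>i. norm (M $ i)) UNIV = norm M" by (rule norm_vec_def[symmetric])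
  finally show ?thesis .
qed

lemma quadratic_form_le: "\<bar>(M *v Q) \<bullet> Q\<bar> \<le> norm (M :: real^'n^'n) * (norm Q)\<^sup>2"
proof -
  have "\<bar>(M *v Q) \<bullet> Q\<bar> \<le> norm (M *v Q) * norm Q" by (rule Cauchy_Schwarz_ineq2)
  also have "\<dots> \<le> (norm M * norm Q) * norm Q" by (intro mult_right_mono norm_matrix_vector_le) auto
  finally show ?thesis by (simp add: power2_eq_square mult.assoc)
qed

lemma continuous_quadratic_form:
  "continuous_on UNIV (\<lambda>p :: (real^'n^'n) \<times> (real^'n). (fst p *v snd p) \<bullet> snd p)"
  unfolding inner_vec_def matrix_vector_mul_component
  by (intro continuous_intros)

lemma quadratic_form_midpoint:
  fixes M :: "real^'n^'n"
  shows "(M *v ((1/2) *\<^sub>R (a + b))) \<bullet> ((1/2) *\<^sub>R (a + b))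
    = ((M *v a) \<bullet> a + (M *v b) \<bullet> b) / 2 - ((M *v (a - b)) \<bullet> (a - b)) / 4"
  by (simp add: matrix_vector_mult_scaleR matrix_vector_right_distrib matrix_vector_mult_diff_distrib
      inner_simps field_simps)

section \<open>The energy, its convexity and its minimizing sequences\<close>

locale data_functional = lipschitz_data +
  fixes t lam :: real and f :: "real^2 \<Rightarrow> real"
  assumes t: "t > 1" and lam: "lam > 0" and f: "f \<in> Lp t K"
begin

text \<open>The functional is written as a single integral over \<open>\<Omega>\<close>, so that Fatou's lemma is needed only once.\<close>

definition den :: "(real^2 \<Rightarrow> real^2^2) \<Rightarrow> (real^2 \<Rightarrow> real) \<Rightarrow> (real^2 \<Rightarrow> real^2) \<Rightarrow> real^2 \<Rightarrow> real" where
  "den F v g x = ((F x *v g x) \<bullet> g x) / 2 + lam * (indicator K x * \<bar>v x - f x\<bar> powr t)"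

abbreviation "fidelity v x \<equiv> indicator K x * \<bar>v x - f x\<bar> powr t"

abbreviation "power_K v x \<equiv> indicator K x * \<bar>v x\<bar> powr t"

text \<open>Real-valued, so that differences can be formed. It is the value of the functional only
  for admissible \<open>v\<close>: otherwise the Bochner integral takes its default value 0.\<close>

definition energy :: "(real^2 \<Rightarrow> real^2^2) \<Rightarrow> (real^2 \<Rightarrow> real) \<Rightarrow> (real^2 \<Rightarrow> real^2) \<Rightarrow> real" where
  "energy F v g = (\<integral>x. den F v g x \<partial>\<mu>)"

definition admissible :: "(real^2 \<Rightarrow> real) \<Rightarrow> bool" where
  "admissible v \<longleftrightarrow> integrable \<mu> (\<lambda>x. fidelity v x)"

text \<open>The gradient is carried along as an argument because it is determined only up to null
  sets. The comparison is restricted to admissible functions, where \<open>energy\<close> is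
  meaningful.\<close>

definition is_min :: "(real^2 \<Rightarrow> real^2^2) \<Rightarrow> (real^2 \<Rightarrow> real) \<Rightarrow> (real^2 \<Rightarrow> real^2) \<Rightarrow> bool" where
  "is_min F v g \<longleftrightarrow> wgrad v g \<and> admissible v \<and>
     (\<forall>u k. wgrad u k \<longrightarrow> admissible u \<longrightarrow> energy F v g \<le> energy F u k)"

lemma KOm: "K \<in> lmeasurable"
  by (rule fmeasurableI2[OF lmeasurable_Omega K(2,1)])

text \<open>The quadratic form attains a positive minimum on the compact product of the closure of
  \<open>\<Omega>\<close> with the unit sphere, and homogeneity extends the bound to all
  \<open>Q\<close>.\<close>

lemma elliptic:
  assumes F: "F \<in> C0_sym_pos \<Omega>"
  obtains \<alpha> where "\<alpha> > 0" "\<And>x Q. x \<in> \<Omega> \<Longrightarrow> \<alpha> * (norm Q)\<^sup>2 \<le> (F x *v Q) \<bullet> Q"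
proof -
  let ?S = "closure \<Omega> \<times> sphere (0 :: real^2) 1"
  let ?q = "\<lambda>p. (F (fst p) *v snd p) \<bullet> snd p"
  have cF: "continuous_on (closure \<Omega>) F" and pos: "\<And>x Q. x \<in> closure \<Omega> \<Longrightarrow> Q \<noteq> 0 \<Longrightarrow> (F x *v Q) \<bullet> Q > 0"
    using F by (auto simp: C0_sym_pos_def sym_pos_def)
  have c1: "compact ?S" using bounded_Omega by (intro compact_Times) auto
  have "\<Omega> \<noteq> {}" using lip by (simp add: lipschitz_domain_def)
  then obtain x0 where "x0 \<in> closure \<Omega>" using closure_subset by blast
  then have "(x0, axis 1 1) \<in> ?S" by simp
  then have c2: "?S \<noteq> {}" by blast
  have c3: "continuous_on ?S ?q"
  proof -
    have "continuous_on ?S (\<lambda>p. F (fst p))"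
      by (rule continuous_on_compose2[OF cF]) (auto intro: continuous_intros)
    then have "continuous_on ?S (\<lambda>p. (F (fst p), snd p))" by (intro continuous_intros)
    from continuous_on_compose2[OF continuous_quadratic_form this] show ?thesis by simp
  qed
  obtain p where p: "p \<in> ?S" "\<forall>y\<in>?S. ?q p \<le> ?q y"
    using continuous_attains_inf[OF c1 c2 c3] by (elim bexE)
  have "?q p > 0" using p(1) by (intro pos) auto
  moreover have "?q p * (norm Q)\<^sup>2 \<le> (F x *v Q) \<bullet> Q" if x: "x \<in> \<Omega>" for x Q
  proof (cases "Q = 0")
    case False
    have "(x, (1 / norm Q) *\<^sub>R Q) \<in> ?S" using x closure_subset False by auto
    from bspec[OF p(2) this] have "?q p \<le> ((F x *v Q) \<bullet> Q) / (norm Q)\<^sup>2"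
      by (simp add: matrix_vector_mult_scaleR power2_eq_square)
    then show ?thesis using False by (simp add: pos_le_divide_eq)
  qed simp
  ultimately show ?thesis using that by blast
qed

lemma bounded_coefficients:
  assumes F: "F \<in> C0_sym_pos \<Omega>"
  obtains \<beta> where "\<beta> \<ge> 0" "\<And>x. x \<in> \<Omega> \<Longrightarrow> norm (F x) \<le> \<beta>"
proof -
  have "compact (F ` closure \<Omega>)"
    using F bounded_Omega by (intro compact_continuous_image) (auto simp: C0_sym_pos_def)
  then obtain b where b: "\<And>x. x \<in> closure \<Omega> \<Longrightarrow> norm (F x) \<le> b"
    using compact_imp_bounded bounded_iff by (metis image_eqI)
  show ?thesis
  proof (rule that[of "max b 0"])
    show "norm (F x) \<le> max b 0" if "x \<in> \<Omega>" for x
      using b[of x] that closure_subset by force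
  qed simp
qed

lemma quad_nonneg: "F \<in> C0_sym_pos \<Omega> \<Longrightarrow> x \<in> \<Omega> \<Longrightarrow> 0 \<le> (F x *v Q) \<bullet> Q"
  using closure_subset[of \<Omega>]
  by (cases "Q = 0") (auto simp: C0_sym_pos_def sym_pos_def image_subset_iff intro: less_imp_le)

lemma coefficients_measurable: "F \<in> C0_sym_pos \<Omega> \<Longrightarrow> F \<in> borel_measurable \<mu>"
  using sets_Omega closure_subset
  by (intro continuous_imp_measurable_on_sets_lebesgue) (auto simp: C0_sym_pos_def intro: continuous_on_subset)

lemma quad_measurable:
  fixes F :: "real^2 \<Rightarrow> real^2^2"
  assumes "F \<in> borel_measurable \<mu>" "g \<in> borel_measurable \<mu>"
  shows "(\<lambda>x. (F x *v g x) \<bullet> g x) \<in> borel_measurable \<mu>"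
  by (rule borel_measurable_continuous_Pair[where H="\<lambda>(A :: real^2^2) Q. (A *v Q) \<bullet> Q", OF assms continuous_quadratic_form])

lemma quad_integrable:
  assumes F: "F \<in> C0_sym_pos \<Omega>" and g: "g \<in> L2 \<mu>"
  shows "integrable \<mu> (\<lambda>x. (F x *v g x) \<bullet> g x)"
proof -
  obtain \<beta> where b: "\<beta> \<ge> 0" "\<And>x. x \<in> \<Omega> \<Longrightarrow> norm (F x) \<le> \<beta>" using bounded_coefficients[OF F] by metis
  show ?thesis
  proof (rule Bochner_Integration.integrable_bound[where f="\<lambda>x. \<beta> * (norm (g x))\<^sup>2"])
    show "integrable \<mu> (\<lambda>x. \<beta> * (norm (g x))\<^sup>2)" using L2_integrable[OF g] by simp
    show "(\<lambda>x. (F x *v g x) \<bullet> g x) \<in> borel_measurable \<mu>"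
      by (rule quad_measurable[OF coefficients_measurable[OF F] L2_measurable[OF g]])
    have "norm ((F x *v g x) \<bullet> g x) \<le> norm (\<beta> * (norm (g x))\<^sup>2)" if x: "x \<in> \<Omega>" for x
      using order_trans[OF quadratic_form_le mult_right_mono[OF b(2)[OF x]]] b(1) by (simp add: abs_mult)
    then show "AE x in \<mu>. norm ((F x *v g x) \<bullet> g x) \<le> norm (\<beta> * (norm (g x))\<^sup>2)"
      by (intro AE_I2) simp
  qed
qed

lemma indicator_K_measurable: "(indicator K :: real^2 \<Rightarrow> real) \<in> borel_measurable \<mu>"
  using K(1) by (intro measurable_restrict_space1) simp

lemma fidelity_measurable:
  assumes "v \<in> borel_measurable \<mu>"
  shows "(\<lambda>x. fidelity v x) \<in> borel_measurable \<mu>"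
proof -
  \<comment> \<open>\<open>f\<close> is measurable only on \<open>K\<close>; off \<open>K\<close>
    its values are irrelevant and may be replaced by 0.\<close>
  define f0 where "f0 x = (if x \<in> K then f x else 0)" for x
  have "f \<in> borel_measurable (lebesgue_on K)" using f by (simp add: Lp_def)
  then have "f0 \<in> borel_measurable lebesgue" unfolding f0_def using K(1)
    by (simp add: borel_measurable_if_I)
  then have [measurable]: "f0 \<in> borel_measurable \<mu>" by (rule measurable_restrict_space1)
  note indicator_K_measurable[measurable] assms[measurable]
  have "(\<lambda>x. indicator K x * \<bar>v x - f0 x\<bar> powr t) \<in> borel_measurable \<mu>" by measurable
  moreover have "(\<lambda>x. indicator K x * \<bar>v x - f0 x\<bar> powr t) = (\<lambda>x. fidelity v x)"
    by (auto simp: f0_def indicator_def)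
  ultimately show ?thesis by simp
qed

lemma fidelity_nonneg: "0 \<le> indicator K x * \<bar>y\<bar> powr t"
  by simp

lemma integral_on_K:
  fixes h :: "real^2 \<Rightarrow> real"
  shows "integrable (lebesgue_on K) h \<longleftrightarrow> integrable \<mu> (\<lambda>x. indicator K x * h x)"
    "(\<integral>x. h x \<partial>lebesgue_on K) = (\<integral>x. indicator K x * h x \<partial>\<mu>)"
proof -
  have *: "(\<lambda>x. indicator \<Omega> x * (indicator K x * h x)) = (\<lambda>x. indicator K x * h x)"
  proof (rule ext)
    show "indicator \<Omega> x * (indicator K x * h x) = indicator K x * h x" for x
      using K(2) by (cases "x \<in> K") auto
  qed
  show "integrable (lebesgue_on K) h \<longleftrightarrow> integrable \<mu> (\<lambda>x. indicator K x * h x)"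
    "(\<integral>x. h x \<partial>lebesgue_on K) = (\<integral>x. indicator K x * h x \<partial>\<mu>)"
    using K(1) sets_Omega by (simp_all add: integrable_restrict_space integral_restrict_space *)
qed

lemma f_powr_integrable: "integrable \<mu> (\<lambda>x. power_K f x)"
  using f by (simp add: Lp_def integral_on_K)

lemma admissible_0: "admissible (\<lambda>x. 0)"
  using f_powr_integrable by (simp add: admissible_def)

lemma den_nonneg: "F \<in> C0_sym_pos \<Omega> \<Longrightarrow> x \<in> \<Omega> \<Longrightarrow> 0 \<le> den F v g x"
  using quad_nonneg lam by (simp add: den_def)

lemma den_measurable:
  assumes "F \<in> C0_sym_pos \<Omega>" "v \<in> borel_measurable \<mu>" "g \<in> borel_measurable \<mu>"
  shows "den F v g \<in> borel_measurable \<mu>"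
  unfolding den_def
  by (intro borel_measurable_add borel_measurable_divide borel_measurable_const borel_measurable_times
      quad_measurable coefficients_measurable fidelity_measurable assms)

lemma den_integrable:
  assumes "F \<in> C0_sym_pos \<Omega>" "g \<in> L2 \<mu>" "admissible v"
  shows "integrable \<mu> (den F v g)"
  using quad_integrable[OF assms(1,2)] assms(3) unfolding den_def admissible_def by auto

lemma energy_eq:
  assumes "F \<in> C0_sym_pos \<Omega>" "g \<in> L2 \<mu>" "admissible v"
  shows "energy F v g = (\<integral>x. (F x *v g x) \<bullet> g x \<partial>\<mu>) / 2 + lam * (\<integral>x. fidelity v x \<partial>\<mu>)"
  using quad_integrable[OF assms(1,2)] assms(3) unfolding energy_def den_def admissible_def by simp

lemma energy_nonneg: "F \<in> C0_sym_pos \<Omega> \<Longrightarrow> 0 \<le> energy F v g"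
  unfolding energy_def by (intro integral_nonneg_AE AE_I2) (auto intro: den_nonneg)

text \<open>Connects the functional of the theorem, formed with the chosen gradient, with the single
  density formed with any weak gradient; the two gradients agree almost everywhere.\<close>

lemma J_functional_eq:
  assumes F: "\<D> w \<in> C0_sym_pos \<Omega>" and v: "wgrad v g"
  shows "J_functional \<Omega> K t lam \<D> w v f = (\<integral>\<^sup>+x. ennreal (den (\<D> w) v g x) \<partial>\<mu>)"
proof -
  define F where "F = \<D> w"
  note F' = F[folded F_def]
  have vm: "v \<in> borel_measurable \<mu>" and gm: "g \<in> borel_measurable \<mu>"
    using has_weak_gradientD[OF v] L2_measurable by blast+
  note q0 = quad_nonneg[OF F', of _ "g _"]
  have 1: "(\<integral>\<^sup>+x. ennreal ((F x *v weak_gradient \<Omega> v x) \<bullet> weak_gradient \<Omega> v x) \<partial>\<mu>) = (\<integral>\<^sup>+x. ennreal ((F x *v g x) \<bullet> g x) \<partial>\<mu>)"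
    by (rule nn_integral_cong_AE) (use weak_gradient_AE_eq[OF v] in \<open>auto elim: eventually_mono\<close>)
  have 2: "(\<integral>\<^sup>+x. ennreal (\<bar>v x - f x\<bar> powr t) \<partial>lebesgue_on K) = (\<integral>\<^sup>+x. ennreal (fidelity v x) \<partial>\<mu>)"
  proof -
    have "ennreal (\<bar>v x - f x\<bar> powr t) * indicator K x = ennreal (fidelity v x) * indicator \<Omega> x" for x
      using K(2) by (auto simp: indicator_def)
    then show ?thesis using K(1) sets_Omega by (simp add: nn_integral_restrict_space)
  qed
  have m1: "(\<lambda>x. ennreal ((F x *v g x) \<bullet> g x)) \<in> borel_measurable \<mu>"
    using quad_measurable[OF coefficients_measurable[OF F'] gm] by measurable
  have m2: "(\<lambda>x. ennreal (fidelity v x)) \<in> borel_measurable \<mu>"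
    using fidelity_measurable[OF vm] by measurable
  have "J_functional \<Omega> K t lam \<D> w v f =
      (\<integral>\<^sup>+x. ennreal (1/2) * ennreal ((F x *v g x) \<bullet> g x) + ennreal lam * ennreal (fidelity v x) \<partial>\<mu>)"
    unfolding J_functional_def F_def[symmetric] 1 2 using m1 m2
    by (subst nn_integral_add) (auto simp: nn_integral_cmult)
  also have "\<dots> = (\<integral>\<^sup>+x. ennreal (den F v g x) \<partial>\<mu>)"
  proof (rule nn_integral_cong)
    fix x assume "x \<in> space \<mu>"
    then have x: "x \<in> \<Omega>" by simp
    have "ennreal (1/2) * ennreal ((F x *v g x) \<bullet> g x) = ennreal (((F x *v g x) \<bullet> g x) / 2)"
      using q0[OF x] by (subst ennreal_mult[symmetric]) auto
    moreover have "ennreal lam * ennreal (fidelity v x) = ennreal (lam * (fidelity v x))"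
      using lam by (subst ennreal_mult[symmetric]) auto
    ultimately show "ennreal (1/2) * ennreal ((F x *v g x) \<bullet> g x) + ennreal lam * ennreal (fidelity v x) = ennreal (den F v g x)"
      using q0[OF x] lam by (simp add: den_def ennreal_plus del: ennreal_half)
  qed
  finally show ?thesis by (simp add: F_def)
qed

text \<open>The gradient term is always finite because \<open>F\<close> is bounded and
  \<open>g\<close> square integrable, so the value infinity can stem only from the fidelity
  term.\<close>

lemma finite_energy:
  assumes F: "F \<in> C0_sym_pos \<Omega>" and v: "wgrad v g"
  shows "(\<integral>\<^sup>+x. ennreal (den F v g x) \<partial>\<mu>) = (if admissible v then ennreal (energy F v g) else \<infinity>)"
proof (cases "admissible v")
  case True
  have "(\<integral>\<^sup>+x. ennreal (den F v g x) \<partial>\<mu>) = ennreal (energy F v g)"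
    unfolding energy_def
    by (rule nn_integral_eq_integral[OF den_integrable[OF F has_weak_gradientD(2)[OF v] True]])
       (auto intro!: AE_I2 den_nonneg F)
  then show ?thesis using True by simp
next
  case False
  have vm: "v \<in> borel_measurable \<mu>" and gm: "g \<in> borel_measurable \<mu>"
    using has_weak_gradientD[OF v] L2_measurable by blast+
  have "(\<integral>\<^sup>+x. ennreal (den F v g x) \<partial>\<mu>) = \<infinity>"
  proof (rule ccontr)
    assume "(\<integral>\<^sup>+x. ennreal (den F v g x) \<partial>\<mu>) \<noteq> \<infinity>"
    moreover have "(\<integral>\<^sup>+x. ennreal (norm (den F v g x)) \<partial>\<mu>) = (\<integral>\<^sup>+x. ennreal (den F v g x) \<partial>\<mu>)"
      by (rule nn_integral_cong) (simp add: den_nonneg[OF F])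
    ultimately have "integrable \<mu> (den F v g)"
      using den_measurable[OF F vm gm] by (intro integrableI_bounded) (auto simp: top.not_eq_extremum)
    then have "integrable \<mu> (\<lambda>x. (den F v g x - ((F x *v g x) \<bullet> g x) / 2) / lam)"
      using quad_integrable[OF F has_weak_gradientD(2)[OF v]] by simp
    then show False using False lam by (simp add: den_def admissible_def)
  qed
  then show ?thesis using False by simp
qed

lemma admissible_convex:
  assumes "admissible u" "admissible v" "u \<in> borel_measurable \<mu>" "v \<in> borel_measurable \<mu>"
  shows "admissible (\<lambda>x. (u x + v x) / 2)"
  unfolding admissible_def
proof (rule Bochner_Integration.integrable_bound)
  show "integrable \<mu> (\<lambda>x. (fidelity u x + fidelity v x) / 2)"
    using assms(1,2) by (simp add: admissible_def)
  show "(\<lambda>x. indicator K x * \<bar>(u x + v x) / 2 - f x\<bar> powr t) \<in> borel_measurable \<mu>"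
    by (intro fidelity_measurable borel_measurable_divide borel_measurable_add borel_measurable_const assms)
  have le: "indicator K x * \<bar>(u x + v x) / 2 - f x\<bar> powr t
      \<le> (fidelity u x + fidelity v x) / 2" for x
    using abs_powr_midpoint[of t "u x - f x" "v x - f x"] t
    by (auto simp: field_simps split: split_indicator)
  show "AE x in \<mu>. norm (indicator K x * \<bar>(u x + v x) / 2 - f x\<bar> powr t)
      \<le> norm ((fidelity u x + fidelity v x) / 2)"
    by (intro AE_I2) (simp only: real_norm_def abs_of_nonneg[OF fidelity_nonneg], rule order_trans[OF le abs_ge_self])
qed

text \<open>Uniform convexity in the gradient, from the parallelogram identity.\<close>

lemma den_midpoint:
  "den F (\<lambda>x. (u x + v x) / 2) (\<lambda>x. (1/2) *\<^sub>R (g x + k x)) x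
    \<le> (den F u g x + den F v k x) / 2 - ((F x *v (g x - k x)) \<bullet> (g x - k x)) / 8"
    (is ?le)
  and den_midpoint_strict: "x \<in> K \<Longrightarrow> u x \<noteq> v x \<Longrightarrow>
   den F (\<lambda>x. (u x + v x) / 2) (\<lambda>x. (1/2) *\<^sub>R (g x + k x)) x
    < (den F u g x + den F v k x) / 2 - ((F x *v (g x - k x)) \<bullet> (g x - k x)) / 8"
proof -
  have "indicator K x * \<bar>(u x + v x) / 2 - f x\<bar> powr t
      \<le> (fidelity u x + fidelity v x) / 2"
    using abs_powr_midpoint[of t "u x - f x" "v x - f x"] t
    by (auto simp: field_simps split: split_indicator)
  from mult_left_mono[OF this, of lam] lam show ?le
    unfolding den_def quadratic_form_midpoint by (simp add: field_simps)
  assume x: "x \<in> K" "u x \<noteq> v x"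
  have "(u x + v x) / 2 - f x = ((u x - f x) + (v x - f x)) / 2" by (simp add: field_simps)
  then have "\<bar>(u x + v x) / 2 - f x\<bar> powr t < (\<bar>u x - f x\<bar> powr t + \<bar>v x - f x\<bar> powr t) / 2"
    by (rule ssubst, intro abs_powr_midpoint_strict[OF t]) (use x in simp)
  from mult_strict_left_mono[OF this lam] x
  show "den F (\<lambda>x. (u x + v x) / 2) (\<lambda>x. (1/2) *\<^sub>R (g x + k x)) x
    < (den F u g x + den F v k x) / 2 - ((F x *v (g x - k x)) \<bullet> (g x - k x)) / 8"
    unfolding den_def quadratic_form_midpoint by (simp add: field_simps)
qed

lemma midpoint_weak_gradient:
  assumes "wgrad u g" "wgrad v k"
  shows "wgrad (\<lambda>x. (u x + v x) / 2) (\<lambda>x. (1/2) *\<^sub>R (g x + k x))"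
  using weak_gradient_scaleR[OF weak_gradient_add[OF assms], of "1/2"] by simp

text \<open>The 1/8 is the factor 1/2 in front of the quadratic form times the 1/4 of the
  parallelogram identity; ellipticity then turns the form into a norm.\<close>

lemma energy_midpoint:
  assumes F: "F \<in> C0_sym_pos \<Omega>" and u: "wgrad u g" "admissible u"
    and v: "wgrad v k" "admissible v"
    and el: "\<And>x Q. x \<in> \<Omega> \<Longrightarrow> \<alpha> * (norm Q)\<^sup>2 \<le> (F x *v Q) \<bullet> Q"
  shows "admissible (\<lambda>x. (u x + v x) / 2)"
    and "energy F (\<lambda>x. (u x + v x) / 2) (\<lambda>x. (1/2) *\<^sub>R (g x + k x))
      \<le> (energy F u g + energy F v k) / 2 - \<alpha> / 8 * (l2norm \<mu> (\<lambda>x. g x - k x))\<^sup>2"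
proof -
  note U = has_weak_gradientD[OF u(1)] and V = has_weak_gradientD[OF v(1)]
  show a: "admissible (\<lambda>x. (u x + v x) / 2)"
    using u v U V L2_measurable by (intro admissible_convex) auto
  have d: "(\<lambda>x. g x - k x) \<in> L2 \<mu>" by (intro L2_diff U V)
  have i: "integrable \<mu> (\<lambda>x. (den F u g x + den F v k x) / 2)"
    using den_integrable[OF F U(2) u(2)] den_integrable[OF F V(2) v(2)] by simp
  have j: "integrable \<mu> (\<lambda>x. \<alpha> / 8 * (norm (g x - k x))\<^sup>2)" using L2_integrable[OF d] by simp
  have "energy F (\<lambda>x. (u x + v x) / 2) (\<lambda>x. (1/2) *\<^sub>R (g x + k x))
      \<le> (\<integral>x. (den F u g x + den F v k x) / 2 - \<alpha> / 8 * (norm (g x - k x))\<^sup>2 \<partial>\<mu>)"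
    unfolding energy_def
  proof (rule integral_mono)
    show "integrable \<mu> (den F (\<lambda>x. (u x + v x) / 2) (\<lambda>x. (1/2) *\<^sub>R (g x + k x)))"
      by (rule den_integrable[OF F has_weak_gradientD(2)[OF midpoint_weak_gradient[OF u(1) v(1)]] a])
    show "integrable \<mu> (\<lambda>x. (den F u g x + den F v k x) / 2 - \<alpha> / 8 * (norm (g x - k x))\<^sup>2)"
      using i j by simp
    show "den F (\<lambda>x. (u x + v x) / 2) (\<lambda>x. (1/2) *\<^sub>R (g x + k x)) x
        \<le> (den F u g x + den F v k x) / 2 - \<alpha> / 8 * (norm (g x - k x))\<^sup>2" if "x \<in> space \<mu>" for x
      using den_midpoint[of F u v g k x] el[of x "g x - k x"] that by simp
  qed
  also have "\<dots> = (energy F u g + energy F v k) / 2 - \<alpha> / 8 * (l2norm \<mu> (\<lambda>x. g x - k x))\<^sup>2"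
    using i j den_integrable[OF F U(2) u(2)] den_integrable[OF F V(2) v(2)]
    by (simp add: energy_def l2norm_sq)
  finally show "energy F (\<lambda>x. (u x + v x) / 2) (\<lambda>x. (1/2) *\<^sub>R (g x + k x))
      \<le> (energy F u g + energy F v k) / 2 - \<alpha> / 8 * (l2norm \<mu> (\<lambda>x. g x - k x))\<^sup>2" .
qed

lemma integrable_on_K:
  assumes "wgrad v g" "S \<subseteq> K" "S \<in> sets lebesgue"
  shows "integrable (lebesgue_on S) v"
proof -
  have S: "S \<in> lmeasurable" by (rule fmeasurableI2[OF KOm assms(2,3)])
  show ?thesis
    using L2_imp_L1(1)[OF finite_measure_lebesgue_on[OF S] has_weak_gradient_L2[OF assms(1)]] assms K(2) by auto
qed

lemma fidelity_le_energy:
  assumes F: "F \<in> C0_sym_pos \<Omega>" and v: "wgrad v g" "admissible v"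
  shows "lam * (\<integral>x. fidelity v x \<partial>\<mu>) \<le> energy F v g"
    and "(\<integral>x. (F x *v g x) \<bullet> g x \<partial>\<mu>) / 2 \<le> energy F v g"
proof -
  have "0 \<le> (\<integral>x. (F x *v g x) \<bullet> g x \<partial>\<mu>)"
    by (intro integral_nonneg_AE AE_I2) (simp add: quad_nonneg[OF F])
  moreover have "0 \<le> (\<integral>x. fidelity v x \<partial>\<mu>)" by (intro integral_nonneg_AE AE_I2) auto
  ultimately show "lam * (\<integral>x. fidelity v x \<partial>\<mu>) \<le> energy F v g"
    "(\<integral>x. (F x *v g x) \<bullet> g x \<partial>\<mu>) / 2 \<le> energy F v g"
    using energy_eq[OF F has_weak_gradientD(2)[OF v(1)] v(2)] lam by auto
qed

text \<open>On \<open>K\<close> the value of \<open>v\<close> is split into v - f and f, and each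
  part is bounded by 1 plus its t-th power; the two ones integrate to twice the measure of
  \<open>\<Omega>\<close>.\<close>

lemma mean_bound:
  assumes F: "F \<in> C0_sym_pos \<Omega>" and v: "wgrad v g" "admissible v" and S: "S \<subseteq> K" "S \<in> sets lebesgue"
  shows "\<bar>\<integral>x. v x \<partial>lebesgue_on S\<bar> \<le> 2 * measure lebesgue \<Omega> + energy F v g / lam + (\<integral>x. power_K f x \<partial>\<mu>)"
proof -
  let ?h = "\<lambda>x. 2 + fidelity v x + power_K f x"
  have hi: "integrable \<mu> ?h"
    using v(2) unfolding admissible_def
    by (intro Bochner_Integration.integrable_add f_powr_integrable finite_measure.integrable_const[OF finite_mu])
  have pw: "\<bar>y\<bar> \<le> 1 + \<bar>y\<bar> powr t" for y :: real
  proof (cases "\<bar>y\<bar> \<le> 1")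
    case False
    then have "\<bar>y\<bar> powr 1 \<le> \<bar>y\<bar> powr t" using t by (intro powr_mono) auto
    then show ?thesis using False by simp
  qed (simp add: add_increasing2)
  have le: "\<bar>v x\<bar> \<le> ?h x" if "x \<in> K" for x
    using pw[of "v x - f x"] pw[of "f x"] that by simp
  have SO: "S \<subseteq> \<Omega>" using S K by auto
  have "\<bar>\<integral>x. v x \<partial>lebesgue_on S\<bar> \<le> (\<integral>x. \<bar>v x\<bar> \<partial>lebesgue_on S)"
    using integral_norm_bound[of "lebesgue_on S" v] by (simp only: real_norm_def)
  also have "\<dots> = (\<integral>x. indicator S x * \<bar>v x\<bar> \<partial>\<mu>)"
  proof -
    have "(\<lambda>x. indicator \<Omega> x * (indicator S x * \<bar>v x\<bar>)) = (\<lambda>x. indicator S x * \<bar>v x\<bar>)"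
    proof (rule ext)
      show "indicator \<Omega> x * (indicator S x * \<bar>v x\<bar>) = indicator S x * \<bar>v x\<bar>" for x
        using SO by (cases "x \<in> S") auto
    qed
    then show ?thesis using S sets_Omega by (simp add: integral_restrict_space)
  qed
  also have "\<dots> \<le> (\<integral>x. ?h x \<partial>\<mu>)"
  proof (rule integral_mono)
    show "integrable \<mu> (\<lambda>x. indicator S x * \<bar>v x\<bar>)"
    proof -
      have "integrable \<mu> (\<lambda>x. \<bar>v x\<bar>)"
        using L2_imp_L1(1)[OF finite_mu has_weak_gradientD(1)[OF v(1)]] by simp
      moreover have "S \<inter> \<Omega> \<in> sets \<mu>" using S sets_Omega SO
        by (subst sets_restrict_space_iff) (auto simp: Int_absorb2)
      ultimately have "integrable \<mu> (\<lambda>x. indicator (S \<inter> \<Omega>) x *\<^sub>R \<bar>v x\<bar>)" by (intro integrable_mult_indicator)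
      then show ?thesis using SO by (simp add: Int_absorb2)
    qed
    show "integrable \<mu> ?h" by (rule hi)
    show "indicator S x * \<bar>v x\<bar> \<le> ?h x" if "x \<in> space \<mu>" for x
      using le[of x] S(1) by (cases "x \<in> S") (auto simp: add_nonneg_nonneg)
  qed
  also have "\<dots> = 2 * measure lebesgue \<Omega> + (\<integral>x. fidelity v x \<partial>\<mu>) + (\<integral>x. power_K f x \<partial>\<mu>)"
    using v(2) f_powr_integrable finite_measure.integrable_const[OF finite_mu, of "2::real"] sets_Omega
    by (simp add: admissible_def measure_restrict_space)
  also have "\<dots> \<le> 2 * measure lebesgue \<Omega> + energy F v g / lam + (\<integral>x. power_K f x \<partial>\<mu>)"
    using fidelity_le_energy(1)[OF F v] lam by (simp add: pos_le_divide_eq mult.commute)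
  finally show ?thesis .
qed

text \<open>The parallelogram identity makes the gradients of a minimizing sequence Cauchy. By the Poincare
  inequality only the integral over \<open>S\<close>, a bounded sequence of reals, has to be made convergent
  by passing to a subsequence; no weak compactness is needed.\<close>

theorem minimizing_sequence:
  assumes F: "F \<in> C0_sym_pos \<Omega>"
    and v: "\<And>n::nat. wgrad (v n) (g n)" "\<And>n. admissible (v n)"
    and lim: "(\<lambda>n. energy F (v n) (g n)) \<longlonglongrightarrow> m"
    and m: "\<And>u k. wgrad u k \<Longrightarrow> admissible u \<Longrightarrow> m \<le> energy F u k"
  obtains r w k where "strict_mono (r :: nat \<Rightarrow> nat)" "is_min F w k" "energy F w k = m"
    "(\<lambda>n. l2norm \<mu> (\<lambda>x. v (r n) x - w x)) \<longlonglongrightarrow> 0" "(\<lambda>n. l2norm \<mu> (\<lambda>x. g (r n) x - k x)) \<longlonglongrightarrow> 0"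
proof -
  obtain \<alpha> where al: "\<alpha> > 0" "\<And>x Q. x \<in> \<Omega> \<Longrightarrow> \<alpha> * (norm Q)\<^sup>2 \<le> (F x *v Q) \<bullet> Q"
    by (rule elliptic[OF F]) (rule that)
  obtain S C where S: "S \<subseteq> K" "S \<in> sets lebesgue" "C \<ge> 0" and poinc:
    "\<And>u g. wgrad u g \<Longrightarrow>
       (l2norm \<mu> u)\<^sup>2 \<le> C * ((l2norm \<mu> g)\<^sup>2 + (\<integral>x. u x \<partial>lebesgue_on S)\<^sup>2)"
    by (rule poincare) (rule that)
  note V = has_weak_gradientD[OF v(1)]
  define E where "E n = energy F (v n) (g n)" for n
  \<comment> \<open>The midpoint of two members of the sequence is a competitor, so its energy is at
    least m, and the convexity gap is bounded by the two excess energies.\<close>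
  have gest: "(l2norm \<mu> (\<lambda>x. g i x - g j x))\<^sup>2 \<le> 4 / \<alpha> * ((E i - m) + (E j - m))" for i j
  proof -
    have "m \<le> (E i + E j) / 2 - \<alpha> / 8 * (l2norm \<mu> (\<lambda>x. g i x - g j x))\<^sup>2"
      using energy_midpoint[OF F v(1)[of i] v(2)[of i] v(1)[of j] v(2)[of j] al(2)]
        m[OF midpoint_weak_gradient[OF v(1)[of i] v(1)[of j]]] unfolding E_def by linarith
    then show ?thesis using al(1) by (simp add: field_simps)
  qed
  define s where "s n = (\<integral>x. v n x \<partial>lebesgue_on S)" for n
  have "bounded (range s)"
  proof -
    have "Bseq E" using lim unfolding E_def by (intro convergent_imp_Bseq convergentI)
    then obtain b where b: "\<And>n. \<bar>E n\<bar> \<le> b" by (auto simp: Bseq_def)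
    have "\<bar>s n\<bar> \<le> 2 * measure lebesgue \<Omega> + b / lam + (\<integral>x. power_K f x \<partial>\<mu>)" for n
    proof -
      have "E n / lam \<le> b / lam" using b[of n] lam by (intro divide_right_mono) auto
      then show ?thesis using mean_bound[OF F v(1)[of n] v(2)[of n] S(1,2)] unfolding s_def E_def by linarith
    qed
    then show ?thesis by (auto simp: bounded_iff)
  qed
  then obtain r l where r: "strict_mono (r :: nat \<Rightarrow> nat)" "(s \<circ> r) \<longlonglongrightarrow> l"
    using bounded_imp_convergent_subsequence by blast
  have Elim: "(\<lambda>n. E (r n) - m) \<longlonglongrightarrow> 0"
    using LIMSEQ_subseq_LIMSEQ[OF lim r(1)] by (simp add: E_def o_def LIM_zero)
  have E0: "0 \<le> E n - m" for n using m[OF v(1) v(2)] by (simp add: E_def)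
  have gC: "\<exists>N. \<forall>i\<ge>N. \<forall>j\<ge>N. l2norm \<mu> (\<lambda>x. g (r i) x - g (r j) x) < e" if e: "e > 0" for e
  proof -
    have "0 < e\<^sup>2 * \<alpha> / 8" using e al by simp
    from LIMSEQ_D[OF Elim this] obtain N where "\<And>n. n \<ge> N \<Longrightarrow> norm (E (r n) - m - 0) < e\<^sup>2 * \<alpha> / 8" by blast
    then have N: "\<And>n. n \<ge> N \<Longrightarrow> E (r n) - m < e\<^sup>2 * \<alpha> / 8" by (smt (verit) real_norm_def)
    have "l2norm \<mu> (\<lambda>x. g (r i) x - g (r j) x) < e" if "i \<ge> N" "j \<ge> N" for i j
    proof -
      have "(E (r i) - m) + (E (r j) - m) < e\<^sup>2 * \<alpha> / 4" using N[OF that(1)] N[OF that(2)] by simp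
      then have "4 / \<alpha> * ((E (r i) - m) + (E (r j) - m)) < e\<^sup>2" using al(1) by (simp add: field_simps)
      then have "(l2norm \<mu> (\<lambda>x. g (r i) x - g (r j) x))\<^sup>2 < e\<^sup>2" using gest[of "r i" "r j"] by linarith
      then show ?thesis using e by (simp add: power2_less_imp_less)
    qed
    then show ?thesis by blast
  qed
  have vC: "\<exists>N. \<forall>i\<ge>N. \<forall>j\<ge>N. l2norm \<mu> (\<lambda>x. v (r i) x - v (r j) x) < e" if e: "e > 0" for e
  proof -
    \<comment> \<open>Chosen so that the bound C (d^2 + d^2) of the Poincare inequality stays below
      e^2; the extra 1 covers C = 0.\<close>
    define d where "d = e / sqrt (2 * C + 1)"
    have d: "d > 0" using e S(3) by (simp add: d_def)
    obtain N1 where N1: "\<And>i j. i \<ge> N1 \<Longrightarrow> j \<ge> N1 \<Longrightarrow> l2norm \<mu> (\<lambda>x. g (r i) x - g (r j) x) < d"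
      using gC[OF d] by blast
    have "Cauchy (s \<circ> r)" using r(2) by (intro LIMSEQ_imp_Cauchy)
    then obtain N2 where N2: "\<And>i j. i \<ge> N2 \<Longrightarrow> j \<ge> N2 \<Longrightarrow> \<bar>s (r i) - s (r j)\<bar> < d"
      using d unfolding Cauchy_def dist_real_def by fastforce
    have "l2norm \<mu> (\<lambda>x. v (r i) x - v (r j) x) < e" if "i \<ge> max N1 N2" "j \<ge> max N1 N2" for i j
    proof -
      have "(\<integral>x. v (r i) x - v (r j) x \<partial>lebesgue_on S) = s (r i) - s (r j)"
        unfolding s_def by (intro Bochner_Integration.integral_diff integrable_on_K[OF v(1) S(1,2)])
      then have "(l2norm \<mu> (\<lambda>x. v (r i) x - v (r j) x))\<^sup>2
          \<le> C * ((l2norm \<mu> (\<lambda>x. g (r i) x - g (r j) x))\<^sup>2 + (s (r i) - s (r j))\<^sup>2)"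
        using poinc[OF weak_gradient_diff[OF v(1)[of "r i"] v(1)[of "r j"]]] by simp
      also have "\<dots> \<le> C * (d\<^sup>2 + d\<^sup>2)"
      proof (intro mult_left_mono add_mono)
        show "(l2norm \<mu> (\<lambda>x. g (r i) x - g (r j) x))\<^sup>2 \<le> d\<^sup>2"
          using N1[of i j] that by (intro power_mono) (auto simp: l2norm_nonneg)
        show "(s (r i) - s (r j))\<^sup>2 \<le> d\<^sup>2"
          using N2[of i j] that d abs_le_square_iff[of "s (r i) - s (r j)" d] by auto
      qed (rule S(3))
      also have "\<dots> < (2 * C + 1) * d\<^sup>2" using d by (simp add: algebra_simps)
      also have "\<dots> = e\<^sup>2" using S(3) by (simp add: d_def power_divide)
      finally show ?thesis using e by (simp add: power2_less_imp_less)
    qed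
    then show ?thesis by blast
  qed
  obtain k where k: "k \<in> L2 \<mu>" "(\<lambda>n. l2norm \<mu> (\<lambda>x. g (r n) x - k x)) \<longlonglongrightarrow> 0"
    by (rule L2_complete[OF finite_mu V(2) gC], assumption, rule that)
  obtain w where w: "w \<in> L2 \<mu>" "(\<lambda>n. l2norm \<mu> (\<lambda>x. v (r n) x - w x)) \<longlonglongrightarrow> 0"
    by (rule L2_complete[OF finite_mu V(1) vC], assumption, rule that)
  have wk: "wgrad w k" by (rule weak_gradient_limit[OF v(1) w k])
  \<comment> \<open>The further subsequences serve only to have pointwise convergence almost
    everywhere for Fatou's lemma; the convergence asserted in the end is along r.\<close>
  obtain p where p: "strict_mono (p :: nat \<Rightarrow> nat)" "AE x in \<mu>. (\<lambda>n. v (r (p n)) x) \<longlonglongrightarrow> w x"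
    by (rule L2_tendsto_AE_subseq[OF finite_mu V(1) w]) (rule that)
  have kp: "(\<lambda>n. l2norm \<mu> (\<lambda>x. g (r (p n)) x - k x)) \<longlonglongrightarrow> 0"
    using LIMSEQ_subseq_LIMSEQ[OF k(2) p(1)] by (simp add: o_def)
  obtain q where q: "strict_mono (q :: nat \<Rightarrow> nat)" "AE x in \<mu>. (\<lambda>n. g (r (p (q n))) x) \<longlonglongrightarrow> k x"
    by (rule L2_tendsto_AE_subseq[OF finite_mu V(2) k(1) kp]) (rule that)
  define c where "c n = r (p (q n))" for n
  have sc: "strict_mono c" unfolding c_def using r(1) p(1) q(1) by (simp add: strict_mono_def)
  have AE: "AE x in \<mu>. (\<lambda>n. ennreal (den F (v (c n)) (g (c n)) x)) \<longlonglongrightarrow> ennreal (den F w k x)"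
    using p(2) q(2)
  proof eventually_elim
    case (elim x)
    have "(\<lambda>n. v (c n) x) \<longlonglongrightarrow> w x"
      using LIMSEQ_subseq_LIMSEQ[OF elim(1) q(1)] by (simp add: o_def c_def)
    then have 1: "(\<lambda>n. \<bar>v (c n) x - f x\<bar> powr t) \<longlonglongrightarrow> \<bar>w x - f x\<bar> powr t"
      using t by (intro tendsto_powr' tendsto_intros) auto
    have "(\<lambda>n. (F x, g (c n) x)) \<longlonglongrightarrow> (F x, k x)"
      using elim(2) by (auto simp: c_def intro!: tendsto_intros)
    then have 2: "(\<lambda>n. (F x *v g (c n) x) \<bullet> g (c n) x) \<longlonglongrightarrow> (F x *v k x) \<bullet> k x"
      using continuous_on_tendsto_compose[OF continuous_quadratic_form] by fastforce
    then show ?case unfolding den_def 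
      by (intro tendsto_ennrealI tendsto_add tendsto_divide[OF 2] tendsto_mult tendsto_const 1) simp
  qed
  have Ec: "(\<lambda>n. ennreal (E (c n))) \<longlonglongrightarrow> ennreal m"
    using LIMSEQ_subseq_LIMSEQ[OF lim sc] by (intro tendsto_ennrealI) (simp add: E_def o_def)
  have "(\<integral>\<^sup>+x. ennreal (den F w k x) \<partial>\<mu>) = (\<integral>\<^sup>+x. liminf (\<lambda>n. ennreal (den F (v (c n)) (g (c n)) x)) \<partial>\<mu>)"
    by (rule nn_integral_cong_AE, use AE in eventually_elim)
       (rule lim_imp_Liminf[OF sequentially_bot, symmetric])
  also have "\<dots> \<le> liminf (\<lambda>n. \<integral>\<^sup>+x. ennreal (den F (v (c n)) (g (c n)) x) \<partial>\<mu>)"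
    using den_measurable[OF F L2_measurable[OF V(1)] L2_measurable[OF V(2)]]
    by (intro nn_integral_liminf) measurable
  also have "(\<lambda>n. \<integral>\<^sup>+x. ennreal (den F (v (c n)) (g (c n)) x) \<partial>\<mu>) = (\<lambda>n. ennreal (E (c n)))"
    using finite_energy[OF F v(1)] v(2) by (simp add: E_def)
  also have "liminf (\<lambda>n. ennreal (E (c n))) = ennreal m"
    using lim_imp_Liminf[OF _ Ec] by simp
  finally have fin: "(\<integral>\<^sup>+x. ennreal (den F w k x) \<partial>\<mu>) \<le> ennreal m" .
  \<comment> \<open>Admissibility of the limit is not inherited from L^2 convergence; it follows
    because Fatou's lemma gives a finite value.\<close>
  then have adm: "admissible w" using finite_energy[OF F wk] by (auto split: if_splits simp: top_unique)
  have m0: "0 \<le> m" by (rule LIMSEQ_le_const[OF lim]) (auto intro: energy_nonneg[OF F])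
  have "energy F w k \<le> m" using fin finite_energy[OF F wk] adm m0 by simp
  then have eq: "energy F w k = m" using m[OF wk adm] by simp
  have "is_min F w k" unfolding is_min_def using wk adm eq m by auto
  then show ?thesis using that r(1) eq w(2) k(2) by blast
qed

end


subsection \<open>Dependence on the coefficients and the fixed point\<close>

context data_functional
begin

lemma energy_0: "energy F (\<lambda>x. 0) (\<lambda>x. 0) = lam * (\<integral>x. power_K f x \<partial>\<mu>)"
  by (simp add: energy_def den_def)

lemma is_min_le_0: "is_min F v g \<Longrightarrow> energy F v g \<le> energy F (\<lambda>x. 0) (\<lambda>x. 0)"
  using weak_gradient_zero admissible_0 by (simp add: is_min_def)

lemma is_min_exists:
  assumes F: "F \<in> C0_sym_pos \<Omega>"
  obtains w k where "is_min F w k"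
proof -
  define X where "X = {energy F u k | u k. wgrad u k \<and> admissible u}"
  have bdd: "bdd_below X" by (rule bdd_belowI[of _ 0]) (auto simp: X_def energy_nonneg[OF F])
  have ne: "X \<noteq> {}" using weak_gradient_zero admissible_0 by (auto simp: X_def)
  have "\<exists>u k. wgrad u k \<and> admissible u \<and> energy F u k < Inf X + 1 / real (Suc n)" for n
    using cInf_lessD[OF ne, of "Inf X + 1 / real (Suc n)"] by (auto simp: X_def)
  then obtain v g where v: "\<And>n. wgrad (v n) (g n)" "\<And>n. admissible (v n)"
    "\<And>n. energy F (v n) (g n) < Inf X + 1 / real (Suc n)" by metis
  have m: "Inf X \<le> energy F u k" if "wgrad u k" "admissible u" for u k
    using that by (intro cInf_lower[OF _ bdd]) (auto simp: X_def)
  have "(\<lambda>n. energy F (v n) (g n)) \<longlonglongrightarrow> Inf X"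
  proof (rule tendsto_sandwich[where f="\<lambda>_. Inf X"])
    show "(\<lambda>n. Inf X + 1 / real (Suc n)) \<longlonglongrightarrow> Inf X"
      using LIMSEQ_inverse_real_of_nat_add[of "Inf X"] by (simp add: inverse_eq_divide)
  qed (use v m in \<open>auto intro!: always_eventually less_imp_le\<close>)
  from minimizing_sequence[OF F v(1,2) this m] that show ?thesis by blast
qed

text \<open>The midpoint of two minimizers has no smaller energy. The quadratic gap then forces
  equal gradients, and strict convexity of the t-th power forces equality almost everywhere on
  \<open>K\<close>. The difference has gradient 0 and integral 0 over \<open>S\<close>, so it
  vanishes by the Poincare inequality.\<close>

lemma is_min_unique:
  assumes F: "F \<in> C0_sym_pos \<Omega>" and v: "is_min F v g" and w: "is_min F w k"
  shows "AE x in \<mu>. v x = w x"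
proof -
  obtain \<alpha> where al: "\<alpha> > 0" "\<And>x Q. x \<in> \<Omega> \<Longrightarrow> \<alpha> * (norm Q)\<^sup>2 \<le> (F x *v Q) \<bullet> Q"
    by (rule elliptic[OF F]) (rule that)
  obtain S C where S: "S \<subseteq> K" "S \<in> sets lebesgue" "C \<ge> 0" and poinc:
    "\<And>u g. wgrad u g \<Longrightarrow>
       (l2norm \<mu> u)\<^sup>2 \<le> C * ((l2norm \<mu> g)\<^sup>2 + (\<integral>x. u x \<partial>lebesgue_on S)\<^sup>2)"
    by (rule poincare) (rule that)
  have V: "wgrad v g" "admissible v" and W: "wgrad w k" "admissible w"
    using v w by (auto simp: is_min_def)
  have eq: "energy F v g = energy F w k" using v w by (auto simp: is_min_def intro: antisym)
  let ?u = "\<lambda>x. (v x + w x) / 2" and ?l = "\<lambda>x. (1/2) *\<^sub>R (g x + k x)"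
  have mid: "admissible ?u" "energy F ?u ?l \<le> (energy F v g + energy F w k) / 2 - \<alpha> / 8 * (l2norm \<mu> (\<lambda>x. g x - k x))\<^sup>2"
    using energy_midpoint[OF F V W, of \<alpha>] al(2) by blast+
  have gu: "wgrad ?u ?l" by (rule midpoint_weak_gradient[OF V(1) W(1)])
  have mu: "energy F v g \<le> energy F ?u ?l" using v gu mid(1) by (auto simp: is_min_def)
  have "\<alpha> / 8 * (l2norm \<mu> (\<lambda>x. g x - k x))\<^sup>2 \<le> 0"
  proof -
    have "q \<le> 0" if "E \<le> (a + b) / 2 - q" "a \<le> E" "a = b" for a b E q :: real using that by simp
    then show ?thesis using mid(2) mu eq by blast
  qed
  then have g0: "(l2norm \<mu> (\<lambda>x. g x - k x))\<^sup>2 = 0"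
    using al(1) by (simp add: mult_le_0_iff)
  \<comment> \<open>The convexity defect: nonnegative on \<open>\<Omega>\<close>, positive at points
    of \<open>K\<close> where v and w differ, and of integral at most 0 by minimality.\<close>
  define h where "h x = (den F v g x + den F w k x) / 2 - den F ?u ?l x" for x
  have iv: "integrable \<mu> (den F v g)" and iw: "integrable \<mu> (den F w k)" and iu: "integrable \<mu> (den F ?u ?l)"
    using den_integrable[OF F] has_weak_gradientD(2) V W gu mid(1) by blast+
  have q0: "0 \<le> (F x *v (g x - k x)) \<bullet> (g x - k x)" if "x \<in> \<Omega>" for x
    using al(2)[OF that, of "g x - k x"] al(1) by (smt (verit) mult_nonneg_nonneg zero_le_power2)
  have h0: "0 \<le> h x" if "x \<in> \<Omega>" for x
    using den_midpoint[of F v w g k x] q0[OF that] unfolding h_def by linarith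
  have hpos: "0 < h x" if "x \<in> K" "v x \<noteq> w x" for x
  proof -
    have "x \<in> \<Omega>" using that(1) K(2) by blast
    then show ?thesis using den_midpoint_strict[of x v w F g k, OF that] q0[of x] unfolding h_def by linarith
  qed
  have ih: "integrable \<mu> h" unfolding h_def using iv iw iu by simp
  have "(\<integral>x. h x \<partial>\<mu>) = (energy F v g + energy F w k) / 2 - energy F ?u ?l"
    unfolding h_def energy_def using iv iw iu by simp
  then have "(\<integral>x. h x \<partial>\<mu>) \<le> 0" using mu eq by simp
  moreover have hAE: "AE x in \<mu>. 0 \<le> h x" by (intro AE_I2) (simp add: h0)
  ultimately have "(\<integral>x. h x \<partial>\<mu>) = 0" using integral_nonneg_AE[OF hAE] by linarith
  then have "AE x in \<mu>. h x = 0" using integral_nonneg_eq_0_iff_AE[OF ih hAE] by simp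
  then have "AE x in lebesgue. x \<in> \<Omega> \<longrightarrow> h x = 0"
    using sets_Omega by (subst (asm) AE_restrict_space_iff) auto
  then have "AE x in lebesgue. x \<in> S \<longrightarrow> v x - w x = 0"
  proof eventually_elim
    case (elim x)
    then show ?case using hpos[of x] S(1) K(2) by force
  qed
  then have "AE x in lebesgue_on S. v x - w x = 0"
    using S(2) by (subst AE_restrict_space_iff) auto
  then have "(\<integral>x. v x - w x \<partial>lebesgue_on S) = 0" by (rule integral_eq_zero_AE)
  then have "(l2norm \<mu> (\<lambda>x. v x - w x))\<^sup>2 \<le> 0"
    using poinc[OF weak_gradient_diff[OF V(1) W(1)]] g0 by simp
  then have "l2norm \<mu> (\<lambda>x. v x - w x) = 0" by simp
  from L2_AE_zero[OF has_weak_gradientD(1)[OF weak_gradient_diff[OF V(1) W(1)]] this]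
  show ?thesis by simp
qed

text \<open>Since 0 is admissible, a minimizer of the functional has a finite value and is therefore
  admissible; conversely, functions that are not admissible have the value infinity and cannot
  compete.\<close>

lemma is_arg_min_iff:
  assumes F: "\<D> w \<in> C0_sym_pos \<Omega>"
  shows "is_arg_min (\<lambda>v. J_functional \<Omega> K t lam \<D> w v f) (\<lambda>u. u \<in> W12 \<Omega>) v \<longleftrightarrow> (\<exists>g. is_min (\<D> w) v g)"
proof -
  define F where "F = \<D> w"
  have F': "F \<in> C0_sym_pos \<Omega>" using F by (simp add: F_def)
  define J where "J v = J_functional \<Omega> K t lam \<D> w v f" for v
  have J: "J u = (if admissible u then ennreal (energy F u k) else \<infinity>)" if "wgrad u k" for u k
    using J_functional_eq[of \<D> w, OF F that] finite_energy[OF F' that] by (simp add: J_def F_def)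
  have "is_arg_min J (\<lambda>u. u \<in> W12 \<Omega>) v \<longleftrightarrow> (\<exists>g. is_min F v g)"
  proof
    assume v: "is_arg_min J (\<lambda>u. u \<in> W12 \<Omega>) v"
    then obtain g where g: "wgrad v g" by (auto simp: is_arg_min_linorder W12_def)
    have le: "J v \<le> J u" if "wgrad u k" for u k
      using v that by (auto simp: is_arg_min_linorder W12_def)
    have "J v \<noteq> \<infinity>" using le[OF weak_gradient_zero] J[OF weak_gradient_zero] admissible_0
      by (auto simp: top_unique)
    then have a: "admissible v" using J[OF g] by (auto split: if_splits)
    have "energy F v g \<le> energy F u k" if "wgrad u k" "admissible u" for u k
      using le[OF that(1)] J[OF g] J[OF that(1)] a that(2) energy_nonneg[OF F', of u k] by simp
    then show "\<exists>g. is_min F v g" using g a by (auto simp: is_min_def)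
  next
    assume "\<exists>g. is_min F v g"
    then obtain g where g: "wgrad v g" "admissible v"
      "\<And>u k. wgrad u k \<Longrightarrow> admissible u \<Longrightarrow> energy F v g \<le> energy F u k"
      by (auto simp: is_min_def)
    have "J v \<le> J u" if u: "u \<in> W12 \<Omega>" for u
    proof -
      obtain k where k: "wgrad u k" using u weak_gradient_works by blast
      show ?thesis using J[OF g(1)] J[OF k] g(2) g(3)[OF k] by (auto intro: ennreal_leI)
    qed
    then show "is_arg_min J (\<lambda>u. u \<in> W12 \<Omega>) v" using g(1) by (auto simp: is_arg_min_linorder W12_def)
  qed
  then show ?thesis by (simp add: F_def J_def[abs_def])
qed

lemma exists_unique_minimizer:
  assumes F: "\<D> w \<in> C0_sym_pos \<Omega>"
  shows "\<exists>v. is_unique_minimizer \<Omega> (\<lambda>v. J_functional \<Omega> K t lam \<D> w v f) v"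
proof -
  obtain v k where v: "is_min (\<D> w) v k" by (rule is_min_exists[OF F])
  have "ae_eq \<Omega> v' v" if "is_min (\<D> w) v' g" for v' g
    unfolding ae_eq_def by (rule is_min_unique[OF F that v])
  then show ?thesis using v unfolding is_unique_minimizer_def is_arg_min_iff[of \<D> w, OF F] by blast
qed

lemma f_integral_nonneg: "0 \<le> (\<integral>x. power_K f x \<partial>\<mu>)"
  by (intro integral_nonneg_AE AE_I2) simp

lemma Lp_norm_K: "Lp_norm t K v = (\<integral>x. power_K v x \<partial>\<mu>) powr (1 / t)" for v :: "real^2 \<Rightarrow> real"
  by (simp add: Lp_norm_def integral_on_K)

lemma Lp_K:
  assumes "v \<in> L2 \<mu>"
  shows "v \<in> Lp t K \<longleftrightarrow> integrable \<mu> (\<lambda>x. power_K v x)"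
proof -
  have "v \<in> borel_measurable (lebesgue_on K)"
    using L2_measurable[OF L2_subset[OF assms K(2,1) sets_Omega]] .
  then show ?thesis by (simp add: Lp_def integral_on_K)
qed

lemma powr_sum_le:
  fixes a b :: real
  shows "\<bar>a + b\<bar> powr t \<le> 2 powr t * ((\<bar>a\<bar> powr t + \<bar>b\<bar> powr t) / 2)"
proof -
  have "\<bar>a + b\<bar> powr t = 2 powr t * \<bar>(a + b) / 2\<bar> powr t"
    using powr_mult[of 2 "\<bar>(a + b) / 2\<bar>" t] by simp
  also have "\<dots> \<le> 2 powr t * ((\<bar>a\<bar> powr t + \<bar>b\<bar> powr t) / 2)"
    using t by (intro mult_left_mono abs_powr_midpoint) auto
  finally show ?thesis .
qed

text \<open>Comparison with 0 bounds the integral of |v - f|^t over \<open>K\<close> by that of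
  |f|^t. Midpoint convexity bounds |v|^t by 2^t times the mean of |v - f|^t and |f|^t, and the t-th
  root leaves the factor 2.\<close>

lemma is_min_in_ball:
  assumes F: "F \<in> C0_sym_pos \<Omega>" and v: "is_min F v g"
  shows "v \<in> Lp t K" and "Lp_norm t K v \<le> 2 * Lp_norm t K f"
proof -
  have V: "wgrad v g" "admissible v" using v by (auto simp: is_min_def)
  note vL = has_weak_gradientD(1)[OF V(1)]
  define c where "c = (\<integral>x. power_K f x \<partial>\<mu>)"
  have c0: "0 \<le> c" unfolding c_def by (rule f_integral_nonneg)
  have "lam * (\<integral>x. fidelity v x \<partial>\<mu>) \<le> lam * c"
    using order_trans[OF fidelity_le_energy(1)[OF F V] is_min_le_0[OF v]] by (simp add: c_def energy_0)
  then have fid: "(\<integral>x. fidelity v x \<partial>\<mu>) \<le> c" using lam by simp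
  let ?b = "\<lambda>x. 2 powr t * ((fidelity v x + power_K f x) / 2)"
  have ib: "integrable \<mu> ?b" using V(2) f_powr_integrable by (simp add: admissible_def)
  have le: "power_K v x \<le> ?b x" for x
    using powr_sum_le[of "v x - f x" "f x"] by (cases "x \<in> K") auto
  have iv: "integrable \<mu> (\<lambda>x. power_K v x)"
  proof (rule Bochner_Integration.integrable_bound[OF ib])
    show "(\<lambda>x. power_K v x) \<in> borel_measurable \<mu>"
      using indicator_K_measurable L2_measurable[OF vL] by measurable
    show "AE x in \<mu>. norm (power_K v x) \<le> norm (?b x)"
      by (intro AE_I2) (simp only: real_norm_def abs_of_nonneg[OF fidelity_nonneg], rule order_trans[OF le abs_ge_self])
  qed
  then show "v \<in> Lp t K" using Lp_K[OF vL] by simp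
  have "(\<integral>x. power_K v x \<partial>\<mu>) \<le> (\<integral>x. ?b x \<partial>\<mu>)"
    by (intro integral_mono iv ib le)
  also have "\<dots> = 2 powr t * (((\<integral>x. fidelity v x \<partial>\<mu>) + c) / 2)"
    using V(2) f_powr_integrable by (simp add: admissible_def c_def)
  also have "\<dots> \<le> 2 powr t * c" using fid by (intro mult_left_mono) auto
  finally have "(\<integral>x. power_K v x \<partial>\<mu>) powr (1 / t) \<le> (2 powr t * c) powr (1 / t)"
    using t by (intro powr_mono2) (auto intro!: integral_nonneg_AE)
  also have "\<dots> = 2 * c powr (1 / t)" using c0 t by (simp add: powr_mult powr_powr)
  finally show "Lp_norm t K v \<le> 2 * Lp_norm t K f" by (simp add: Lp_norm_K c_def)
qed

text \<open>The factor 1/2 of the quadratic form is given away in the error term, which uses that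
  \<open>e\<close> is nonnegative; this holds because \<open>\<Omega>\<close> is nonempty.\<close>

lemma energy_change_coefficients:
  assumes F: "F \<in> C0_sym_pos \<Omega>" "G \<in> C0_sym_pos \<Omega>" and v: "wgrad v g" "admissible v"
    and e: "\<And>x. x \<in> \<Omega> \<Longrightarrow> norm (F x - G x) \<le> e"
  shows "energy F v g \<le> energy G v g + e * (l2norm \<mu> g)\<^sup>2"
proof -
  note g = has_weak_gradientD(2)[OF v(1)]
  have pw: "(F x *v Q) \<bullet> Q \<le> (G x *v Q) \<bullet> Q + e * (norm Q)\<^sup>2" if "x \<in> \<Omega>" for x Q
  proof -
    have "(F x *v Q) \<bullet> Q - (G x *v Q) \<bullet> Q = ((F x - G x) *v Q) \<bullet> Q"
      by (simp add: matrix_vector_mult_diff_rdistrib inner_diff_left)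
    also have "\<dots> \<le> norm (F x - G x) * (norm Q)\<^sup>2" using quadratic_form_le[of "F x - G x" Q] by simp
    also have "\<dots> \<le> e * (norm Q)\<^sup>2" by (intro mult_right_mono e that) auto
    finally show ?thesis by simp
  qed
  have "(\<integral>x. (F x *v g x) \<bullet> g x \<partial>\<mu>) \<le> (\<integral>x. (G x *v g x) \<bullet> g x + e * (norm (g x))\<^sup>2 \<partial>\<mu>)"
    using quad_integrable[OF F(1) g] quad_integrable[OF F(2) g] L2_integrable[OF g]
    by (intro integral_mono) (auto simp: pw)
  also have "\<dots> = (\<integral>x. (G x *v g x) \<bullet> g x \<partial>\<mu>) + e * (l2norm \<mu> g)\<^sup>2"
    using quad_integrable[OF F(2) g] L2_integrable[OF g] by (simp add: l2norm_sq)
  finally have "(\<integral>x. (F x *v g x) \<bullet> g x \<partial>\<mu>) \<le> (\<integral>x. (G x *v g x) \<bullet> g x \<partial>\<mu>) + e * (l2norm \<mu> g)\<^sup>2" .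
  moreover have "0 \<le> e * (l2norm \<mu> g)\<^sup>2"
  proof -
    obtain x where "x \<in> \<Omega>" using lip by (auto simp: lipschitz_domain_def)
    then have "0 \<le> e" using e[of x] norm_ge_zero order_trans by blast
    then show ?thesis by simp
  qed
  ultimately show ?thesis using energy_eq[OF F(1) g v(2)] energy_eq[OF F(2) g v(2)] by linarith
qed

text \<open>Minimizers for the coefficients \<open>Fn n\<close> form a minimizing sequence for the limit coefficient \<open>F\<close>.\<close>

theorem minimizers_converge:
  assumes Fn: "\<And>n::nat. Fn n \<in> C0_sym_pos \<Omega>" and F: "F \<in> C0_sym_pos \<Omega>"
    and unif: "uniform_limit (closure \<Omega>) Fn F sequentially"
    and v: "\<And>n. is_min (Fn n) (v n) (g n)" and w: "is_min F w k"
  obtains r where "strict_mono (r :: nat \<Rightarrow> nat)"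
    "(\<lambda>n. W12_norm \<Omega> (\<lambda>x. v (r n) x - w x)) \<longlonglongrightarrow> 0"
proof -
  have V: "wgrad (v n) (g n)" "admissible (v n)" for n using v by (auto simp: is_min_def)
  have W: "wgrad w k" "admissible w" using w by (auto simp: is_min_def)
  obtain \<alpha> where al: "\<alpha> > 0" "\<And>x Q. x \<in> \<Omega> \<Longrightarrow> \<alpha> * (norm Q)\<^sup>2 \<le> (F x *v Q) \<bullet> Q"
    by (rule elliptic[OF F]) (rule that)
  define c where "c = energy F (\<lambda>x. 0) (\<lambda>x. 0)"
  have cn: "energy (Fn n) (v n) (g n) \<le> c" for n
    using is_min_le_0[OF v[of n]] by (simp add: c_def energy_0)
  have near: "\<forall>\<^sub>F n in sequentially. \<forall>x\<in>\<Omega>. norm (Fn n x - F x) \<le> e" if "e > 0" for e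
    using uniform_limitD[OF unif that] 
  proof eventually_elim
    case (elim n)
    then show ?case using closure_subset[of \<Omega>] by (auto simp: dist_norm intro: less_imp_le)
  qed
  \<comment> \<open>If the coefficients differ from \<open>F\<close> by at most
    \<open>\<alpha> / 4\<close>, then \<open>\<alpha>\<close> times the squared norm X of the
    gradient is at most 2c + (\<open>\<alpha>\<close> / 2) X. Absorbing the last term gives X <= 4c
    / \<open>\<alpha>\<close>.\<close>
  define G where "G = 4 * c / \<alpha>"
  have bnd: "(l2norm \<mu> (g n))\<^sup>2 \<le> G" if n: "\<forall>x\<in>\<Omega>. norm (Fn n x - F x) \<le> \<alpha> / 4" for n
  proof -
    have "\<alpha> * (l2norm \<mu> (g n))\<^sup>2 \<le> (\<integral>x. (F x *v g n x) \<bullet> g n x \<partial>\<mu>)"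
    proof -
      have "(\<integral>x. \<alpha> * (norm (g n x))\<^sup>2 \<partial>\<mu>) \<le> (\<integral>x. (F x *v g n x) \<bullet> g n x \<partial>\<mu>)"
        using L2_integrable[OF has_weak_gradientD(2)[OF V(1)[of n]]] quad_integrable[OF F has_weak_gradientD(2)[OF V(1)[of n]]]
        by (intro integral_mono) (auto simp: al(2))
      then show ?thesis by (simp add: l2norm_sq)
    qed
    also have "\<dots> \<le> 2 * energy F (v n) (g n)" using fidelity_le_energy(2)[OF F V, of n] by simp
    also have "\<dots> \<le> 2 * (energy (Fn n) (v n) (g n) + \<alpha> / 4 * (l2norm \<mu> (g n))\<^sup>2)"
      using energy_change_coefficients[OF F Fn[of n] V(1)[of n] V(2)[of n], of "\<alpha> / 4"] n by (simp add: norm_minus_commute)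
    also have "\<dots> \<le> 2 * c + \<alpha> / 2 * (l2norm \<mu> (g n))\<^sup>2" using cn[of n] by simp
    finally show ?thesis using al(1) by (simp add: G_def field_simps)
  qed
  define m where "m = energy F w k"
  \<comment> \<open>The two errors from exchanging coefficients add up to at most d times
    \<open>H\<close>; the summand 1 makes \<open>H\<close> positive, as the choice of d divides by
    it.\<close>
  define H where "H = G + (l2norm \<mu> k)\<^sup>2 + 1"
  have "c \<ge> 0" unfolding c_def by (rule energy_nonneg[OF F])
  then have Hpos: "H > 0" using al(1) by (simp add: H_def G_def add_nonneg_pos)
  have mle: "m \<le> energy F u l" if "wgrad u l" "admissible u" for u l
    using w that by (auto simp: is_min_def m_def)
  have lim: "(\<lambda>n. energy F (v n) (g n)) \<longlonglongrightarrow> m"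
  proof (rule LIMSEQ_I)
    fix e :: real assume e: "e > 0"
    define d where "d = min (\<alpha> / 4) (e / (2 * H))"
    have d: "d > 0" "d \<le> \<alpha> / 4" "d * H < e"
    proof -
      show "d > 0" "d \<le> \<alpha> / 4" using al(1) e Hpos by (auto simp: d_def)
      have "d * H \<le> e / (2 * H) * H" using Hpos by (intro mult_right_mono) (auto simp: d_def)
      then show "d * H < e" using e Hpos by simp
    qed
    obtain N where N: "\<And>n. n \<ge> N \<Longrightarrow> \<forall>x\<in>\<Omega>. norm (Fn n x - F x) \<le> d"
      using near[OF d(1)] by (auto simp: eventually_sequentially)
    have "norm (energy F (v n) (g n) - m) < e" if n: "n \<ge> N" for n
    proof -
      have "(l2norm \<mu> (g n))\<^sup>2 \<le> G" using N[OF n] d(2) by (intro bnd) (auto intro: order_trans)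
      then have b: "d * (l2norm \<mu> (g n))\<^sup>2 \<le> d * G" using d(1) by (intro mult_left_mono) auto
      \<comment> \<open>Minimality is available only for the coefficients \<open>Fn n\<close>: pass
        from \<open>F\<close> to \<open>Fn n\<close>, compare \<open>v n\<close> with w there, and
        pass back.\<close>
      have "energy F (v n) (g n) \<le> energy (Fn n) (v n) (g n) + d * (l2norm \<mu> (g n))\<^sup>2"
        using N[OF n] by (intro energy_change_coefficients F Fn V) (auto simp: norm_minus_commute)
      also have "energy (Fn n) (v n) (g n) \<le> energy (Fn n) w k" using v[of n] W by (auto simp: is_min_def)
      also have "energy (Fn n) w k \<le> energy F w k + d * (l2norm \<mu> k)\<^sup>2"
        using N[OF n] by (intro energy_change_coefficients F Fn W) auto
      finally have "energy F (v n) (g n) \<le> m + d * (l2norm \<mu> k)\<^sup>2 + d * G" using b by (simp add: m_def)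
      also have "\<dots> < m + e" using d by (simp add: H_def algebra_simps)
      finally show ?thesis using mle[OF V] by simp
    qed
    then show "\<exists>no. \<forall>n\<ge>no. norm (energy F (v n) (g n) - m) < e" by blast
  qed
  obtain r w' k' where r: "strict_mono (r :: nat \<Rightarrow> nat)" and w': "is_min F w' k'"
    and l: "(\<lambda>n. l2norm \<mu> (\<lambda>x. v (r n) x - w' x)) \<longlonglongrightarrow> 0" "(\<lambda>n. l2norm \<mu> (\<lambda>x. g (r n) x - k' x)) \<longlonglongrightarrow> 0"
    by (rule minimizing_sequence[OF F V lim mle], assumption, assumption) (rule that)
  have W': "wgrad w' k'" using w' by (auto simp: is_min_def)
  \<comment> \<open>Uniqueness identifies the limit with the minimizer w given in advance, so the
    limit does not depend on the subsequence.\<close>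
  have ae: "AE x in \<mu>. w' x = w x" by (rule is_min_unique[OF F w' w])
  have aek: "AE x in \<mu>. k' x = k x" by (rule weak_gradient_unique[OF W' W(1) ae])
  have "W12_norm \<Omega> (\<lambda>x. v (r n) x - w x) =
      sqrt ((l2norm \<mu> (\<lambda>x. v (r n) x - w' x))\<^sup>2 + (l2norm \<mu> (\<lambda>x. g (r n) x - k' x))\<^sup>2)" for n
  proof -
    note D = has_weak_gradientD[OF weak_gradient_diff[OF V(1)[of "r n"] W(1)]]
    note D' = has_weak_gradientD[OF weak_gradient_diff[OF V(1)[of "r n"] W']]
    have 1: "l2norm \<mu> (\<lambda>x. v (r n) x - w x) = l2norm \<mu> (\<lambda>x. v (r n) x - w' x)"
      using L2_measurable[OF D(1)] L2_measurable[OF D'(1)] ae by (intro l2norm_cong_AE) (auto elim: eventually_mono)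
    have 2: "l2norm \<mu> (\<lambda>x. g (r n) x - k x) = l2norm \<mu> (\<lambda>x. g (r n) x - k' x)"
      using L2_measurable[OF D(2)] L2_measurable[OF D'(2)] aek by (intro l2norm_cong_AE) (auto elim: eventually_mono)
    show ?thesis using W12_norm_eq[OF weak_gradient_diff[OF V(1)[of "r n"] W(1)]] 1 2 by simp
  qed
  moreover have "(\<lambda>n. sqrt ((l2norm \<mu> (\<lambda>x. v (r n) x - w' x))\<^sup>2 + (l2norm \<mu> (\<lambda>x. g (r n) x - k' x))\<^sup>2)) \<longlonglongrightarrow> sqrt (0\<^sup>2 + 0\<^sup>2)"
    by (intro tendsto_intros l)
  ultimately show ?thesis using that[OF r] by simp
qed

section \<open>Convexity of the data ball and the fixed point\<close>

lemma W12_seminormed: "seminormed_functions (W12 \<Omega>) (W12_norm \<Omega>)"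
proof
  show "(\<lambda>x. 0) \<in> W12 \<Omega>" using weak_gradient_zero by (auto simp: W12_def)
  show "(\<lambda>x. u x + v x) \<in> W12 \<Omega>" if "u \<in> W12 \<Omega>" "v \<in> W12 \<Omega>" for u v
    using weak_gradient_add[OF weak_gradient_works[OF that(1)] weak_gradient_works[OF that(2)]]
    unfolding W12_def by blast
  show "(\<lambda>x. c * u x) \<in> W12 \<Omega>" if "u \<in> W12 \<Omega>" for c u
    using weak_gradient_scaleR[OF weak_gradient_works[OF that]] unfolding W12_def by blast
  show "W12_norm \<Omega> (\<lambda>x. u x + v x) \<le> W12_norm \<Omega> u + W12_norm \<Omega> v" if uv: "u \<in> W12 \<Omega>" "v \<in> W12 \<Omega>" for u v
  proof -
    obtain g k where g: "wgrad u g" and k: "wgrad v k"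
      using uv by (auto simp: W12_def)
    note U = has_weak_gradientD[OF g] and V = has_weak_gradientD[OF k]
    have "W12_norm \<Omega> (\<lambda>x. u x + v x) = sqrt ((l2norm \<mu> (\<lambda>x. u x + v x))\<^sup>2 + (l2norm \<mu> (\<lambda>x. g x + k x))\<^sup>2)"
      by (rule W12_norm_eq[OF weak_gradient_add[OF g k]])
    also have "\<dots> \<le> sqrt ((l2norm \<mu> u + l2norm \<mu> v)\<^sup>2 + (l2norm \<mu> g + l2norm \<mu> k)\<^sup>2)"
      by (intro real_sqrt_le_mono add_mono power_mono l2norm_triangle U V l2norm_nonneg)
    also have "\<dots> \<le> sqrt ((l2norm \<mu> u)\<^sup>2 + (l2norm \<mu> g)\<^sup>2) + sqrt ((l2norm \<mu> v)\<^sup>2 + (l2norm \<mu> k)\<^sup>2)"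
      by (rule real_sqrt_sum_squares_triangle_ineq)
    finally show ?thesis by (simp add: W12_norm_eq[OF g] W12_norm_eq[OF k])
  qed
  show "W12_norm \<Omega> (\<lambda>x. c * u x) = \<bar>c\<bar> * W12_norm \<Omega> u" if u: "u \<in> W12 \<Omega>" for c u
  proof -
    obtain g where g: "wgrad u g" using u weak_gradient_works by blast
    have "W12_norm \<Omega> (\<lambda>x. c * u x) = sqrt ((\<bar>c\<bar> * l2norm \<mu> u)\<^sup>2 + (\<bar>c\<bar> * l2norm \<mu> g)\<^sup>2)"
      using W12_norm_eq[OF weak_gradient_scaleR[OF g]] l2norm_scaleR[of \<mu> c u] l2norm_scaleR[of \<mu> c g] by simp
    also have "\<dots> = sqrt (c\<^sup>2 * ((l2norm \<mu> u)\<^sup>2 + (l2norm \<mu> g)\<^sup>2))"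
      by (simp add: power_mult_distrib distrib_left)
    finally show ?thesis by (simp add: W12_norm_eq[OF g] real_sqrt_mult)
  qed
qed

text \<open>The t-th power of the norm is the integral of a convex function of the values of
  \<open>w\<close>, the form in which convexity of the ball is checked.\<close>

lemma data_ball_iff:
  assumes R: "R > 0" and w: "w \<in> W12 \<Omega>"
  shows "w \<in> data_ball \<Omega> K t R \<longleftrightarrow> integrable \<mu> (\<lambda>x. power_K w x) \<and>
    (\<integral>x. power_K w x \<partial>\<mu>) \<le> R powr t"
proof -
  obtain g where "wgrad w g" using w by (auto simp: W12_def)
  then have wL: "w \<in> L2 \<mu>" by (rule has_weak_gradientD)
  have i0: "0 \<le> (\<integral>x. power_K w x \<partial>\<mu>)" by (intro integral_nonneg_AE AE_I2) simp
  have "Lp_norm t K w \<le> R \<longleftrightarrow> (\<integral>x. power_K w x \<partial>\<mu>) \<le> R powr t"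
  proof
    assume "Lp_norm t K w \<le> R"
    then have "Lp_norm t K w powr t \<le> R powr t"
      using t by (intro powr_mono2) (auto simp: Lp_norm_def)
    then show "(\<integral>x. power_K w x \<partial>\<mu>) \<le> R powr t"
      using t i0 by (simp add: Lp_norm_K powr_powr)
  next
    assume "(\<integral>x. power_K w x \<partial>\<mu>) \<le> R powr t"
    then have "(\<integral>x. power_K w x \<partial>\<mu>) powr (1 / t) \<le> (R powr t) powr (1 / t)"
      using t i0 by (intro powr_mono2) auto
    then show "Lp_norm t K w \<le> R" using t R by (simp add: Lp_norm_K powr_powr)
  qed
  then show ?thesis using w Lp_K[OF wL] by (auto simp: data_ball_def)
qed

lemma data_ball_convex:
  assumes R: "R > 0" and u: "u \<in> data_ball \<Omega> K t R" and v: "v \<in> data_ball \<Omega> K t R"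
    and s: "0 \<le> s" "s \<le> 1"
  shows "(\<lambda>x. (1 - s) * u x + s * v x) \<in> data_ball \<Omega> K t R"
proof -
  interpret seminormed_functions "W12 \<Omega>" "W12_norm \<Omega>" by (rule W12_seminormed)
  have W: "u \<in> W12 \<Omega>" "v \<in> W12 \<Omega>" using u v by (auto simp: data_ball_def)
  then have c: "(\<lambda>x. (1 - s) * u x + s * v x) \<in> W12 \<Omega>" by (intro add_in scale_in)
  let ?p = "\<lambda>w x. power_K w x"
  have U: "integrable \<mu> (?p u)" "(\<integral>x. ?p u x \<partial>\<mu>) \<le> R powr t"
    and V: "integrable \<mu> (?p v)" "(\<integral>x. ?p v x \<partial>\<mu>) \<le> R powr t"
    using u v data_ball_iff[OF R W(1)] data_ball_iff[OF R W(2)] by auto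
  let ?b = "\<lambda>x. (1 - s) * ?p u x + s * ?p v x"
  have le: "?p (\<lambda>x. (1 - s) * u x + s * v x) x \<le> ?b x" for x
    using abs_powr_convex[of t s "u x" "v x"] s t by (cases "x \<in> K") auto
  have ib: "integrable \<mu> ?b" using U V by simp
  have ip: "integrable \<mu> (?p (\<lambda>x. (1 - s) * u x + s * v x))"
  proof (rule Bochner_Integration.integrable_bound[OF ib])
    have "(\<lambda>x. (1 - s) * u x + s * v x) \<in> borel_measurable \<mu>"
      using weak_gradient_works[OF c] has_weak_gradientD(1) L2_measurable by blast
    then show "?p (\<lambda>x. (1 - s) * u x + s * v x) \<in> borel_measurable \<mu>" using indicator_K_measurable by measurable
    show "AE x in \<mu>. norm (?p (\<lambda>x. (1 - s) * u x + s * v x) x) \<le> norm (?b x)"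
      by (intro AE_I2) (simp only: real_norm_def abs_of_nonneg[OF fidelity_nonneg], rule order_trans[OF le abs_ge_self])
  qed
  have "(\<integral>x. ?p (\<lambda>x. (1 - s) * u x + s * v x) x \<partial>\<mu>) \<le> (\<integral>x. ?b x \<partial>\<mu>)"
    by (intro integral_mono ip ib le)
  also have "\<dots> = (1 - s) * (\<integral>x. ?p u x \<partial>\<mu>) + s * (\<integral>x. ?p v x \<partial>\<mu>)" using U V by simp
  also have "\<dots> \<le> (1 - s) * R powr t + s * R powr t" using U V s by (intro add_mono mult_left_mono) auto
  also have "\<dots> = R powr t" by (simp add: algebra_simps)
  finally show ?thesis using data_ball_iff[OF R c] ip by simp
qed

text \<open>Both analytic hypotheses of \<open>schauder\<close> come from
  \<open>minimizers_converge\<close>: the continuity of \<open>\<D>\<close> supplies the uniform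
  convergence of the coefficients for \<open>cont\<close>, the precompactness supplies it for
  \<open>comp\<close>.\<close>

lemma fixed_point_in_ball:
  assumes R: "R > 0" "2 * Lp_norm t K f \<le> R"
    and \<D>: "\<D> \<in> W12 \<Omega> \<rightarrow> C0_sym_pos \<Omega>" "continuous_W12_C0 \<Omega> \<D>"
    and pre: "precompact_C0 \<Omega> (\<D> ` data_ball \<Omega> K t R)"
    and T: "\<And>w. w \<in> W12 \<Omega> \<Longrightarrow> is_unique_minimizer \<Omega> (\<lambda>v. J_functional \<Omega> K t lam \<D> w v f) (T w)"
  shows "\<exists>w \<in> data_ball \<Omega> K t R. ae_eq \<Omega> (T w) w"
proof -
  interpret seminormed_functions "W12 \<Omega>" "W12_norm \<Omega>" by (rule W12_seminormed)
  let ?B = "data_ball \<Omega> K t R"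
  have BW: "w \<in> W12 \<Omega>" if "w \<in> ?B" for w using that by (simp add: data_ball_def)
  have DC: "\<D> w \<in> C0_sym_pos \<Omega>" if "w \<in> W12 \<Omega>" for w using \<D>(1) that by auto
  have minB: "v \<in> ?B" if "F \<in> C0_sym_pos \<Omega>" "is_min F v g" for F v g
    using is_min_in_ball[OF that] R that(2) by (auto simp: data_ball_def W12_def is_min_def)
  have "\<exists>g. is_min (\<D> w) (T w) g" if "w \<in> W12 \<Omega>" for w
    using T[OF that] is_arg_min_iff[of \<D> w, OF DC[OF that]] by (auto simp: is_unique_minimizer_def)
  then obtain G where Tmin: "\<And>w. w \<in> W12 \<Omega> \<Longrightarrow> is_min (\<D> w) (T w) (G w)" by metis
  have TB: "T w \<in> ?B" if "w \<in> ?B" for w using minB[OF DC Tmin] BW that by blast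
  have cont: "(\<lambda>n. d (T (w n)) (T z)) \<longlonglongrightarrow> 0"
    if w: "\<And>n::nat. w n \<in> ?B" and z: "z \<in> ?B" and lim: "(\<lambda>n. d (w n) z) \<longlonglongrightarrow> 0" for w z
  proof -
    have unif: "uniform_limit (closure \<Omega>) (\<lambda>n. \<D> (w n)) (\<D> z) sequentially"
    proof (rule uniform_limitI)
      fix e :: real assume "e > 0"
      then obtain \<delta> where de: "\<delta> > 0" "\<forall>v \<in> W12 \<Omega>. W12_norm \<Omega> (\<lambda>x. v x - z x) < \<delta> \<longrightarrow>
        (\<forall>x \<in> closure \<Omega>. norm (\<D> v x - \<D> z x) < e)"
        using \<D>(2) BW[OF z] unfolding continuous_W12_C0_def by blast
      have "\<forall>\<^sub>F n in sequentially. d (w n) z < \<delta>" using order_tendstoD(2)[OF lim de(1)] .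
      then show "\<forall>\<^sub>F n in sequentially. \<forall>x\<in>closure \<Omega>. dist (\<D> (w n) x) (\<D> z x) < e"
        by eventually_elim (use de(2) BW[OF w] in \<open>auto simp: d_def dist_norm\<close>)
    qed
    \<comment> \<open>\<open>minimizers_converge\<close> gives convergence along a subsequence only,
      but towards a prescribed limit; applied to a subsequence staying away from \<open>T z\<close>
      it yields a contradiction.\<close>
    show ?thesis
    proof (rule ccontr)
      assume "\<not> (\<lambda>n. d (T (w n)) (T z)) \<longlonglongrightarrow> 0"
      then obtain e where e: "e > 0" "\<And>N. \<exists>n\<ge>N. \<not> norm (d (T (w n)) (T z) - 0) < e"
        unfolding LIMSEQ_iff by blast
      then have "\<exists>\<^sub>\<infinity>n. \<not> norm (d (T (w n)) (T z) - 0) < e" by (simp add: INFM_nat_le)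
      then obtain q where q: "strict_mono (q :: nat \<Rightarrow> nat)" "\<And>n. \<not> norm (d (T (w (q n))) (T z) - 0) < e"
        using infinite_enumerate[of "{n. \<not> norm (d (T (w n)) (T z) - 0) < e}"]
        by (auto simp: INFM_iff_infinite)
      have "uniform_limit (closure \<Omega>) (\<lambda>n. \<D> (w (q n))) (\<D> z) sequentially"
        using filterlim_compose[OF unif filterlim_subseq[OF q(1)]] by simp
      from minimizers_converge[OF DC[OF BW[OF w]] DC[OF BW[OF z]] this Tmin[OF BW[OF w]] Tmin[OF BW[OF z]]]
      obtain r where "strict_mono (r :: nat \<Rightarrow> nat)" "(\<lambda>n. d (T (w (q (r n)))) (T z)) \<longlonglongrightarrow> 0"
        unfolding d_def by blast
      from LIMSEQ_D[OF this(2) e(1)] show False using q(2) by blast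
    qed
  qed
  have comp: "\<exists>z\<in>?B. \<exists>r::nat \<Rightarrow> nat. strict_mono r \<and> (\<lambda>n. d (T (w (r n))) z) \<longlonglongrightarrow> 0"
    if w: "\<And>n::nat. w n \<in> ?B" for w
  proof -
    have "range (\<lambda>n. \<D> (w n)) \<subseteq> \<D> ` ?B" using w by auto
    then obtain F p where F: "F \<in> C0_sym_pos \<Omega>" and p: "strict_mono (p :: nat \<Rightarrow> nat)"
      "uniform_limit (closure \<Omega>) ((\<lambda>n. \<D> (w n)) \<circ> p) F sequentially"
      using pre unfolding precompact_C0_def by blast
    \<comment> \<open>The limit coefficient \<open>F\<close> need not be a value of
      \<open>\<D>\<close>, so the limit z need not be a value of \<open>T\<close>; as a minimizer
      for \<open>F\<close> it still lies in the ball.\<close>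
    obtain z k where z: "is_min F z k" by (rule is_min_exists[OF F])
    have "uniform_limit (closure \<Omega>) (\<lambda>n. \<D> (w (p n))) F sequentially" using p(2) by (simp add: o_def)
    from minimizers_converge[OF DC[OF BW[OF w]] F this Tmin[OF BW[OF w]] z]
    obtain r where r: "strict_mono (r :: nat \<Rightarrow> nat)" "(\<lambda>n. d (T (w (p (r n)))) z) \<longlonglongrightarrow> 0"
      unfolding d_def by blast
    then have "strict_mono (p \<circ> r)" using p(1) by (intro strict_mono_o)
    then show ?thesis using minB[OF F z] r(2) by (intro bexI[of _ z] exI[of _ "p \<circ> r"]) auto
  qed
  have "(\<lambda>x. 0) \<in> ?B" using data_ball_iff[OF R(1) zero_in] by simp
  then have "?B \<noteq> {}" by blast
  then obtain z where z: "z \<in> ?B" "d (T z) z = 0"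
    using schauder[of ?B T, OF _ _ data_ball_convex[OF R(1)] TB cont comp] BW by blast
  obtain g where g: "wgrad (\<lambda>x. T z x - z x) g"
    using diff_in[OF BW[OF TB[OF z(1)]] BW[OF z(1)]] by (auto simp: W12_def)
  have "l2norm \<mu> (\<lambda>x. T z x - z x) = 0"
    using z(2) W12_norm_eq[OF g] by (simp add: d_def sum_power2_eq_zero_iff)
  from L2_AE_zero[OF has_weak_gradientD(1)[OF g] this]
  have "ae_eq \<Omega> (T z) z" by (simp add: ae_eq_def)
  then show ?thesis using z(1) by blast
qed

end

text \<open>Minimizers are unique only up to null sets, so \<open>T\<close> is not determined as a
  function. The first conjunct shows that such operators exist, and the second holds for every
  choice of representatives, a fixed point being meant up to equality almost everywhere.\<close>

theorem theorem3p1: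
  fixes \<Omega> K :: "(real^2) set"
    and t lam :: real
    and f :: "real^2 \<Rightarrow> real"
    and \<D> :: "(real^2 \<Rightarrow> real) \<Rightarrow> real^2 \<Rightarrow> real^2^2"
  assumes "bounded \<Omega>" and "lipschitz_domain \<Omega>"
    and "K \<in> sets lebesgue" and "K \<subseteq> \<Omega>" and "emeasure lebesgue K > 0"
    and "t > 1" and "f \<in> Lp t K" and "lam > 0"
    and "\<D> \<in> W12 \<Omega> \<rightarrow> C0_sym_pos \<Omega>"
    and "continuous_W12_C0 \<Omega> \<D>"
    and "\<And>R. R > 0 \<Longrightarrow> precompact_C0 \<Omega> (\<D> ` data_ball \<Omega> K t R)"
  shows "(\<forall>w \<in> W12 \<Omega>. \<exists>v. is_unique_minimizer \<Omega> (\<lambda>v. J_functional \<Omega> K t lam \<D> w v f) v) \<and>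
    (\<forall>T. (\<forall>w \<in> W12 \<Omega>. is_unique_minimizer \<Omega> (\<lambda>v. J_functional \<Omega> K t lam \<D> w v f) (T w)) \<longrightarrow>
      (\<exists>R0>0. \<forall>R\<ge>R0. \<exists>w \<in> data_ball \<Omega> K t R. ae_eq \<Omega> (T w) w))"
proof -
  interpret data_functional \<Omega> K t lam f
    by unfold_locales (use assms in \<open>auto simp: lipschitz_domain_def\<close>)
  show ?thesis
  proof (intro conjI ballI allI impI)
    show "\<exists>v. is_unique_minimizer \<Omega> (\<lambda>v. J_functional \<Omega> K t lam \<D> w v f) v" if "w \<in> W12 \<Omega>" for w
      using assms(9) that by (intro exists_unique_minimizer) auto
    fix T assume T: "\<forall>w \<in> W12 \<Omega>. is_unique_minimizer \<Omega> (\<lambda>v. J_functional \<Omega> K t lam \<D> w v f) (T w)"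
    \<comment> \<open>The summand 1 keeps the radius positive also when \<open>f\<close> vanishes
      almost everywhere on \<open>K\<close>.\<close>
    define R0 where "R0 = 2 * Lp_norm t K f + 1"
    have R0: "R0 > 0" by (simp add: R0_def Lp_norm_def add_nonneg_pos)
    have "\<exists>w \<in> data_ball \<Omega> K t R. ae_eq \<Omega> (T w) w" if "R \<ge> R0" for R
      using that R0 T assms(9-11) by (intro fixed_point_in_ball[of R \<D> T]) (auto simp: R0_def)
    with R0 show "\<exists>R0>0. \<forall>R\<ge>R0. \<exists>w \<in> data_ball \<Omega> K t R. ae_eq \<Omega> (T w) w" by blast
  qed
qed

end
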